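(* Let $B\subseteq A$ be an inclusion of $C^*$-algebras. Assume that the primitive ideal space $\operatorname{Prim}(A)$ with the hull-kernel topology is semiregular. Then $B\subseteq A$ has the ideal intersection property if and only if it has the regular ideal intersection property.
   Context: A topological space is semiregular if it has a basis of regular open sets, where an open set is regular if it equals the interior of its closure. Ideals are closed and two-sided. For $X \subseteq A$, $X^\perp = \{a\in A : ax = xa = 0 \text{ for all } x\in X\}$; an ideal $J$ of $A$ is regular if $J = J^{\perp\perp}$. An inclusion of $C^*$-algebras $B\subseteq A$ means that $B$ is a $C^*$-subalgebra of $A$ containing an approximate unit for $A$. It has the ideal intersection property (respectively, the regular ideal intersection property) if $J\cap B\neq\{0\}$ for every non-zero ideal (respectively, every non-zero regular ideal) $J$ of $A$. *)

theory Defs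
  imports "HOL-Analysis.Analysis" "HOL-Library.Function_Algebras"
begin

section \<open>C*-algebras, ideals and inclusions\<close>

text \<open>Not necessarily unital; the zero algebra is allowed.\<close>

class cstar_algebra = real_normed_algebra + banach +
  fixes scaleC :: "complex \<Rightarrow> 'a \<Rightarrow> 'a"
    and star :: "'a \<Rightarrow> 'a"
  assumes scaleC_add_right: "scaleC c (x + y) = scaleC c x + scaleC c y"
    and scaleC_add_left: "scaleC (c + d) x = scaleC c x + scaleC d x"
    and scaleC_scaleC: "scaleC c (scaleC d x) = scaleC (c * d) x"
    and scaleR_scaleC: "scaleR r x = scaleC (complex_of_real r) x"
    and mult_scaleC_left: "scaleC c x * y = scaleC c (x * y)"
    and mult_scaleC_right: "x * scaleC c y = scaleC c (x * y)"
    and norm_scaleC: "norm (scaleC c x) = cmod c * norm x"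
    and star_add: "star (x + y) = star x + star y"
    and star_scaleC: "star (scaleC c x) = scaleC (cnj c) (star x)"
    and star_mult: "star (x * y) = star y * star x"
    and star_star: "star (star x) = x"
    and cstar_identity: "norm (star x * x) = (norm x)\<^sup>2"

definition complex_subspace :: "'a::cstar_algebra set \<Rightarrow> bool" where
  "complex_subspace S \<longleftrightarrow>
     0 \<in> S \<and> (\<forall>x\<in>S. \<forall>y\<in>S. x + y \<in> S) \<and> (\<forall>c. \<forall>x\<in>S. scaleC c x \<in> S)"

definition cstar_subalgebra :: "'a::cstar_algebra set \<Rightarrow> bool" where
  "cstar_subalgebra B \<longleftrightarrow>
     complex_subspace B \<and> closed B \<and> (\<forall>x\<in>B. \<forall>y\<in>B. x * y \<in> B) \<and> (\<forall>x\<in>B. star x \<in> B)"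

definition positive :: "'a::cstar_algebra \<Rightarrow> bool" where
  "positive a \<longleftrightarrow> (\<exists>x. a = star x * x)"

text \<open>
  A net in \<open>B\<close> is represented by its tail filter \<open>F\<close> on the algebra (the image of the
  order filter of the index set), so that the index set need not be mentioned.  An
  approximate unit is a net of positive elements of norm at most one; it is not
  required to be increasing.
\<close>

definition contains_approximate_unit :: "'a::cstar_algebra set \<Rightarrow> bool" where
  "contains_approximate_unit B \<longleftrightarrow>
     (\<exists>F. F \<noteq> bot \<and> (\<forall>\<^sub>F e in F. e \<in> B \<and> positive e \<and> norm e \<le> 1) \<and>
          (\<forall>a. ((\<lambda>e. e * a) \<longlongrightarrow> a) F \<and> ((\<lambda>e. a * e) \<longlongrightarrow> a) F))"

definition cstar_inclusion :: "'a::cstar_algebra set \<Rightarrow> bool" where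
  "cstar_inclusion B \<longleftrightarrow> cstar_subalgebra B \<and> contains_approximate_unit B"

definition closed_ideal :: "'a::cstar_algebra set \<Rightarrow> bool" where
  "closed_ideal J \<longleftrightarrow>
     complex_subspace J \<and> closed J \<and> (\<forall>a. \<forall>x\<in>J. a * x \<in> J \<and> x * a \<in> J)"

definition perp :: "'a::cstar_algebra set \<Rightarrow> 'a set" where
  "perp X = {a. \<forall>x\<in>X. a * x = 0 \<and> x * a = 0}"

definition regular_ideal :: "'a::cstar_algebra set \<Rightarrow> bool" where
  "regular_ideal J \<longleftrightarrow> closed_ideal J \<and> J = perp (perp J)"

definition ideal_intersection_property :: "'a::cstar_algebra set \<Rightarrow> bool" where
  "ideal_intersection_property B \<longleftrightarrow>
     (\<forall>J. closed_ideal J \<and> J \<noteq> {0} \<longrightarrow> J \<inter> B \<noteq> {0})"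

definition regular_ideal_intersection_property :: "'a::cstar_algebra set \<Rightarrow> bool" where
  "regular_ideal_intersection_property B \<longleftrightarrow>
     (\<forall>J. regular_ideal J \<and> J \<noteq> {0} \<longrightarrow> J \<inter> B \<noteq> {0})"


section \<open>Irreducible representations\<close>

text \<open>
  A Hilbert space is a linear subspace \<open>H\<close> of an ambient complex vector space, with an
  inner product \<open>ip\<close>, conjugate-linear in the first argument, that is only meaningful
  on \<open>H\<close>.  Using a carrier set makes it possible to quantify over Hilbert spaces inside
  a formula.
\<close>

locale complex_hilbert_space = vector_space scale
  for scale :: "complex \<Rightarrow> 'h::ab_group_add \<Rightarrow> 'h" +
  fixes H :: "'h set" and ip :: "'h \<Rightarrow> 'h \<Rightarrow> complex"
  assumes subspace_H: "subspace H"
    and ip_add: "x \<in> H \<Longrightarrow> y \<in> H \<Longrightarrow> z \<in> H \<Longrightarrow> ip x (y + z) = ip x y + ip x z"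
    and ip_scale: "x \<in> H \<Longrightarrow> y \<in> H \<Longrightarrow> ip x (scale c y) = c * ip x y"
    and ip_cnj: "x \<in> H \<Longrightarrow> y \<in> H \<Longrightarrow> ip y x = cnj (ip x y)"
    and ip_nonneg: "x \<in> H \<Longrightarrow> 0 \<le> Re (ip x x)"
    and ip_definite: "x \<in> H \<Longrightarrow> ip x x = 0 \<Longrightarrow> x = 0"
    and complete_H: "(\<forall>n. X n \<in> H) \<Longrightarrow>
          (\<forall>e>0. \<exists>N. \<forall>m\<ge>N. \<forall>n\<ge>N. sqrt (Re (ip (X m - X n) (X m - X n))) < e) \<Longrightarrow>
          \<exists>l\<in>H. (\<lambda>n. sqrt (Re (ip (X n - l) (X n - l)))) \<longlonglongrightarrow> 0"
begin

definition hnorm :: "'h \<Rightarrow> real" where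
  "hnorm x = sqrt (Re (ip x x))"

definition closed_subspace :: "'h set \<Rightarrow> bool" where
  "closed_subspace K \<longleftrightarrow> subspace K \<and> K \<subseteq> H \<and>
     (\<forall>X l. (\<forall>n. X n \<in> K) \<and> l \<in> H \<and> (\<lambda>n. hnorm (X n - l)) \<longlonglongrightarrow> 0 \<longrightarrow> l \<in> K)"

definition bounded_operator :: "('h \<Rightarrow> 'h) \<Rightarrow> bool" where
  "bounded_operator T \<longleftrightarrow>
     (\<forall>x\<in>H. T x \<in> H) \<and>
     (\<forall>x\<in>H. \<forall>y\<in>H. T (x + y) = T x + T y) \<and>
     (\<forall>c. \<forall>x\<in>H. T (scale c x) = scale c (T x)) \<and>
     (\<exists>C. \<forall>x\<in>H. hnorm (T x) \<le> C * hnorm x)"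

definition star_representation :: "('a::cstar_algebra \<Rightarrow> 'h \<Rightarrow> 'h) \<Rightarrow> bool" where
  "star_representation \<pi> \<longleftrightarrow>
     (\<forall>a. bounded_operator (\<pi> a)) \<and>
     (\<forall>a b. \<forall>x\<in>H. \<pi> (a + b) x = \<pi> a x + \<pi> b x) \<and>
     (\<forall>c a. \<forall>x\<in>H. \<pi> (scaleC c a) x = scale c (\<pi> a x)) \<and>
     (\<forall>a b. \<forall>x\<in>H. \<pi> (a * b) x = \<pi> a (\<pi> b x)) \<and>
     (\<forall>a. \<forall>x\<in>H. \<forall>y\<in>H. ip (\<pi> (star a) x) y = ip x (\<pi> a y))"

definition rep_kernel :: "('a::cstar_algebra \<Rightarrow> 'h \<Rightarrow> 'h) \<Rightarrow> 'a set" where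
  "rep_kernel \<pi> = {a. \<forall>x\<in>H. \<pi> a x = 0}"

definition irreducible_rep :: "('a::cstar_algebra \<Rightarrow> 'h \<Rightarrow> 'h) \<Rightarrow> bool" where
  "irreducible_rep \<pi> \<longleftrightarrow> star_representation \<pi> \<and> rep_kernel \<pi> \<noteq> UNIV \<and>
     (\<forall>K. closed_subspace K \<and> (\<forall>a. \<forall>x\<in>K. \<pi> a x \<in> K) \<longrightarrow> K = {0} \<or> K = H)"

end


section \<open>The primitive ideal space\<close>

definition primitive_by ::
  "(complex \<Rightarrow> 'h::ab_group_add \<Rightarrow> 'h) \<Rightarrow> 'h set \<Rightarrow> ('h \<Rightarrow> 'h \<Rightarrow> complex) \<Rightarrow>
   'a::cstar_algebra set \<Rightarrow> bool" where
  "primitive_by sc H ip P \<longleftrightarrow> complex_hilbert_space sc H ip \<and>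
     (\<exists>\<pi>. complex_hilbert_space.irreducible_rep sc H ip \<pi> \<and>
          P = complex_hilbert_space.rep_kernel H \<pi>)"

text \<open>
  Kernels of irreducible representations.  Since one cannot quantify over all types, the
  Hilbert spaces range over linear subspaces of \<open>'a \<Rightarrow> complex\<close> with pointwise operations,
  equipped with arbitrary complete inner products.  This loses nothing: see
  \<open>primitive_by_imp_Prim\<close> below, which covers Hilbert spaces of any type.
\<close>

definition Prim :: "'a::cstar_algebra set set" where
  "Prim = {P. \<exists>(H :: ('a \<Rightarrow> complex) set) ip. primitive_by (\<lambda>c f x. c * f x) H ip P}"

text \<open>The hull-kernel topology: the closed sets are the hulls.\<close>

definition hull_of :: "'a::cstar_algebra set \<Rightarrow> 'a set set" where
  "hull_of S = {P \<in> Prim. S \<subseteq> P}"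

definition hull_kernel_topology :: "'a::cstar_algebra set topology" where
  "hull_kernel_topology = topology (\<lambda>U. \<exists>S. U = Prim - hull_of S)"


section \<open>Semiregular spaces\<close>

definition regular_open :: "'b topology \<Rightarrow> 'b set \<Rightarrow> bool" where
  "regular_open X U \<longleftrightarrow> openin X U \<and> U = X interior_of (X closure_of U)"

definition semiregular_space :: "'b topology \<Rightarrow> bool" where
  "semiregular_space X \<longleftrightarrow>
     (\<exists>\<B>. (\<forall>V\<in>\<B>. regular_open X V) \<and> openin X = arbitrary union_of (\<lambda>V. V \<in> \<B>))"


section \<open>Well-definedness of the primitive ideal space\<close>

context complex_hilbert_space
begin

lemma H_simps [simp, intro]:
  "0 \<in> H"
  "x \<in> H \<Longrightarrow> y \<in> H \<Longrightarrow> x + y \<in> H"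
  "x \<in> H \<Longrightarrow> y \<in> H \<Longrightarrow> x - y \<in> H"
  "x \<in> H \<Longrightarrow> scale c x \<in> H"
  using subspace_H by (auto simp: subspace_0 subspace_add subspace_diff subspace_scale)

lemma ip_zero [simp]: "x \<in> H \<Longrightarrow> ip x 0 = 0"
  using ip_scale[of x 0 0] by simp

lemma ip_zero_left [simp]: "x \<in> H \<Longrightarrow> ip 0 x = 0"
  using ip_cnj[of x 0] by simp

lemma ip_diff: "x \<in> H \<Longrightarrow> y \<in> H \<Longrightarrow> z \<in> H \<Longrightarrow> ip x (y - z) = ip x y - ip x z"
  using ip_add[of x "y - z" z] by (simp add: algebra_simps)

lemma ip_diff_left: "x \<in> H \<Longrightarrow> y \<in> H \<Longrightarrow> z \<in> H \<Longrightarrow> ip (y - z) x = ip y x - ip z x"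
  using ip_cnj[of x "y - z"] ip_cnj[of x y] ip_cnj[of x z] by (simp add: ip_diff)

lemma ip_scale_left: "x \<in> H \<Longrightarrow> y \<in> H \<Longrightarrow> ip (scale c y) x = cnj c * ip y x"
  using ip_cnj[of x "scale c y"] ip_cnj[of x y] by (simp add: ip_scale)

lemma ip_self: "x \<in> H \<Longrightarrow> ip x x = complex_of_real (Re (ip x x))"
  using ip_cnj[of x x] by (metis Reals_cnj_iff of_real_Re)

lemma hnorm_sq: "x \<in> H \<Longrightarrow> (hnorm x)\<^sup>2 = Re (ip x x)"
  by (simp add: hnorm_def ip_nonneg)

lemma hnorm_nonneg [simp]: "x \<in> H \<Longrightarrow> 0 \<le> hnorm x"
  by (simp add: hnorm_def ip_nonneg)

lemma Cauchy_Schwarz: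
  assumes x: "x \<in> H" and y: "y \<in> H"
  shows "cmod (ip x y) \<le> hnorm x * hnorm y"
proof (cases "x = 0")
  case True
  then show ?thesis using y by (simp add: hnorm_def)
next
  case False
  define s where "s = Re (ip x x)"
  define c where "c = ip x y"
  have sx: "ip x x = complex_of_real s" using ip_self[OF x] by (simp add: s_def)
  have "s \<noteq> 0" using False ip_definite[OF x] sx by auto
  then have s: "s > 0" using ip_nonneg[OF x] by (simp add: s_def)
  define z where "z = scale (complex_of_real s) y - scale c x"
  have zH: "z \<in> H" using x y by (simp add: z_def)
  have yx: "ip y x = cnj c" using ip_cnj[OF x y] by (simp add: c_def)
  have "ip z z = complex_of_real s * (complex_of_real s * ip y y - c * cnj c)"
    using x y unfolding z_def
    by (simp add: ip_diff ip_diff_left ip_scale ip_scale_left sx yx c_def[symmetric] algebra_simps)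
  then have "Re (ip z z) = s * (s * Re (ip y y) - (cmod c)\<^sup>2)"
    by (simp add: complex_mult_cnj cmod_power2)
  then have "0 \<le> s * (s * Re (ip y y) - (cmod c)\<^sup>2)" using ip_nonneg[OF zH] by simp
  then have "(cmod c)\<^sup>2 \<le> s * Re (ip y y)" using s by (simp add: zero_le_mult_iff)
  also have "\<dots> = (hnorm x * hnorm y)\<^sup>2"
    using x y by (simp add: power_mult_distrib hnorm_sq s_def)
  finally show ?thesis
    unfolding c_def by (rule power2_le_imp_le) (simp add: x y)
qed

lemma closed_subspace_orth:
  assumes W: "W \<subseteq> H"
  shows "closed_subspace {h \<in> H. \<forall>w\<in>W. ip w h = 0}"
  unfolding closed_subspace_def
proof (intro conjI allI impI)
  show "subspace {h \<in> H. \<forall>w\<in>W. ip w h = 0}"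
    using W by (auto intro!: subspaceI simp: ip_add ip_scale subset_iff)
next
  fix X l
  assume asm: "(\<forall>n. X n \<in> {h \<in> H. \<forall>w\<in>W. ip w h = 0}) \<and> l \<in> H \<and> (\<lambda>n. hnorm (X n - l)) \<longlonglongrightarrow> 0"
  have "ip w l = 0" if w: "w \<in> W" for w
  proof -
    have wH: "w \<in> H" using w W by auto
    have "cmod (ip w l) \<le> hnorm w * hnorm (X n - l)" for n
    proof -
      have "ip w (X n - l) = - ip w l" using asm wH w by (simp add: ip_diff)
      then show ?thesis using Cauchy_Schwarz[OF wH, of "X n - l"] asm by simp
    qed
    moreover have "(\<lambda>n. hnorm w * hnorm (X n - l)) \<longlonglongrightarrow> 0"
      using asm by (auto intro: tendsto_mult_right_zero)
    ultimately have "cmod (ip w l) \<le> 0"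
      by (intro LIMSEQ_le_const) auto
    then show ?thesis by simp
  qed
  then show "l \<in> {h \<in> H. \<forall>w\<in>W. ip w h = 0}" using asm by auto
qed auto

lemma
  assumes "star_representation \<pi>"
  shows rep_in [simp]: "x \<in> H \<Longrightarrow> \<pi> a x \<in> H"
    and rep_mult: "x \<in> H \<Longrightarrow> \<pi> (a * b) x = \<pi> a (\<pi> b x)"
    and rep_adj: "x \<in> H \<Longrightarrow> y \<in> H \<Longrightarrow> ip (\<pi> (star a) x) y = ip x (\<pi> a y)"
    and rep_adj': "x \<in> H \<Longrightarrow> y \<in> H \<Longrightarrow> ip (\<pi> a x) y = ip x (\<pi> (star a) y)"
  using assms unfolding star_representation_def bounded_operator_def
  by (auto, metis star_star)

lemma rep_zero: "star_representation \<pi> \<Longrightarrow> \<pi> a 0 = 0"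
  unfolding star_representation_def bounded_operator_def
  by (metis H_simps(1) scale_zero_left)

lemma irreducible_orth:
  assumes irr: "irreducible_rep \<pi>" and W: "W \<subseteq> H" and inv: "\<And>a w. w \<in> W \<Longrightarrow> \<pi> a w \<in> W"
  shows "{h \<in> H. \<forall>w\<in>W. ip w h = 0} = {0} \<or> W \<subseteq> {0}"
proof -
  let ?K = "{h \<in> H. \<forall>w\<in>W. ip w h = 0}"
  have rep: "star_representation \<pi>" using irr by (simp add: irreducible_rep_def)
  have "\<pi> a x \<in> ?K" if "x \<in> ?K" for a x
    using that W inv rep by (auto simp: rep_adj[OF rep, symmetric] subset_iff)
  then have "?K = {0} \<or> ?K = H"
    using irr closed_subspace_orth[OF W] unfolding irreducible_rep_def by blast
  moreover have "W \<subseteq> {0}" if "?K = H"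
  proof
    fix w assume w: "w \<in> W"
    then have "w \<in> ?K" using W that by auto
    then show "w \<in> {0}" using w ip_definite by auto
  qed
  ultimately show ?thesis by blast
qed

lemma irreducible_cyclic:
  assumes irr: "irreducible_rep \<pi>"
  obtains v where "v \<in> H" "\<And>h. h \<in> H \<Longrightarrow> (\<And>a. ip (\<pi> a v) h = 0) \<Longrightarrow> h = 0"
proof -
  have rep: "star_representation \<pi>" using irr by (simp add: irreducible_rep_def)
  obtain a v where v: "v \<in> H" and av: "\<pi> a v \<noteq> 0"
    using irr unfolding irreducible_rep_def rep_kernel_def by auto
  let ?W = "range (\<lambda>a. \<pi> a v)"
  have "?W \<subseteq> H" using v rep by auto
  moreover have "\<pi> b w \<in> ?W" if "w \<in> ?W" for b w
    using that v by (auto simp: rep_mult[OF rep, symmetric])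
  ultimately have "{h \<in> H. \<forall>w\<in>?W. ip w h = 0} = {0}"
    using irreducible_orth[OF irr, of ?W] av by blast
  then show ?thesis using that[OF v] by blast
qed

lemma irreducible_kernel_prime:
  assumes irr: "irreducible_rep \<pi>" and s: "s \<notin> rep_kernel \<pi>" and t: "t \<notin> rep_kernel \<pi>"
  shows "\<exists>a. s * a * t \<notin> rep_kernel \<pi>"
proof (rule ccontr)
  have rep: "star_representation \<pi>" using irr by (simp add: irreducible_rep_def)
  assume "\<not> ?thesis"
  then have sat: "\<pi> s (\<pi> a (\<pi> t y)) = 0" if "y \<in> H" for a y
    using that rep by (auto simp: rep_kernel_def rep_mult)
  obtain y where y: "y \<in> H" and ty: "\<pi> t y \<noteq> 0" using t by (auto simp: rep_kernel_def)
  obtain z where z: "z \<in> H" and sz: "\<pi> s z \<noteq> 0" using s by (auto simp: rep_kernel_def)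
  have "\<pi> (star s) (\<pi> s z) \<noteq> 0"
  proof
    assume "\<pi> (star s) (\<pi> s z) = 0"
    then have "ip (\<pi> s z) (\<pi> s z) = 0" using z rep by (simp add: rep_adj')
    then show False using sz z rep ip_definite by auto
  qed
  then have uz: "\<pi> (star s) (\<pi> s z) \<noteq> 0" .
  let ?W = "{\<pi> a (\<pi> (star s) x) |a x. x \<in> H}"
  have W: "?W \<subseteq> H" using rep by auto
  have inv: "\<pi> b w \<in> ?W" if w: "w \<in> ?W" for b w
  proof -
    obtain a x where x: "x \<in> H" and w: "w = \<pi> a (\<pi> (star s) x)" using w by auto
    have "\<pi> b w = \<pi> (b * a) (\<pi> (star s) x)" using x rep by (simp add: w rep_mult)
    then show ?thesis using x by blast
  qed
  have "\<pi> t y \<in> {h \<in> H. \<forall>w\<in>?W. ip w h = 0}"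
  proof -
    have "ip (\<pi> a (\<pi> (star s) x)) (\<pi> t y) = 0" if x: "x \<in> H" for a x
      using sat[OF y, of "star a"] x y rep by (simp add: rep_adj' star_star)
    then show ?thesis using y rep by auto
  qed
  then have W0: "?W \<subseteq> {0}" using irreducible_orth[OF irr W inv] ty by blast
  let ?u = "\<pi> (star s) (\<pi> s z)"
  let ?V = "{\<pi> a x |a x. x \<in> H}"
  have "?V \<subseteq> H" using rep by auto
  moreover have "\<pi> b w \<in> ?V" if w: "w \<in> ?V" for b w
    using w rep_in[OF rep] by blast
  moreover have "ip (\<pi> a x) ?u = 0" if x: "x \<in> H" for a x
  proof -
    have "\<pi> (star a) ?u \<in> ?W" using rep_in[OF rep z] by blast
    then have "\<pi> (star a) ?u = 0" using W0 by blast
    then show ?thesis using x z rep by (simp add: rep_adj')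
  qed
  then have "?u \<in> {h \<in> H. \<forall>w\<in>?V. ip w h = 0}" using z rep by auto
  ultimately have "?V \<subseteq> {0}" using irreducible_orth[OF irr, of ?V] uz by blast
  then show False using sz z by blast
qed

end

lemma Prim_prime:
  assumes "P \<in> Prim" "s \<notin> P" "t \<notin> P"
  shows "\<exists>a. s * a * t \<notin> P"
  using assms unfolding Prim_def primitive_by_def
  by (auto dest: complex_hilbert_space.irreducible_kernel_prime)

lemma Prim_ideal:
  assumes "P \<in> Prim" "x \<in> P"
  shows "a * x \<in> P" "x * a \<in> P"
proof -
  from assms(1) obtain H :: "('a \<Rightarrow> complex) set" and ip \<pi>
    where hs: "complex_hilbert_space (\<lambda>c f x. c * f x) H ip"
      and irr: "complex_hilbert_space.irreducible_rep (\<lambda>c f x. c * f x) H ip \<pi>"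
      and P: "P = complex_hilbert_space.rep_kernel H \<pi>"
    unfolding Prim_def primitive_by_def by auto
  interpret complex_hilbert_space "\<lambda>c f x. c * f x" H ip by (rule hs)
  have rep: "star_representation \<pi>" using irr by (simp add: irreducible_rep_def)
  show "a * x \<in> P" "x * a \<in> P"
    using assms(2) rep by (auto simp: P rep_kernel_def rep_mult rep_zero)
qed

lemma Prim_proper: "P \<in> Prim \<Longrightarrow> P \<noteq> UNIV"
  unfolding Prim_def primitive_by_def
  by (auto simp: complex_hilbert_space.irreducible_rep_def)

lemma istopology_hull_kernel: "istopology (\<lambda>U. \<exists>S. U = Prim - hull_of (S::'a::cstar_algebra set))"
  unfolding istopology_def
proof (intro conjI allI impI)
  fix U V :: "'a set set"
  assume "\<exists>S. U = Prim - hull_of S" "\<exists>S. V = Prim - hull_of S"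
  then obtain S T where U: "U = Prim - hull_of S" and V: "V = Prim - hull_of T" by blast
  have "U \<inter> V = Prim - hull_of {s * a * t |s a t. s \<in> S \<and> t \<in> T}" (is "_ = Prim - hull_of ?R")
  proof (intro equalityI subsetI)
    fix P assume "P \<in> U \<inter> V"
    then obtain s t where "P \<in> Prim" "s \<in> S" "s \<notin> P" "t \<in> T" "t \<notin> P"
      by (auto simp: U V hull_of_def)
    then show "P \<in> Prim - hull_of ?R"
      using Prim_prime[of P s t] by (fastforce simp: hull_of_def)
  next
    fix P assume "P \<in> Prim - hull_of ?R"
    then obtain s a t where "P \<in> Prim" "s \<in> S" "t \<in> T" "s * a * t \<notin> P"
      by (auto simp: hull_of_def)
    moreover from this have "s \<notin> P" "t \<notin> P" by (auto dest: Prim_ideal)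
    ultimately show "P \<in> U \<inter> V" by (auto simp: U V hull_of_def)
  qed
  then show "\<exists>S. U \<inter> V = Prim - hull_of S" by blast
next
  fix \<U> :: "'a set set set"
  assume "\<forall>U\<in>\<U>. \<exists>S. U = Prim - hull_of S"
  then obtain S where S: "\<And>U. U \<in> \<U> \<Longrightarrow> U = Prim - hull_of (S U)" by metis
  have "\<Union>\<U> = (\<Union>U\<in>\<U>. Prim - hull_of (S U))" using S by blast
  also have "\<dots> = Prim - hull_of (\<Union>U\<in>\<U>. S U)"
    by (auto simp: hull_of_def)
  finally show "\<exists>S. \<Union>\<U> = Prim - hull_of S" by blast
qed

lemma openin_hull_kernel:
  "openin hull_kernel_topology U \<longleftrightarrow> (\<exists>S. U = Prim - hull_of S)"
  unfolding hull_kernel_topology_def by (simp add: topology_inverse'[OF istopology_hull_kernel])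

lemma topspace_hull_kernel [simp]: "topspace hull_kernel_topology = Prim"
proof -
  have "Prim = Prim - hull_of UNIV"
    using Prim_proper by (auto simp: hull_of_def)
  then have "openin hull_kernel_topology Prim" unfolding openin_hull_kernel by blast
  moreover have "topspace hull_kernel_topology \<subseteq> Prim"
    by (auto simp: topspace_def openin_hull_kernel)
  ultimately show ?thesis by (metis openin_subset subset_antisym)
qed

lemma closure_of_hull_kernel:
  assumes "R \<subseteq> Prim"
  shows "hull_kernel_topology closure_of R = hull_of (\<Inter>R)"
proof -
  have cl: "closedin hull_kernel_topology (hull_of S)" for S :: "'a set"
    unfolding closedin_def openin_hull_kernel by (auto simp: hull_of_def)
  have "R \<subseteq> hull_of (\<Inter>R)" using assms by (auto simp: hull_of_def)
  then have "hull_kernel_topology closure_of R \<subseteq> hull_of (\<Inter>R)"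
    by (rule closure_of_minimal) (rule cl)
  moreover have "hull_of (\<Inter>R) \<subseteq> C" if "closedin hull_kernel_topology C" "R \<subseteq> C" for C
  proof -
    have "C \<subseteq> Prim" and "openin hull_kernel_topology (Prim - C)"
      using that(1) by (simp_all add: closedin_def)
    moreover from this obtain S where "Prim - C = Prim - hull_of S"
      unfolding openin_hull_kernel by blast
    ultimately have "C = hull_of S" by (auto simp: hull_of_def)
    then show ?thesis using that(2) by (auto simp: hull_of_def)
  qed
  ultimately show ?thesis
    by (metis assms closedin_closure_of closure_of_subset subset_antisym topspace_hull_kernel)
qed

text \<open>
  The kernel of an irreducible representation on any Hilbert space \<open>H\<close> is in \<open>Prim\<close>: if \<open>v\<close>
  is a cyclic vector, then \<open>x \<mapsto> (\<lambda>a. ip (\<pi> a v) x)\<close> embeds \<open>H\<close> linearly into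
  \<open>'a \<Rightarrow> complex\<close>.
\<close>

lemma primitive_by_imp_Prim:
  fixes H :: "'h::ab_group_add set" and P :: "'a::cstar_algebra set"
  assumes "primitive_by sc H ip P"
  shows "P \<in> Prim"
proof -
  from assms obtain \<pi> where hs: "complex_hilbert_space sc H ip"
      and irr: "complex_hilbert_space.irreducible_rep sc H ip \<pi>"
      and P: "P = complex_hilbert_space.rep_kernel H \<pi>"
    unfolding primitive_by_def by auto
  interpret complex_hilbert_space sc H ip by (rule hs)
  have rep: "star_representation \<pi>" using irr by (simp add: irreducible_rep_def)
  obtain v where v: "v \<in> H" and cyc: "\<And>h. h \<in> H \<Longrightarrow> (\<And>a. ip (\<pi> a v) h = 0) \<Longrightarrow> h = 0"
    using irreducible_cyclic[OF irr] by blast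
  define T :: "'h \<Rightarrow> 'a \<Rightarrow> complex" where "T x = (\<lambda>a. ip (\<pi> a v) x)" for x
  have avH: "\<pi> a v \<in> H" for a using v rep by simp
  have T_add: "T (x + y) = T x + T y" if "x \<in> H" "y \<in> H" for x y
    using that avH by (auto simp: T_def ip_add fun_eq_iff)
  have T_diff: "T (x - y) = T x - T y" if "x \<in> H" "y \<in> H" for x y
    using that avH by (auto simp: T_def ip_diff fun_eq_iff)
  have T_scale: "T (sc c x) = (\<lambda>a. c * T x a)" if "x \<in> H" for c x
    using that avH by (auto simp: T_def ip_scale fun_eq_iff)
  have T_0: "T 0 = 0" using avH by (auto simp: T_def fun_eq_iff)
  have inj: "inj_on T H"
  proof (rule inj_onI)
    fix x y assume xy: "x \<in> H" "y \<in> H" "T x = T y"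
    then have "T (x - y) = 0" by (simp add: T_diff)
    then have "x - y = 0" using xy by (intro cyc) (auto simp: T_def fun_eq_iff)
    then show "x = y" by simp
  qed
  define G where "G = inv_into H T"
  have GT [simp]: "G (T x) = x" if "x \<in> H" for x
    using that inj by (simp add: G_def)
  define ip' where "ip' f g = ip (G f) (G g)" for f g
  define \<rho> where "\<rho> a f = T (\<pi> a (G f))" for a f
  let ?fsc = "\<lambda>(c::complex) (f::'a \<Rightarrow> complex) x. c * f x"
  have vs: "vector_space ?fsc"
    by unfold_locales (auto simp: fun_eq_iff algebra_simps)
  interpret F: vector_space ?fsc by (rule vs)
  have sub: "F.subspace (T ` K)" if K: "subspace K" "K \<subseteq> H" for K
  proof (rule F.subspaceI)
    show "0 \<in> T ` K" using K T_0 subspace_0 by (metis image_eqI)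
  next
    fix f g assume "f \<in> T ` K" "g \<in> T ` K"
    then obtain x y where xy: "x \<in> K" "y \<in> K" "f = T x" "g = T y" by blast
    then have "f + g = T (x + y)" using K T_add by (metis subsetD)
    then show "f + g \<in> T ` K" using xy K subspace_add by blast
  next
    fix c f assume "f \<in> T ` K"
    then obtain x where x: "x \<in> K" "f = T x" by blast
    then have "(\<lambda>a. c * f a) = T (sc c x)" using K T_scale by (metis subsetD)
    then show "(\<lambda>a. c * f a) \<in> T ` K" using x K subspace_scale by blast
  qed
  have hs': "complex_hilbert_space ?fsc (T ` H) ip'"
  proof (rule complex_hilbert_space.intro[OF vs], unfold_locales)
    show "F.subspace (T ` H)" using sub subspace_H by blast
  next
    fix f g h assume "f \<in> T ` H" "g \<in> T ` H" "h \<in> T ` H"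
    then show "ip' f (g + h) = ip' f g + ip' f h"
      by (auto simp: ip'_def T_add[symmetric] ip_add)
  next
    fix f g c assume "f \<in> T ` H" "g \<in> T ` H"
    then show "ip' f (\<lambda>x. c * g x) = c * ip' f g"
      by (auto simp: ip'_def T_scale[symmetric] ip_scale)
  next
    fix f g assume "f \<in> T ` H" "g \<in> T ` H"
    then show "ip' g f = cnj (ip' f g)" by (auto simp: ip'_def intro: ip_cnj)
  next
    fix f assume "f \<in> T ` H"
    then show "0 \<le> Re (ip' f f)" by (auto simp: ip'_def ip_nonneg)
  next
    fix f assume "f \<in> T ` H" "ip' f f = 0"
    then obtain x where "x \<in> H" "f = T x" "ip x x = 0" by (auto simp: ip'_def)
    then show "f = 0" using ip_definite[of x] T_0 by simp
  next
    fix X :: "nat \<Rightarrow> 'a \<Rightarrow> complex"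
    assume X: "\<forall>n. X n \<in> T ` H"
      and cau: "\<forall>e>0. \<exists>N. \<forall>m\<ge>N. \<forall>n\<ge>N. sqrt (Re (ip' (X m - X n) (X m - X n))) < e"
    have "\<forall>n. \<exists>y. y \<in> H \<and> X n = T y" using X by blast
    then obtain Y where "\<forall>n. Y n \<in> H \<and> X n = T (Y n)" by (rule choice[THEN exE])
    then have Y: "Y n \<in> H" "X n = T (Y n)" for n by auto
    have eq: "ip' (X m - T l) (X m - T l) = ip (Y m - l) (Y m - l)" if "l \<in> H" for m l
      using that Y(1)[of m] by (simp add: ip'_def Y(2)[of m] T_diff[symmetric])
    have eq': "ip' (X m - X n) (X m - X n) = ip (Y m - Y n) (Y m - Y n)" for m n
      using eq[OF Y(1)[of n], of m] by (simp only: Y(2)[of n])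
    have "\<forall>e>0. \<exists>N. \<forall>m\<ge>N. \<forall>n\<ge>N. sqrt (Re (ip (Y m - Y n) (Y m - Y n))) < e"
      using cau by (simp only: eq')
    then obtain l where "l \<in> H" "(\<lambda>n. sqrt (Re (ip (Y n - l) (Y n - l)))) \<longlonglongrightarrow> 0"
      using complete_H[of Y] Y by blast
    then show "\<exists>l\<in>T ` H. (\<lambda>n. sqrt (Re (ip' (X n - l) (X n - l)))) \<longlonglongrightarrow> 0"
      by (auto simp: eq)
  qed
  interpret C: complex_hilbert_space ?fsc "T ` H" ip' by (rule hs')
  have hn: "C.hnorm (T x) = hnorm x" if "x \<in> H" for x
    using that by (simp add: C.hnorm_def hnorm_def ip'_def)
  have rT: "\<rho> a (T x) = T (\<pi> a x)" if "x \<in> H" for a x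
    using that by (simp add: \<rho>_def)
  have bo: "bounded_operator (\<pi> a)" for a using rep by (simp add: star_representation_def)
  have "C.bounded_operator (\<rho> a)" for a
    using bo[of a] unfolding C.bounded_operator_def bounded_operator_def
    by (auto simp: rT T_add[symmetric] T_scale[symmetric] hn)
  then have Crep: "C.star_representation \<rho>"
    using rep unfolding C.star_representation_def
    by (auto simp: rT ip'_def rep_adj rep_mult)
       (auto simp: star_representation_def rT T_add T_scale)
  have ker: "C.rep_kernel \<rho> = P"
  proof -
    have "T (\<pi> a x) = 0 \<longleftrightarrow> \<pi> a x = 0" if "x \<in> H" for a x
      using that inj rep T_0 by (metis GT rep_in H_simps(1))
    then show ?thesis by (auto simp: P C.rep_kernel_def rep_kernel_def rT)
  qed
  have "K = {0} \<or> K = T ` H"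
    if K: "C.closed_subspace K" "\<forall>a. \<forall>x\<in>K. \<rho> a x \<in> K" for K
  proof -
    define L where "L = {x \<in> H. T x \<in> K}"
    have KH: "K \<subseteq> T ` H" and Ks: "F.subspace K"
      using K(1) by (auto simp: C.closed_subspace_def)
    have KL: "K = T ` L" using KH by (auto simp: L_def)
    have "subspace L"
      using Ks by (auto intro!: subspaceI simp: L_def T_0 T_add T_scale
          F.subspace_0 F.subspace_add F.subspace_scale)
    moreover have "l \<in> L"
      if X: "\<forall>n. X n \<in> L" and l: "l \<in> H" and lim: "(\<lambda>n. hnorm (X n - l)) \<longlonglongrightarrow> 0" for X l
    proof -
      have XH: "X n \<in> H" "T (X n) \<in> K" for n using X by (auto simp: L_def)
      have "(\<lambda>n. C.hnorm (T (X n) - T l)) \<longlonglongrightarrow> 0"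
        using lim XH l by (simp add: T_diff[symmetric] hn)
      then have "(\<forall>n. T (X n) \<in> K) \<and> T l \<in> T ` H \<and> (\<lambda>n. C.hnorm (T (X n) - T l)) \<longlonglongrightarrow> 0"
        using XH l by simp
      moreover have "\<forall>Z z. (\<forall>n. Z n \<in> K) \<and> z \<in> T ` H \<and> (\<lambda>n. C.hnorm (Z n - z)) \<longlonglongrightarrow> 0 \<longrightarrow> z \<in> K"
        using K(1) unfolding C.closed_subspace_def by (elim conjE)
      ultimately have "T l \<in> K"
        by (elim allE[of _ "\<lambda>n. T (X n)"] allE[of _ "T l"] mp)
      then show ?thesis using l by (simp add: L_def)
    qed
    ultimately have "closed_subspace L" unfolding closed_subspace_def by (auto simp: L_def)
    moreover have "\<pi> a x \<in> L" if "x \<in> L" for a x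
      using that K(2) rep by (auto simp: L_def rT[symmetric])
    ultimately have "L = {0} \<or> L = H" using irr unfolding irreducible_rep_def by blast
    then show ?thesis using KL T_0 by auto
  qed
  moreover have "C.rep_kernel \<rho> \<noteq> UNIV"
    using irr by (simp add: ker P irreducible_rep_def)
  ultimately have "C.irreducible_rep \<rho>" using Crep unfolding C.irreducible_rep_def by blast
  then have "primitive_by ?fsc (T ` H) ip' P"
    unfolding primitive_by_def using hs' ker by blast
  then show ?thesis unfolding Prim_def by blast
qed

end

theory Submission
  imports Defs
begin

text \<open>
  The hypothesis on \<open>Prim\<close> is used to find, inside any non-zero closed ideal \<open>J\<close>, a non-zero
  regular ideal: if \<open>V\<close> is a non-empty regular open subset of \<open>Prim - hull_of J\<close>, then
  \<open>I = \<Inter>(Prim - V)\<close> is regular because \<open>perp (\<Inter>(Prim - W)) = \<Inter>W\<close> for every open \<open>W\<close>, and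
  \<open>I \<subseteq> J\<close> because a closed ideal is the intersection of the primitive ideals containing it.

  The last fact needs an irreducible representation that annihilates \<open>J\<close> but not a given
  \<open>x \<notin> J\<close>.  It is the GNS representation, on the unitization, of an extreme point of the set of
  states vanishing on \<open>J\<close> that is positive at \<open>x\<^sup>* x\<close>.
\<close>

section \<open>Extreme linear functionals below a sublinear functional\<close>

text \<open>Spectrum, functional calculus and quotient algebras are avoided: order is described by
  norms (\<open>nonneg\<close>), square roots come from the power series of 1 - sqrt (1 - x), and an
  inequality modulo J means that some j in J may be added. The unitization provides the order unit 1
  that makes \<open>upper_bound J\<close> finite. The crux is
  \<open>mem_closed_ideal_if_dominated\<close>: if \<open>star x * x\<close> is at most eps modulo J
  for every eps > 0, then x lies in J. Contrapositively, \<open>upper_bound J\<close> is positive at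
  \<open>star x * x\<close> when x is outside J, so a linear functional below it that attains this
  value does not vanish there. Its extremality makes the GNS representation irreducible. On the
  topological side, the annihilator formula rests on two facts: primitive ideals are prime, and
  their intersection is 0. Since the closure of a set of primitive ideals has the same intersection
  as the set, V = int (cl V) turns into equality of the ideal with its double annihilator.\<close>

definition sublinear :: "('v::real_vector \<Rightarrow> real) \<Rightarrow> bool" where
  "sublinear p \<longleftrightarrow> (\<forall>x y. p (x + y) \<le> p x + p y) \<and> (\<forall>t\<ge>0. \<forall>x. p (t *\<^sub>R x) = t * p x)"

lemma sublinear_add: "sublinear p \<Longrightarrow> p (x + y) \<le> p x + p y"
  and sublinear_scale: "sublinear p \<Longrightarrow> 0 \<le> t \<Longrightarrow> p (t *\<^sub>R x) = t * p x"
  by (auto simp: sublinear_def)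

lemma sublinear_zero: "sublinear p \<Longrightarrow> p 0 = 0"
  using sublinear_scale[of p 0 0] by simp

lemma sublinear_minus: "sublinear p \<Longrightarrow> - p (- x) \<le> p x"
  using sublinear_add[of p x "- x"] sublinear_zero[of p] by simp

text \<open>The inequality \<open>scale\<close>, applied with 1/t to t x, yields the reverse
  inequality.\<close>

lemma sublinearI:
  assumes add: "\<And>x y. p (x + y) \<le> p x + p y"
    and scale: "\<And>t x. 0 < t \<Longrightarrow> p (t *\<^sub>R x) \<le> t * p x" and zero: "p 0 = 0"
  shows "sublinear p"
proof -
  have "p (t *\<^sub>R x) = t * p x" if "t \<ge> 0" for t x
  proof (cases "t = 0")
    case False
    then have t: "t > 0" using that by simp
    have "t * p x = t * p ((1 / t) *\<^sub>R (t *\<^sub>R x))" using t by simp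
    also have "\<dots> \<le> p (t *\<^sub>R x)" using scale[of "1 / t" "t *\<^sub>R x"] t by (simp add: field_simps)
    finally show ?thesis using scale[OF t, of x] by simp
  qed (simp add: zero)
  then show ?thesis using add by (simp add: sublinear_def)
qed

text \<open>The linear functionals below \<open>r\<close> are exactly those g below \<open>q\<close>
  with g y = q y, that is, the face on which evaluation at y is maximal.\<close>

lemma sublinear_INF_ray:
  fixes q :: "'v::real_vector \<Rightarrow> real" and y :: 'v
  assumes q: "sublinear q"
  defines "r \<equiv> \<lambda>x. INF t\<in>{0..}. q (x + t *\<^sub>R y) - t * q y"
  shows "sublinear r" "\<And>x t. t \<ge> 0 \<Longrightarrow> r x \<le> q (x + t *\<^sub>R y) - t * q y"
proof -
  have low: "- q (- x) \<le> q (x + t *\<^sub>R y) - t * q y" if "t \<ge> 0" for x t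
    using sublinear_add[OF q, of "x + t *\<^sub>R y" "- x"] sublinear_scale[OF q that, of y] by simp
  then have bdd: "bdd_below ((\<lambda>t. q (x + t *\<^sub>R y) - t * q y) ` {0..})" for x
    by (intro bdd_belowI2[of _ "- q (- x)"]) auto
  show le: "r x \<le> q (x + t *\<^sub>R y) - t * q y" if "t \<ge> 0" for x t
    unfolding r_def using that bdd by (intro cINF_lower) auto
  have ge: "c \<le> r x" if "\<And>t. t \<ge> 0 \<Longrightarrow> c \<le> q (x + t *\<^sub>R y) - t * q y" for c x
    unfolding r_def using that by (intro cINF_greatest) auto
  have add: "r (x + z) \<le> r x + r z" for x z
  proof -
    have "r (x + z) - (q (z + s *\<^sub>R y) - s * q y) \<le> q (x + t *\<^sub>R y) - t * q y"
      if "t \<ge> 0" "s \<ge> 0" for s t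
      using le[of "t + s" "x + z"] sublinear_add[OF q, of "x + t *\<^sub>R y" "z + s *\<^sub>R y"] that
      by (simp add: algebra_simps)
    then have "r (x + z) - (q (z + s *\<^sub>R y) - s * q y) \<le> r x" if "s \<ge> 0" for s
      using that by (intro ge)
    then have "r (x + z) - r x \<le> q (z + s *\<^sub>R y) - s * q y" if "s \<ge> 0" for s
      using that by (auto simp: algebra_simps)
    then have "r (x + z) - r x \<le> r z" by (intro ge)
    then show ?thesis by simp
  qed
  have scale_le: "r (u *\<^sub>R x) \<le> u * r x" if u: "u > 0" for u x
  proof -
    have "r (u *\<^sub>R x) / u \<le> q (x + t *\<^sub>R y) - t * q y" if "t \<ge> 0" for t
    proof -
      have "r (u *\<^sub>R x) \<le> q (u *\<^sub>R (x + t *\<^sub>R y)) - (u * t) * q y"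
        using le[of "u * t" "u *\<^sub>R x"] u that by (simp add: algebra_simps)
      also have "\<dots> = u * (q (x + t *\<^sub>R y) - t * q y)"
        using u by (simp add: sublinear_scale[OF q] right_diff_distrib del: scaleR_add_right)
      finally show ?thesis using u by (simp add: field_simps)
    qed
    then have "r (u *\<^sub>R x) / u \<le> r x" by (rule ge)
    then show ?thesis using u by (simp add: field_simps)
  qed
  have "r 0 \<ge> 0"
    using low[of _ 0] sublinear_zero[OF q] by (intro ge) auto
  moreover have "r 0 \<le> 0" using le[of 0 0] sublinear_zero[OF q] by simp
  ultimately show "sublinear r" using add scale_le by (intro sublinearI) auto
qed

lemma sublinear_odd_linear:
  assumes q: "sublinear q" and odd: "\<And>x. q (- x) = - q x"
  shows "linear q"
proof (rule linearI)
  fix x y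
  show "q (x + y) = q x + q y"
    using sublinear_add[OF q, of x y] sublinear_add[OF q, of "- x" "- y"] odd[of "x + y"]
    by (simp add: odd)
next
  fix r x
  show "q (r *\<^sub>R x) = r *\<^sub>R q x"
  proof (cases "r \<ge> 0")
    case True
    then show ?thesis using sublinear_scale[OF q] by simp
  next
    case False
    then show ?thesis using sublinear_scale[OF q, of "- r" x] odd[of "r *\<^sub>R x"] by simp
  qed
qed

text \<open>
  A functional \<open>q\<close> in \<open>Q\<close> stands for the face \<open>{g. g \<le> q}\<close> of the convex set of linear
  functionals below \<open>p\<close>.  A minimal face is a single point, which gives the Hahn--Banach
  and the Krein--Milman theorem in one application of Zorn's lemma.
\<close>

lemma exists_extreme_linear_below:
  fixes p :: "'v::real_vector \<Rightarrow> real" and y :: 'v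
  assumes p: "sublinear p"
  obtains f where "linear f" "\<And>x. f x \<le> p x" "f y = p y"
    "\<And>g h t x. linear g \<Longrightarrow> linear h \<Longrightarrow> (\<And>x. g x \<le> p x) \<Longrightarrow> (\<And>x. h x \<le> p x) \<Longrightarrow>
      0 < t \<Longrightarrow> t < 1 \<Longrightarrow> (\<And>x. f x = t * g x + (1 - t) * h x) \<Longrightarrow> g x = f x"
proof -
  define face where "face q \<longleftrightarrow> (\<forall>g h t. linear g \<and> linear h \<and> g \<le> p \<and> h \<le> p \<and> 0 < t \<and> t < 1 \<and>
      (\<lambda>x. t * g x + (1 - t) * h x) \<le> q \<longrightarrow> g \<le> q \<and> h \<le> q)" for q :: "'v \<Rightarrow> real"
  \<comment> \<open>The last condition gives g y \<ge> p y for every linear g below q, so each face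
    in Q consists of functionals that attain p at y.\<close>
  define Q where "Q = {q. sublinear q \<and> q \<le> p \<and> face q \<and> q (- y) \<le> - p y}"
  have ray: "(\<lambda>x. INF t\<in>{0..}. q (x + t *\<^sub>R z) - t * q z) \<in> {r. sublinear r \<and> r \<le> q \<and> face r \<and> r (- z) \<le> - q z}"
    if q: "sublinear q" "q \<le> p" "face q" for q z
  proof -
    define r where "r = (\<lambda>x. INF t\<in>{0..}. q (x + t *\<^sub>R z) - t * q z)"
    have r: "sublinear r" "\<And>x t. t \<ge> 0 \<Longrightarrow> r x \<le> q (x + t *\<^sub>R z) - t * q z"
      unfolding r_def using sublinear_INF_ray[OF q(1), where y = z] by blast+
    have rq: "r \<le> q" using r(2)[of 0] by (simp add: le_fun_def)
    have rz: "r (- z) \<le> - q z" using r(2)[of 1 "- z"] sublinear_zero[OF q(1)] by simp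
    have "g \<le> r \<and> h \<le> r"
      if "linear g" "linear h" "g \<le> p" "h \<le> p" and t: "0 < t" "t < 1"
        and le: "(\<lambda>x. t * g x + (1 - t) * h x) \<le> r" for g h :: "'v \<Rightarrow> real" and t
    proof -
      have gq: "g \<le> q" and hq: "h \<le> q"
        using q(3)[unfolded face_def, rule_format, of g h t] that order_trans[OF le rq] by simp_all
      \<comment> \<open>Being below r, the combination is at least q z at z; as g z and h z are at
        most q z, both must equal it.\<close>
      have 1: "t * (q z - g z) + (1 - t) * (q z - h z) \<le> 0"
        using le_funD[OF le, of "- z"] rz linear_neg[OF \<open>linear g\<close>] linear_neg[OF \<open>linear h\<close>]
        by (simp add: algebra_simps)
      have "t * (q z - g z) \<ge> 0" "(1 - t) * (q z - h z) \<ge> 0"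
        using gq hq t by (auto simp: le_fun_def)
      then have "t * (q z - g z) = 0" "(1 - t) * (q z - h z) = 0" using 1 by linarith+
      then have eq: "g z = q z" "h z = q z" using t by auto
      have *: "k \<le> r" if k: "linear k" "k \<le> q" "k z = q z" for k
      proof (rule le_funI)
        fix x
        show "k x \<le> r x" unfolding r_def
        proof (rule cINF_greatest)
          fix s :: real assume "s \<in> {0..}"
          show "k x \<le> q (x + s *\<^sub>R z) - s * q z"
            using le_funD[OF k(2), of "x + s *\<^sub>R z"] k(1,3) by (simp add: linear_add linear_scale)
        qed simp
      qed
      show ?thesis using *[OF \<open>linear g\<close> gq eq(1)] *[OF \<open>linear h\<close> hq eq(2)] by blast
    qed
    then have "face r" unfolding face_def by blast
    then show ?thesis using r(1) rq rz by (simp add: r_def)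
  qed
  have facep: "face p" by (auto simp: face_def)
  have Qne: "(\<lambda>x. INF t\<in>{0..}. p (x + t *\<^sub>R y) - t * p y) \<in> Q"
    using ray[OF p order_refl facep, of y] by (auto simp: Q_def)
  have "\<exists>m\<in>Q. \<forall>a\<in>Q. a \<le> m \<longrightarrow> a = m"
  \<comment> \<open>The order is reversed, so Zorn yields a minimal functional; the pointwise
    infimum bounds a chain.\<close>
  proof (rule predicate_Zorn[of Q "\<lambda>a b. b \<le> a"])
    show "partial_order_on Q (relation_of (\<lambda>a b. b \<le> a) Q)"
      by (rule partial_order_on_relation_ofI) auto
  next
    fix C assume C: "C \<in> Chains (relation_of (\<lambda>a b. b \<le> a) Q)"
    show "\<exists>u\<in>Q. \<forall>a\<in>C. u \<le> a"
    proof (cases "C = {}")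
      case True
      then show ?thesis using Qne by blast
    next
      case False
      have CQ: "C \<subseteq> Q" and tot: "\<And>a b. a \<in> C \<Longrightarrow> b \<in> C \<Longrightarrow> a \<le> b \<or> b \<le> a"
        using C by (auto simp: Chains_def relation_of_def)
      then have Csub: "sublinear q" "q \<le> p" "face q" "q (- y) \<le> - p y" if "q \<in> C" for q
        using that by (auto simp: Q_def)
      define u where "u x = (INF q\<in>C. q x)" for x
      have bdd: "bdd_below ((\<lambda>q. q x) ` C)" for x
      proof (rule bdd_belowI2)
        fix q assume "q \<in> C"
        then show "- p (- x) \<le> q x"
          using sublinear_minus[OF Csub(1), of q x] le_funD[OF Csub(2), of q "- x"] by simp
      qed
      have le: "u x \<le> q x" if "q \<in> C" for q x
        unfolding u_def using bdd that by (rule cINF_lower)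
      have ge: "c \<le> u x" if "\<And>q. q \<in> C \<Longrightarrow> c \<le> q x" for c x
        unfolding u_def using False that by (rule cINF_greatest)
      have add: "u (x + z) \<le> u x + u z" for x z
      proof -
        have "u (x + z) \<le> a x + b z" if ab: "a \<in> C" "b \<in> C" for a b
        proof -
          \<comment> \<open>Subadditivity of the infimum needs a single member of the chain below
            both a and b.\<close>
          obtain c where c: "c \<in> C" "c \<le> a" "c \<le> b" using tot[OF ab] ab by blast
          then show ?thesis
            using le[OF c(1), of "x + z"] sublinear_add[OF Csub(1)[OF c(1)], of x z]
              le_funD[OF c(2), of x] le_funD[OF c(3), of z] by linarith
        qed
        then have "u (x + z) - b z \<le> u x" if "b \<in> C" for b
          using that by (intro ge) (simp add: diff_le_eq)
        then have "u (x + z) - u x \<le> b z" if "b \<in> C" for b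
          using that by (auto simp: algebra_simps)
        then have "u (x + z) - u x \<le> u z" by (intro ge)
        then show ?thesis by simp
      qed
      have scale_le: "u (t *\<^sub>R x) \<le> t * u x" if t: "t > 0" for t x
      proof -
        have "u (t *\<^sub>R x) / t \<le> u x"
        proof (rule ge)
          fix q assume "q \<in> C"
          then show "u (t *\<^sub>R x) / t \<le> q x"
            using le[of q "t *\<^sub>R x"] sublinear_scale[OF Csub(1), of q t x] t
            by (simp add: field_simps)
        qed
        then show ?thesis using t by (simp add: field_simps)
      qed
      have "(\<lambda>q. q 0) ` C = (\<lambda>q. 0) ` C" using sublinear_zero[OF Csub(1)] by (intro image_cong) auto
      then have "u 0 = 0" using False by (simp add: u_def)
      then have sub: "sublinear u" using add scale_le by (intro sublinearI)
      have lu: "k \<le> u" if "\<And>q. q \<in> C \<Longrightarrow> k \<le> q" for k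
        using that by (intro le_funI ge) (auto simp: le_fun_def)
      obtain q0 where q0: "q0 \<in> C" using False by blast
      have uq: "u \<le> q" if "q \<in> C" for q using le[OF that] by (simp add: le_fun_def)
      have "face u" unfolding face_def
      proof (intro allI impI)
        fix g h t assume *: "linear g \<and> linear h \<and> g \<le> p \<and> h \<le> p \<and> 0 < t \<and> t < 1 \<and>
          (\<lambda>x. t * g x + (1 - t) * h x) \<le> u"
        have "g \<le> q \<and> h \<le> q" if "q \<in> C" for q
          using Csub(3)[OF that, unfolded face_def, rule_format, of g h t] *
            order_trans[OF _ uq[OF that], of "\<lambda>x. t * g x + (1 - t) * h x"] by simp
        then show "g \<le> u \<and> h \<le> u" using lu by blast
      qed
      moreover have "u \<le> p" using uq[OF q0] Csub(2)[OF q0] by (rule order_trans)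
      moreover have "u (- y) \<le> - p y" using le[OF q0, of "- y"] Csub(4)[OF q0] by linarith
      ultimately have "u \<in> Q" using sub by (simp add: Q_def)
      then show ?thesis using uq by blast
    qed
  qed
  then obtain f where f: "f \<in> Q" and min: "\<And>a. a \<in> Q \<Longrightarrow> a \<le> f \<Longrightarrow> a = f" by blast
  have f': "sublinear f" "f \<le> p" "face f" "f (- y) \<le> - p y" using f by (auto simp: Q_def)
  \<comment> \<open>The subface in direction z again belongs to Q, so by minimality it is the whole
    face; hence f is odd.\<close>
  have odd: "f (- z) = - f z" for z
  proof -
    obtain r where r: "sublinear r" "r \<le> f" "face r" "r (- z) \<le> - f z"
      using ray[OF f'(1-3), of z] by blast
    have "r \<in> Q"
      using r f'(4) le_funD[OF r(2), of "- y"] order_trans[OF r(2) f'(2)] by (simp add: Q_def)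
    then have "r = f" using r(2) by (rule min)
    then have "f (- z) \<le> - f z" using r(4) by simp
    then show ?thesis using sublinear_minus[OF f'(1), of z] by simp
  qed
  have lin: "linear f" using f'(1) odd by (rule sublinear_odd_linear)
  show ?thesis
  proof (rule that[OF lin])
    show "f x \<le> p x" for x using f'(2) by (rule le_funD)
    then show "f y = p y" using f'(4) odd[of y] by (intro antisym) auto
  next
    fix g h t x
    assume g: "linear g" and h: "linear h" "\<And>x. g x \<le> p x" "\<And>x. h x \<le> p x"
      and t: "0 < t" "t < 1" and eq: "\<And>x. f x = t * g x + (1 - t) * h x"
    have "linear g \<and> linear h \<and> g \<le> p \<and> h \<le> p \<and> 0 < t \<and> t < 1 \<and> (\<lambda>x. t * g x + (1 - t) * h x) \<le> f"
      using g h t eq by (simp add: le_fun_def)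
    then have gf: "g \<le> f" using f'(3) unfolding face_def by blast
    show "g x = f x"
      using le_funD[OF gf, of x] le_funD[OF gf, of "- x"] linear_neg[OF g] odd[of x] by simp
  qed
qed

section \<open>Elementary facts about C*-algebras\<close>

lemma scaleC_zero_right [simp]: "scaleC c 0 = 0"
  using scaleC_add_right[of c 0 0] by simp

lemma scaleC_zero_left [simp]: "scaleC 0 x = 0"
  using scaleC_add_left[of 0 0 x] by simp

lemma scaleC_one [simp]: "scaleC 1 x = x"
  using scaleR_scaleC[of 1 x] by simp

lemma scaleC_minus_right: "scaleC c (- x) = - scaleC c x"
  using scaleC_add_right[of c x "- x"] by (simp add: eq_neg_iff_add_eq_0 add.commute)

lemma scaleC_minus_left: "scaleC (- c) x = - scaleC c x"
  using scaleC_add_left[of c "- c" x] by (simp add: eq_neg_iff_add_eq_0 add.commute)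

lemma scaleC_diff_right: "scaleC c (x - y) = scaleC c x - scaleC c y"
  using scaleC_add_right[of c x "- y"] by (simp add: scaleC_minus_right)

lemma star_zero [simp]: "star 0 = 0"
  using star_add[of 0 0] by simp

lemma star_minus: "star (- x) = - star x"
  using star_add[of x "- x"] by (simp add: eq_neg_iff_add_eq_0 add.commute)

lemma star_diff: "star (x - y) = star x - star y"
  using star_add[of x "- y"] by (simp add: star_minus)

lemma star_scaleR: "star (r *\<^sub>R x) = r *\<^sub>R star x"
  by (simp add: scaleR_scaleC star_scaleC)

text \<open>The C*-identity and submultiplicativity give \<open>norm y \<le> norm (star y)\<close>;
  applying this to \<open>star y\<close> as well gives equality.\<close>

lemma norm_star [simp]: "norm (star x) = norm x"
proof -
  have le: "norm y \<le> norm (star y)" for y :: 'a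
  proof (cases "y = 0")
    case False
    have "norm y * norm y \<le> norm (star y) * norm y"
      using norm_mult_ineq[of "star y" y] by (simp add: cstar_identity power2_eq_square)
    then show ?thesis using False by simp
  qed simp
  show ?thesis using le[of x] le[of "star x"] by (simp add: star_star)
qed

lemma bounded_linear_star: "bounded_linear (star :: 'a::cstar_algebra \<Rightarrow> 'a)"
  by (rule bounded_linear_intro[where K = 1]) (auto simp: star_add star_scaleR)

lemma bounded_linear_scaleC: "bounded_linear (scaleC c :: 'a::cstar_algebra \<Rightarrow> 'a)"
  by (rule bounded_linear_intro[where K = "cmod c"])
     (auto simp: scaleC_add_right scaleR_scaleC scaleC_scaleC norm_scaleC mult.commute)

lemma norm_sq_self_adjoint: "star x = x \<Longrightarrow> norm (x * x) = (norm x)\<^sup>2"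
  using cstar_identity[of x] by simp

class cstar_algebra_1 = cstar_algebra + real_normed_algebra_1

lemma star_one [simp]: "star (1::'a::cstar_algebra_1) = 1"
  using star_mult[of "star (1::'a)" 1] by (simp add: star_star)

lemma star_of_real [simp]: "star (of_real r :: 'a::cstar_algebra_1) = of_real r"
  by (simp add: of_real_def star_scaleR)

section \<open>The unitization\<close>

datatype 'a unitization = Unitization (alg_part: 'a) (scalar_part: complex)

definition embed_unitization :: "'a::cstar_algebra \<Rightarrow> 'a unitization" where
  "embed_unitization a = Unitization a 0"

text \<open>Left multiplication by a + c 1 on the algebra, regarded as an ideal of its
  unitization.\<close>

definition unitization_action :: "'a::cstar_algebra unitization \<Rightarrow> 'a \<Rightarrow> 'a" where
  "unitization_action u b = alg_part u * b + scaleC (scalar_part u) b"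

lemma bounded_linear_unitization_action: "bounded_linear (unitization_action u)"
  unfolding unitization_action_def
  by (intro bounded_linear_add bounded_linear_mult_right bounded_linear_scaleC)

instantiation unitization :: (cstar_algebra) "{real_vector, ring_1}"
begin

definition "0 = Unitization 0 0"
definition "1 = Unitization 0 1"
definition "u + v = Unitization (alg_part u + alg_part v) (scalar_part u + scalar_part v)"
definition "u - v = Unitization (alg_part u - alg_part v) (scalar_part u - scalar_part v)"
definition "- u = Unitization (- alg_part u) (- scalar_part u)"
definition "u * v = Unitization
  (alg_part u * alg_part v + scaleC (scalar_part u) (alg_part v) + scaleC (scalar_part v) (alg_part u))
  (scalar_part u * scalar_part v)"
definition "r *\<^sub>R u = Unitization (r *\<^sub>R alg_part u) (complex_of_real r * scalar_part u)"

lemmas unitization_ops = zero_unitization_def one_unitization_def plus_unitization_def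
  minus_unitization_def uminus_unitization_def times_unitization_def scaleR_unitization_def

instance
  by standard
     (auto simp: unitization_ops algebra_simps scaleC_add_left scaleC_add_right scaleC_scaleC
       mult_scaleC_left mult_scaleC_right)

end

text \<open>
  If \<open>'a\<close> already has a unit, then the operator norm alone vanishes on \<open>(- 1, 1)\<close>; the
  maximum with the modulus of the scalar part is a C*-norm in every case.
\<close>

instantiation unitization :: (cstar_algebra) real_normed_algebra_1
begin

definition "norm u = max (onorm (unitization_action u)) (cmod (scalar_part u))"
definition "dist u v = norm (u - v :: 'a unitization)"
definition "sgn u = u /\<^sub>R norm (u :: 'a unitization)"
definition "uniformity =
  (INF e\<in>{0<..}. principal {(u, v :: 'a unitization). dist u v < e})"
definition "open S \<longleftrightarrow>
  (\<forall>u\<in>S. \<forall>\<^sub>F (v, w) in uniformity. v = u \<longrightarrow> w \<in> (S :: 'a unitization set))"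

instance
proof
  fix u v :: "'a unitization" and r :: real
  show "dist u v = norm (u - v)" "sgn u = u /\<^sub>R norm u"
    by (simp_all add: dist_unitization_def sgn_unitization_def)
  show "uniformity = (INF e\<in>{0<..}. principal {(u, v :: 'a unitization). dist u v < e})"
    by (simp add: uniformity_unitization_def)
  show "open S \<longleftrightarrow> (\<forall>u\<in>S. \<forall>\<^sub>F (v, w) in uniformity. v = u \<longrightarrow> w \<in> S)" for S :: "'a unitization set"
    by (simp add: open_unitization_def)
  have a0: "unitization_action u b = alg_part u * b" if "scalar_part u = 0" for b
    using that by (simp add: unitization_action_def)
  show "norm u = 0 \<longleftrightarrow> u = 0"
  proof
    assume "norm u = 0"
    then have s: "scalar_part u = 0" and o: "onorm (unitization_action u) = 0"
      using onorm_pos_le[OF bounded_linear_unitization_action[of u]]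
      by (auto simp: norm_unitization_def max_def split: if_splits)
    \<comment> \<open>Evaluating the zero operator at \<open>star a\<close>, with a the algebra
      part, gives \<open>a * star a = 0\<close>, hence a = 0.\<close>
    from o have "unitization_action u (star (alg_part u)) = 0"
      using onorm_eq_0[OF bounded_linear_unitization_action] by blast
    then have "alg_part u * star (alg_part u) = 0" using a0[OF s] by simp
    then have "star (alg_part u) = 0"
      using cstar_identity[of "star (alg_part u)"] by (simp add: star_star)
    then have "alg_part u = 0" using star_star[of "alg_part u"] by simp
    then show "u = 0" using s by (cases u) (simp add: zero_unitization_def)
  qed (simp add: norm_unitization_def zero_unitization_def unitization_action_def[abs_def] onorm_zero)
  have "onorm (unitization_action (u + v)) \<le> onorm (unitization_action u) + onorm (unitization_action v)"
  proof -
    have "unitization_action (u + v) = (\<lambda>b. unitization_action u b + unitization_action v b)"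
      by (auto simp: unitization_action_def plus_unitization_def algebra_simps scaleC_add_left)
    then show ?thesis using onorm_triangle bounded_linear_unitization_action by metis
  qed
  moreover have "cmod (scalar_part (u + v)) \<le> cmod (scalar_part u) + cmod (scalar_part v)"
    by (simp add: plus_unitization_def norm_triangle_ineq)
  ultimately show "norm (u + v) \<le> norm u + norm v"
    unfolding norm_unitization_def by linarith
  have "unitization_action (r *\<^sub>R u) = (\<lambda>b. r *\<^sub>R unitization_action u b)"
    by (auto simp: unitization_action_def scaleR_unitization_def scaleR_scaleC scaleC_add_right
        mult_scaleC_left scaleC_scaleC)
  then have "onorm (unitization_action (r *\<^sub>R u)) = \<bar>r\<bar> * onorm (unitization_action u)"
    using onorm_scaleR bounded_linear_unitization_action by metis
  then show "norm (r *\<^sub>R u) = \<bar>r\<bar> * norm u"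
    by (simp add: norm_unitization_def scaleR_unitization_def norm_mult max_mult_distrib_left)
  show "(r *\<^sub>R u) * v = r *\<^sub>R (u * v)" "u * (r *\<^sub>R v) = r *\<^sub>R (u * v)"
    by (auto simp: unitization_ops scaleR_scaleC scaleC_add_right
        mult_scaleC_left mult_scaleC_right scaleC_scaleC algebra_simps)
  have "onorm (unitization_action (u * v)) \<le> onorm (unitization_action u) * onorm (unitization_action v)"
  proof -
    have "unitization_action (u * v) = unitization_action u \<circ> unitization_action v"
      by (auto simp: unitization_action_def times_unitization_def algebra_simps scaleC_add_right
         mult_scaleC_left mult_scaleC_right scaleC_scaleC)
    then show ?thesis using onorm_compose bounded_linear_unitization_action by metis
  qed
  also have "\<dots> \<le> norm u * norm v"
    by (intro mult_mono) (auto simp: norm_unitization_def onorm_pos_le[OF bounded_linear_unitization_action] le_max_iff_disj)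
  finally have "onorm (unitization_action (u * v)) \<le> norm u * norm v" .
  moreover have "cmod (scalar_part (u * v)) \<le> norm u * norm v"
    by (auto simp: norm_unitization_def times_unitization_def norm_mult intro!: mult_mono simp: le_max_iff_disj)
  ultimately show "norm (u * v) \<le> norm u * norm v"
    unfolding norm_unitization_def[of "u * v"] by simp
  \<comment> \<open>Only \<open>onorm \<le> 1\<close> holds in general, since the algebra may be
    zero; the scalar part supplies the value 1.\<close>
  have "unitization_action 1 = (\<lambda>b::'a. b)"
    by (auto simp: unitization_action_def one_unitization_def)
  then show "norm (1 :: 'a unitization) = 1"
    using onorm_id_le[where 'a = 'a] by (simp add: norm_unitization_def one_unitization_def)
qed

end

text \<open>Left multiplication by a attains the factor \<open>norm a\<close> at
  \<open>star a\<close>, by the C*-identity.\<close>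

lemma norm_embed_unitization [simp]: "norm (embed_unitization a) = norm a"
proof -
  have act: "unitization_action (embed_unitization a) = (\<lambda>b. a * b)"
    by (auto simp: unitization_action_def embed_unitization_def)
  have "onorm (\<lambda>b. a * b) \<le> norm a"
    by (rule onorm_bound) (auto simp: norm_mult_ineq)
  moreover have "norm a \<le> onorm (\<lambda>b. a * b)"
  proof (cases "a = 0")
    case False
    have "(norm a)\<^sup>2 = norm (a * star a)"
      using cstar_identity[of "star a"] by (simp add: star_star)
    also have "\<dots> \<le> onorm (\<lambda>b. a * b) * norm a"
      using onorm[OF bounded_linear_mult_right, of a "star a"] by simp
    finally show ?thesis using False by (simp add: power2_eq_square)
  qed (simp add: onorm_zero)
  ultimately have "onorm (\<lambda>b. a * b) = norm a" by (rule antisym)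
  then show ?thesis
    by (simp add: norm_unitization_def act) (simp add: embed_unitization_def)
qed

lemma norm_Unitization_le: "norm (Unitization a c) \<le> norm a + cmod c"
proof -
  have "onorm (unitization_action (Unitization a c)) \<le> norm a + cmod c"
  proof (rule onorm_bound)
    fix b
    have "norm (unitization_action (Unitization a c) b) \<le> norm (a * b) + norm (scaleC c b)"
      by (simp add: unitization_action_def norm_triangle_ineq)
    also have "\<dots> \<le> (norm a + cmod c) * norm b"
      using norm_mult_ineq[of a b] by (simp add: norm_scaleC algebra_simps)
    finally show "norm (unitization_action (Unitization a c) b) \<le> (norm a + cmod c) * norm b" .
  qed simp
  then show ?thesis by (simp add: norm_unitization_def)
qed

text \<open>Together with \<open>norm_Unitization_le\<close>, this compares the norm with the sum
  norm on pairs, so completeness can be checked on the two coordinates.\<close>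

lemma norm_alg_part_le: "norm (alg_part u) \<le> 2 * norm u"
proof -
  have u: "embed_unitization (alg_part u) = u - Unitization 0 (scalar_part u)"
    by (cases u) (simp add: embed_unitization_def minus_unitization_def)
  have "norm (alg_part u) = norm (u - Unitization 0 (scalar_part u))"
    using norm_embed_unitization[of "alg_part u"] u by simp
  also have "\<dots> \<le> norm u + norm (Unitization 0 (scalar_part u) :: 'a unitization)"
    by (rule norm_triangle_ineq4)
  also have "\<dots> \<le> norm u + cmod (scalar_part u)"
    using norm_Unitization_le[of "0::'a" "scalar_part u"] by simp
  also have "cmod (scalar_part u) \<le> norm u" by (simp add: norm_unitization_def)
  finally show ?thesis by simp
qed

instance unitization :: (cstar_algebra) banach
proof
  fix X :: "nat \<Rightarrow> 'a unitization"
  assume X: "Cauchy X"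
  have s: "cmod (scalar_part u) \<le> norm u" for u :: "'a unitization"
    by (simp add: norm_unitization_def)
  have "Cauchy (\<lambda>n. alg_part (X n))"
  proof (rule CauchyI)
    fix e :: real assume "e > 0"
    then have "e / 2 > 0" by simp
    from CauchyD[OF X this] obtain M where "\<forall>m\<ge>M. \<forall>n\<ge>M. norm (X m - X n) < e / 2" ..
    moreover have "norm (alg_part (X m) - alg_part (X n)) \<le> 2 * norm (X m - X n)" for m n
      using norm_alg_part_le[of "X m - X n"] by (simp add: minus_unitization_def)
    ultimately show "\<exists>M. \<forall>m\<ge>M. \<forall>n\<ge>M. norm (alg_part (X m) - alg_part (X n)) < e"
      by (smt (verit) field_sum_of_halves)
  qed
  then obtain a where a: "(\<lambda>n. alg_part (X n)) \<longlonglongrightarrow> a"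
    using Cauchy_convergent_iff convergent_def by metis
  have "Cauchy (\<lambda>n. scalar_part (X n))"
  proof (rule CauchyI)
    fix e :: real assume "e > 0"
    from CauchyD[OF X this] obtain M where "\<forall>m\<ge>M. \<forall>n\<ge>M. norm (X m - X n) < e" ..
    moreover have "cmod (scalar_part (X m) - scalar_part (X n)) \<le> norm (X m - X n)" for m n
      using s[of "X m - X n"] by (simp add: minus_unitization_def)
    ultimately show "\<exists>M. \<forall>m\<ge>M. \<forall>n\<ge>M. cmod (scalar_part (X m) - scalar_part (X n)) < e"
      by (meson order.strict_trans1)
  qed
  then obtain c where c: "(\<lambda>n. scalar_part (X n)) \<longlonglongrightarrow> c"
    using Cauchy_convergent_iff convergent_def by metis
  have lim: "(\<lambda>n. norm (alg_part (X n) - a) + cmod (scalar_part (X n) - c)) \<longlonglongrightarrow> 0"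
    by (intro tendsto_add_zero tendsto_norm_zero LIM_zero a c)
  have "norm (X n - Unitization a c) \<le> norm (alg_part (X n) - a) + cmod (scalar_part (X n) - c)" for n
    using norm_Unitization_le[of "alg_part (X n) - a" "scalar_part (X n) - c"]
    by (simp add: minus_unitization_def)
  then have "\<forall>\<^sub>F n in sequentially. norm (X n - Unitization a c)
      \<le> norm (alg_part (X n) - a) + cmod (scalar_part (X n) - c)"
    by (intro always_eventually allI)
  from Lim_null_comparison[OF this lim] have "(\<lambda>n. X n - Unitization a c) \<longlonglongrightarrow> 0" .
  then have "X \<longlonglongrightarrow> Unitization a c" by (rule LIM_zero_cancel)
  then show "convergent X" by (rule convergentI)
qed

instantiation unitization :: (cstar_algebra) cstar_algebra_1
begin

definition "scaleC c u = Unitization (scaleC c (alg_part u)) (c * scalar_part u)"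
definition "star u = Unitization (star (alg_part u)) (cnj (scalar_part u))"

instance
proof
  fix u v :: "'a unitization" and c d :: complex and r :: real
  note ops = unitization_ops scaleC_unitization_def star_unitization_def
  note dist = algebra_simps scaleC_add_left scaleC_add_right scaleC_scaleC mult_scaleC_left mult_scaleC_right
  show "scaleC c (u + v) = scaleC c u + scaleC c v" "scaleC (c + d) u = scaleC c u + scaleC d u"
    "scaleC c (scaleC d u) = scaleC (c * d) u" "r *\<^sub>R u = scaleC (complex_of_real r) u"
    "scaleC c u * v = scaleC c (u * v)" "u * scaleC c v = scaleC c (u * v)"
    "star (u + v) = star u + star v" "star (scaleC c u) = scaleC (cnj c) (star u)"
    "star (u * v) = star v * star u" "star (star u) = u"
    by (auto simp: ops dist scaleR_scaleC star_add star_scaleC star_mult star_star)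
  let ?A = "unitization_action"
  \<comment> \<open>The algebra acts like a Hilbert space with inner product
    \<open>star b * b'\<close>: here \<open>star u\<close> acts as the adjoint of u, and the usual
    operator proof of the C*-identity carries over.\<close>
  have adj: "star (?A u b) * b' = star b * ?A (star u) b'" for u :: "'a unitization" and b b' :: 'a
    by (simp add: unitization_action_def star_unitization_def star_add star_mult star_scaleC dist)
  have Amult: "?A (u * v) b = ?A u (?A v b)" for u v :: "'a unitization" and b
    by (simp add: unitization_action_def times_unitization_def dist)
  have pos: "0 \<le> onorm (?A u)" for u :: "'a unitization"
    by (rule onorm_pos_le[OF bounded_linear_unitization_action])
  have bd: "norm (?A u b) \<le> onorm (?A u) * norm b" for u :: "'a unitization" and b
    by (rule onorm[OF bounded_linear_unitization_action])
  have sq: "(onorm (?A u))\<^sup>2 \<le> onorm (?A (star u * u))" for u :: "'a unitization"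
  proof -
    have "onorm (?A u) \<le> sqrt (onorm (?A (star u * u)))"
    proof (rule onorm_bound)
      fix b
      have "(norm (?A u b))\<^sup>2 = norm (star b * ?A (star u * u) b)"
        by (simp add: cstar_identity[symmetric] adj Amult)
      also have "\<dots> \<le> norm b * norm (?A (star u * u) b)"
        using norm_mult_ineq[of "star b"] by simp
      also have "\<dots> \<le> norm b * (onorm (?A (star u * u)) * norm b)"
        using bd by (intro mult_left_mono) auto
      also have "\<dots> = (sqrt (onorm (?A (star u * u))) * norm b)\<^sup>2"
        using pos by (simp add: power_mult_distrib power2_eq_square)
      finally show "norm (?A u b) \<le> sqrt (onorm (?A (star u * u))) * norm b"
        by (rule power2_le_imp_le) (simp add: pos)
    qed (simp add: pos)
    then have "(onorm (?A u))\<^sup>2 \<le> (sqrt (onorm (?A (star u * u))))\<^sup>2"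
      using pos by (intro power_mono) auto
    then show ?thesis using pos by simp
  qed
  have sub: "onorm (?A (u * v)) \<le> onorm (?A u) * onorm (?A v)" for u v :: "'a unitization"
  proof -
    have "?A (u * v) = ?A u \<circ> ?A v" by (auto simp: Amult)
    then show ?thesis using onorm_compose bounded_linear_unitization_action by metis
  qed
  have starle: "onorm (?A u) \<le> onorm (?A (star u))" for u :: "'a unitization"
  proof (cases "onorm (?A u) = 0")
    case False
    then have p: "onorm (?A u) > 0" using pos[of u] by linarith
    have "onorm (?A u) * onorm (?A u) \<le> onorm (?A (star u)) * onorm (?A u)"
      using sq[of u] sub[of "star u" u] by (simp add: power2_eq_square)
    then show ?thesis using p by simp
  qed (simp add: pos)
  have "star (star u) = u" by (simp add: star_unitization_def star_star)
  then have "onorm (?A (star u)) = onorm (?A u)"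
    using starle[of u] starle[of "star u"] by simp
  then have "onorm (?A (star u * u)) = (onorm (?A u))\<^sup>2"
    using sq[of u] sub[of "star u" u] by (simp add: power2_eq_square)
  moreover have "cmod (scalar_part (star u * u)) = (cmod (scalar_part u))\<^sup>2"
    by (simp add: times_unitization_def star_unitization_def norm_mult power2_eq_square)
  moreover have "max (x\<^sup>2) (y\<^sup>2) = (max x y)\<^sup>2" if "0 \<le> x" "0 \<le> y" for x y :: real
    using that by (auto simp: max_def dest: power2_le_imp_le intro!: antisym power_mono)
  ultimately show "norm (star u * u) = (norm u)\<^sup>2"
    using pos[of u] by (simp add: norm_unitization_def)
  have le: "onorm (?A (scaleC c u)) \<le> cmod c * onorm (?A u)" for c and u :: "'a unitization"
  proof (rule onorm_bound)
    fix b
    have "norm (?A (scaleC c u) b) = cmod c * norm (?A u b)"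
      by (simp add: unitization_action_def scaleC_unitization_def mult_scaleC_left
          scaleC_scaleC[symmetric] scaleC_add_right[symmetric] norm_scaleC)
    also have "\<dots> \<le> cmod c * (onorm (?A u) * norm b)"
      by (intro mult_left_mono bd) auto
    finally show "norm (?A (scaleC c u) b) \<le> cmod c * onorm (?A u) * norm b" by simp
  qed (simp add: pos)
  have "onorm (?A (scaleC c u)) = cmod c * onorm (?A u)"
  proof (cases "c = 0")
    case True
    then show ?thesis using le[of c u] pos[of "scaleC c u"] by simp
  next
    case False
    have "scaleC (1 / c) (scaleC c u) = u"
      using False by (cases u) (simp add: scaleC_unitization_def scaleC_scaleC)
    then have "onorm (?A u) \<le> cmod (1 / c) * onorm (?A (scaleC c u))"
      using le[of "1 / c" "scaleC c u"] by simp
    then have "cmod c * onorm (?A u) \<le> onorm (?A (scaleC c u))"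
      using False by (simp add: norm_divide field_simps)
    then show ?thesis using le[of c u] by simp
  qed
  then show "norm (scaleC c u) = cmod c * norm u"
    by (simp add: norm_unitization_def scaleC_unitization_def norm_mult max_mult_distrib_left)
qed

end

lemma embed_unitization_hom:
  "embed_unitization (a + b) = embed_unitization a + embed_unitization b"
  "embed_unitization (a * b) = embed_unitization a * embed_unitization b"
  "embed_unitization (star a) = star (embed_unitization a)"
  "embed_unitization (scaleC c a) = scaleC c (embed_unitization a)"
  by (simp_all add: embed_unitization_def unitization_ops star_unitization_def scaleC_unitization_def)

lemma unitization_decompose: "u = embed_unitization (alg_part u) + scaleC (scalar_part u) 1"
  by (cases u) (simp add: embed_unitization_def unitization_ops scaleC_unitization_def)

lemma closed_ideal_embed_unitization:
  fixes J :: "'a::cstar_algebra set"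
  assumes J: "closed_ideal J"
  shows "closed_ideal (embed_unitization ` J)"
proof -
  have sub: "complex_subspace J" and cl: "closed J" and id: "\<And>a x. x \<in> J \<Longrightarrow> a * x \<in> J \<and> x * a \<in> J"
    using J by (auto simp: closed_ideal_def)
  have "complex_subspace (embed_unitization ` J)"
    using sub unfolding complex_subspace_def
    by (auto simp: embed_unitization_hom[symmetric] zero_unitization_def embed_unitization_def[symmetric]
        simp del: embed_unitization_hom)
  moreover have "u * embed_unitization x \<in> embed_unitization ` J \<and> embed_unitization x * u \<in> embed_unitization ` J"
    if "x \<in> J" for u x
  proof -
    have "u * embed_unitization x = embed_unitization (alg_part u * x + scaleC (scalar_part u) x)"
      "embed_unitization x * u = embed_unitization (x * alg_part u + scaleC (scalar_part u) x)"
      by (auto simp: embed_unitization_def times_unitization_def)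
    then show ?thesis using sub id[OF that] that by (auto simp: complex_subspace_def)
  qed
  moreover have "closed (embed_unitization ` J)"
  proof -
    have "complete J" using cl by (simp add: complete_eq_closed)
    moreover have "subspace J"
      using sub by (auto simp: complex_subspace_def scaleR_scaleC intro!: subspaceI)
    moreover have "bounded_linear (embed_unitization :: 'a \<Rightarrow> _)"
      by (rule bounded_linear_intro[where K = 1])
         (simp_all add: embed_unitization_hom scaleR_scaleC)
    ultimately have "complete (embed_unitization ` J)"
      by (intro complete_isometric_image[of 1]) auto
    then show ?thesis by (simp add: complete_eq_closed)
  qed
  ultimately show ?thesis unfolding closed_ideal_def by auto
qed

section \<open>Square roots and positivity in unital C*-algebras\<close>

text \<open>The coefficients of \<open>1 - sqrt (1 - x)\<close>; the recursion encodes \<open>2 r = x + r\<^sup>2\<close>.\<close>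

fun sqrt_coeff :: "nat \<Rightarrow> real" where
  "sqrt_coeff 0 = 0"
| "sqrt_coeff (Suc 0) = 1 / 2"
| "sqrt_coeff (Suc (Suc n)) = (\<Sum>i\<le>n. sqrt_coeff (Suc i) * sqrt_coeff (Suc (n - i))) / 2"

lemma sqrt_coeff_nonneg: "0 \<le> sqrt_coeff n"
  by (induction n rule: sqrt_coeff.induct) (auto intro!: sum_nonneg)

text \<open>The identity r^2 = 2 r - x for coefficients; the extreme terms of the convolution vanish
  because \<open>sqrt_coeff 0 = 0\<close>.\<close>

lemma sqrt_coeff_convolution:
  "(\<Sum>i\<le>n. sqrt_coeff i * sqrt_coeff (n - i)) = 2 * sqrt_coeff n - (if n = 1 then 1 else 0)"
proof (cases n rule: sqrt_coeff.cases)
  case (3 m)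
  have "(\<Sum>i\<le>n. sqrt_coeff i * sqrt_coeff (n - i)) =
      (\<Sum>i\<le>m. sqrt_coeff (Suc i) * sqrt_coeff (n - Suc i))"
    unfolding 3 by (subst sum.atMost_Suc_shift) simp
  also have "\<dots> = (\<Sum>i\<le>m. sqrt_coeff (Suc i) * sqrt_coeff (Suc (m - i)))"
    by (intro sum.cong) (auto simp: 3 Suc_diff_le)
  finally show ?thesis by (simp add: 3)
qed auto

text \<open>With S_N the partial sum, 2 S_(N+1) - 1 \<le> S_N^2: products of total degree at most N
  + 1 with both indices non-zero only involve indices up to N. So S_N \<le> 1 passes to N +
  1.\<close>

lemma sum_sqrt_coeff_le: "(\<Sum>n\<le>N. sqrt_coeff n) \<le> 1"
proof (induction N)
  case (Suc N)
  let ?b = sqrt_coeff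
  have "2 * (\<Sum>n\<le>Suc N. ?b n) - 1 = (\<Sum>n\<le>Suc N. 2 * ?b n - (if n = 1 then 1 else 0))"
    by (simp add: sum_subtractf sum_distrib_left)
  also have "\<dots> = (\<Sum>n\<le>Suc N. \<Sum>i\<le>n. ?b i * ?b (n - i))"
    by (simp only: sqrt_coeff_convolution)
  also have "\<dots> = (\<Sum>(i, j)\<in>{(i, j). i + j \<le> Suc N}. ?b i * ?b j)"
    by (rule sum.triangle_reindex_eq[symmetric])
  also have "\<dots> = (\<Sum>(i, j)\<in>{(i, j). i + j \<le> Suc N \<and> i \<noteq> 0 \<and> j \<noteq> 0}. ?b i * ?b j)"
  proof (rule sum.mono_neutral_right)
    show "finite {(i, j). i + j \<le> Suc N}"
      by (rule finite_subset[of _ "{..Suc N} \<times> {..Suc N}"]) auto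
  qed (auto intro!: Nat.gr0I)
  also have "\<dots> \<le> (\<Sum>(i, j)\<in>{..N} \<times> {..N}. ?b i * ?b j)"
    by (rule sum_mono2) (auto simp: sqrt_coeff_nonneg)
  also have "\<dots> = (\<Sum>n\<le>N. ?b n) * (\<Sum>n\<le>N. ?b n)"
    by (simp add: sum_product sum.cartesian_product)
  also have "\<dots> \<le> 1"
    using Suc by (intro mult_le_one) (auto intro: sum_nonneg sqrt_coeff_nonneg)
  finally show ?case by simp
qed simp

lemma summable_sqrt_coeff: "summable sqrt_coeff" and suminf_sqrt_coeff_le: "suminf sqrt_coeff \<le> 1"
proof -
  have le: "sum sqrt_coeff {..<n} \<le> 1" for n
  proof (cases n)
    case (Suc m)
    then show ?thesis using sum_sqrt_coeff_le[of m] by (simp add: lessThan_Suc_atMost)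
  qed simp
  show 1: "summable sqrt_coeff"
    by (rule summableI_nonneg_bounded[of _ 1]) (auto simp: sqrt_coeff_nonneg le)
  show "suminf sqrt_coeff \<le> 1" by (rule suminf_le_const[OF 1 le])
qed

lemma star_power: "star (x ^ n) = star (x :: 'a::cstar_algebra_1) ^ n"
  by (induction n) (auto simp: star_mult power_commutes)

lemma commute_power: "d * x = x * d \<Longrightarrow> d * x ^ n = x ^ n * (d :: 'a::monoid_mult)"
proof (induction n)
  case (Suc n)
  then show ?case by (metis mult.assoc power_Suc)
qed simp

text \<open>Summability of the coefficients makes the power series in c converge even for
  \<open>norm c = 1\<close>, and the Cauchy product gives r^2 = 2 r - c. The commutation clause does
  the work of a functional calculus.\<close>

lemma exists_sqrt_one_minus:
  fixes c :: "'a::cstar_algebra_1"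
  assumes c: "star c = c" "norm c \<le> 1"
  obtains r where "star r = r" "norm r \<le> 1" "\<And>d. d * c = c * d \<Longrightarrow> d * r = r * d"
    "(1 - r) * (1 - r) = 1 - c"
proof -
  let ?b = sqrt_coeff
  define f where "f n = ?b n *\<^sub>R c ^ n" for n
  define r where "r = suminf f"
  have nf: "norm (f n) \<le> ?b n" for n
    using sqrt_coeff_nonneg[of n] power_le_one[of "norm c" n] norm_power_ineq[of c n] c
    by (simp add: f_def mult_left_le)
  have ns: "summable (\<lambda>n. norm (f n))"
    by (rule summable_comparison_test'[OF summable_sqrt_coeff]) (simp add: nf)
  then have s: "summable f" by (rule summable_norm_cancel)
  have "norm r \<le> (\<Sum>n. norm (f n))" unfolding r_def using ns by (rule summable_norm)
  also have "\<dots> \<le> suminf ?b" by (rule suminf_le[OF _ ns summable_sqrt_coeff]) (simp add: nf)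
  finally have 1: "norm r \<le> 1" using suminf_sqrt_coeff_le by simp
  have 2: "star r = r"
    unfolding r_def
    by (subst bounded_linear.suminf[OF bounded_linear_star s])
       (simp add: f_def[abs_def] star_scaleR star_power c(1))
  have 3: "d * r = r * d" if "d * c = c * d" for d
    unfolding r_def suminf_mult[OF s, symmetric] suminf_mult2[OF s]
    using commute_power[OF that] by (simp add: f_def)
  have "(\<lambda>k. \<Sum>i\<le>k. f i * f (k - i)) sums (r * r)"
    unfolding r_def by (rule Cauchy_product_sums[OF ns ns])
  moreover have "(\<Sum>i\<le>k. f i * f (k - i)) = 2 *\<^sub>R f k - (if k = 1 then c else 0)" for k
  proof -
    have "(\<Sum>i\<le>k. f i * f (k - i)) = (\<Sum>i\<le>k. ?b i * ?b (k - i)) *\<^sub>R c ^ k"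
      unfolding scaleR_sum_left
      by (intro sum.cong) (auto simp: f_def mult.commute power_add[symmetric])
    then show ?thesis by (simp add: sqrt_coeff_convolution f_def scaleR_diff_left)
  qed
  ultimately have "(\<lambda>k. 2 *\<^sub>R f k - (if k = 1 then c else 0)) sums (r * r)" by simp
  moreover have "(\<lambda>k. 2 *\<^sub>R f k - (if k = 1 then c else 0)) sums (2 *\<^sub>R r - c)"
    using s unfolding r_def
    by (intro sums_diff sums_scaleR_right summable_sums sums_single[of 1 "\<lambda>_. c"])
  ultimately have "r * r = 2 *\<^sub>R r - c" by (rule sums_unique2)
  then have "(1 - r) * (1 - r) = 1 - c" by (simp add: algebra_simps scaleR_2)
  with 1 2 3 show ?thesis using that by blast
qed

text \<open>For u = w + i v, commutation gives \<open>star u * u = w * w + v * v\<close>, and w is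
  the real part of u, so its norm is at most that of u.\<close>

lemma norm_sq_le_norm_sum_squares:
  fixes w v :: "'a::cstar_algebra"
  assumes "star w = w" "star v = v" "w * v = v * w"
  shows "(norm w)\<^sup>2 \<le> norm (w * w + v * v)"
proof -
  define u where "u = w + scaleC \<i> v"
  have su: "star u = w - scaleC \<i> v"
    using assms by (simp add: u_def star_add star_scaleC scaleC_minus_left)
  have "star u * u = w * w + v * v"
    unfolding su unfolding u_def using assms(3)
    by (simp add: algebra_simps mult_scaleC_left mult_scaleC_right scaleC_scaleC scaleC_minus_left scaleC_diff_right)
  then have 1: "(norm u)\<^sup>2 = norm (w * w + v * v)" using cstar_identity[of u] by simp
  have "2 * norm w = norm (u + star u)"
    unfolding su unfolding u_def by (simp flip: scaleR_2)
  also have "\<dots> \<le> norm u + norm (star u)" by (rule norm_triangle_ineq)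
  finally have "norm w \<le> norm u" by simp
  then show ?thesis using 1 power_mono[of "norm w" "norm u" 2] by simp
qed

text \<open>
  The spectral order described by norms alone.  That it coincides with \<^const>\<open>positive\<close> is
  \<open>positive_iff_nonneg\<close> below.
\<close>

definition nonneg :: "'a::cstar_algebra_1 \<Rightarrow> bool" where
  "nonneg a \<longleftrightarrow> star a = a \<and> (\<exists>t. norm (of_real t - a) \<le> t)"

section \<open>The cone of non-negative elements\<close>

lemma nonneg_star: "nonneg a \<Longrightarrow> star a = a"
  by (simp add: nonneg_def)

lemma nonneg_add: "nonneg a \<Longrightarrow> nonneg b \<Longrightarrow> nonneg (a + b)"
proof -
  assume "nonneg a" "nonneg b"
  then obtain t s where ts: "norm (of_real t - a) \<le> t" "norm (of_real s - b) \<le> s"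
    and st: "star a = a" "star b = b" by (auto simp: nonneg_def)
  have eq: "of_real (t + s) - (a + b) = (of_real t - a) + (of_real s - b)" by simp
  have "norm (of_real (t + s) - (a + b)) \<le> t + s"
    unfolding eq using norm_triangle_ineq[of "of_real t - a" "of_real s - b"] ts by linarith
  then show ?thesis using st unfolding nonneg_def by (metis star_add)
qed

lemma nonneg_scaleR: "0 \<le> r \<Longrightarrow> nonneg a \<Longrightarrow> nonneg (r *\<^sub>R a)"
proof -
  assume r: "0 \<le> r" and "nonneg a"
  then obtain t where t: "norm (of_real t - a) \<le> t" and st: "star a = a" by (auto simp: nonneg_def)
  have "of_real (r * t) - r *\<^sub>R a = r *\<^sub>R (of_real t - a)"
    by (simp add: of_real_def scaleR_diff_right)
  then have "norm (of_real (r * t) - r *\<^sub>R a) \<le> r * t" using t r by (simp add: mult_left_mono)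
  then show ?thesis using st unfolding nonneg_def by (metis star_scaleR)
qed

text \<open>After normalizing w to b, write 1 - b^2 = (1 - r)^2; the norm of this square is at most
  that of (1 - r)^2 + b^2 = 1, so t = 1 witnesses \<open>nonneg\<close>.\<close>

lemma nonneg_square:
  fixes w :: "'a::cstar_algebra_1"
  assumes w: "star w = w"
  shows "nonneg (w * w)"
proof (cases "w = 0")
  case True
  then show ?thesis by (auto simp: nonneg_def intro: exI[of _ 0])
next
  case False
  define b where "b = (1 / norm w) *\<^sub>R w"
  have b: "star b = b" "norm b = 1" using False w by (auto simp: b_def star_scaleR)
  have "norm (1 - b * b) \<le> 1"
  proof -
    have bb: "star (b * b) = b * b" "norm (b * b) \<le> 1"
      using b by (auto simp: star_mult norm_sq_self_adjoint)
    obtain r where r: "star r = r" "\<And>d. d * (b * b) = (b * b) * d \<Longrightarrow> d * r = r * d"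
      "(1 - r) * (1 - r) = 1 - b * b"
      using exists_sqrt_one_minus[OF bb] by metis
    have "b * r = r * b" by (rule r(2)) (simp add: mult.assoc)
    then have "(norm (1 - r))\<^sup>2 \<le> norm ((1 - r) * (1 - r) + b * b)"
      using b r(1) by (intro norm_sq_le_norm_sum_squares) (auto simp: star_diff algebra_simps)
    then show ?thesis
      using norm_sq_self_adjoint[of "1 - r"] r(1) by (simp add: r(3) star_diff)
  qed
  then have "nonneg (b * b)"
    using b unfolding nonneg_def by (auto simp: star_mult intro: exI[of _ 1])
  moreover have "w * w = (norm w)\<^sup>2 *\<^sub>R (b * b)"
    using False by (simp add: b_def power2_eq_square)
  ultimately show ?thesis using nonneg_scaleR by (metis zero_le_power2)
qed

lemma nonneg_of_real: "0 \<le> t \<Longrightarrow> nonneg (of_real t :: 'a::cstar_algebra_1)"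
  by (auto simp: nonneg_def intro: exI[of _ t])

text \<open>A witness t > 0 means a / t = 1 - c with \<open>norm c \<le> 1\<close>, to which the
  power series applies; t = 0 forces a = 0.\<close>

lemma nonneg_sqrt:
  fixes a :: "'a::cstar_algebra_1"
  assumes "nonneg a"
  obtains w where "nonneg w" "w * w = a" "\<And>d. d * a = a * d \<Longrightarrow> d * w = w * d"
proof -
  obtain t where t: "norm (of_real t - a) \<le> t" and sa: "star a = a"
    using assms by (auto simp: nonneg_def)
  have t0: "t \<ge> 0" using t norm_ge_zero order_trans by blast
  show ?thesis
  proof (cases "t = 0")
    case True
    then have "a = 0" using t by simp
    then show ?thesis using that[of 0] nonneg_of_real[of 0] by simp
  next
    case False
    define c where "c = 1 - (1 / t) *\<^sub>R a"
    have "star c = c" by (simp add: c_def star_diff star_scaleR sa)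
    moreover have "c = (1 / t) *\<^sub>R (of_real t - a)"
      using False by (simp add: c_def scaleR_diff_right of_real_def)
    then have "norm c \<le> 1" using t t0 False by simp
    ultimately obtain r where r: "star r = r" "norm r \<le> 1" "\<And>d. d * c = c * d \<Longrightarrow> d * r = r * d"
      "(1 - r) * (1 - r) = 1 - c"
      using exists_sqrt_one_minus by metis
    show ?thesis
    proof (rule that[of "sqrt t *\<^sub>R (1 - r)"])
      have "nonneg (1 - r)"
        using r(1,2) unfolding nonneg_def by (auto simp: star_diff intro!: exI[of _ 1])
      then show "nonneg (sqrt t *\<^sub>R (1 - r))" using t0 by (intro nonneg_scaleR) auto
      show "sqrt t *\<^sub>R (1 - r) * sqrt t *\<^sub>R (1 - r) = a"
        using t0 False by (simp add: r(4)) (simp add: c_def)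
      fix d assume "d * a = a * d"
      then have "d * c = c * d" by (simp add: c_def algebra_simps)
      then have "d * r = r * d" by (rule r(3))
      then show "d * sqrt t *\<^sub>R (1 - r) = sqrt t *\<^sub>R (1 - r) * d" by (simp add: algebra_simps)
    qed
  qed
qed

text \<open>The square roots of a and b commute because a and b do, so the estimate for sums of
  squares applies to them.\<close>

lemma nonneg_le_norm:
  assumes a: "nonneg a" and b: "nonneg b" and ab: "a * b = b * a"
  shows "norm a \<le> norm (a + b)"
proof -
  obtain w where w: "nonneg w" "w * w = a" "\<And>d. d * a = a * d \<Longrightarrow> d * w = w * d"
    using nonneg_sqrt[OF a] by metis
  obtain v where v: "nonneg v" "v * v = b" "\<And>d. d * b = b * d \<Longrightarrow> d * v = v * d"
    using nonneg_sqrt[OF b] by metis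
  have "b * w = w * b" using ab by (intro w(3)) simp
  then have "w * v = v * w" by (intro v(3)) simp
  then have "(norm w)\<^sup>2 \<le> norm (w * w + v * v)"
    by (intro norm_sq_le_norm_sum_squares nonneg_star w(1) v(1))
  then show ?thesis
    unfolding norm_sq_self_adjoint[OF nonneg_star[OF w(1)], symmetric] w(2) v(2) .
qed

text \<open>A Neumann series: (1 + e) / (1 + t) = 1 - k with \<open>norm k\<close> at most t / (1 +
  t) < 1.\<close>

lemma nonneg_inverse:
  fixes e :: "'a::cstar_algebra_1"
  assumes "nonneg e"
  obtains g where "g * (1 + e) = 1" "(1 + e) * g = 1"
proof -
  obtain t where t: "norm (of_real t - e) \<le> t" using assms by (auto simp: nonneg_def)
  then have t0: "t \<ge> 0" using norm_ge_zero order_trans by blast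
  define k where "k = (1 / (1 + t)) *\<^sub>R (of_real t - e)"
  have "norm k \<le> t / (1 + t)" using t t0 by (simp add: k_def divide_simps)
  also have "\<dots> < 1" using t0 by simp
  finally have "norm k < 1" .
  then have s: "summable (\<lambda>n. k ^ n)" by (rule complete_algebra_summable_geometric)
  define h where "h = (\<Sum>n. k ^ n)"
  have "h = 1 + (\<Sum>n. k ^ Suc n)" unfolding h_def using suminf_split_head[OF s] by simp
  moreover have "(\<Sum>n. k ^ Suc n) = k * h" "(\<Sum>n. k ^ Suc n) = h * k"
    unfolding h_def suminf_mult[OF s, symmetric] suminf_mult2[OF s] by (simp_all add: power_commutes)
  ultimately have h: "(1 - k) * h = 1" "h * (1 - k) = 1" by (simp_all add: algebra_simps)
  have "1 - k = (1 / (1 + t)) *\<^sub>R ((1 + t) *\<^sub>R 1 - (of_real t - e))"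
    using t0 by (simp add: k_def scaleR_diff_right)
  also have "(1 + t) *\<^sub>R 1 - (of_real t - e) = 1 + e"
    by (simp add: of_real_def scaleR_add_left)
  finally have k: "1 - k = (1 / (1 + t)) *\<^sub>R (1 + e)" .
  show ?thesis using that[of "(1 / (1 + t)) *\<^sub>R h"] h unfolding k by simp
qed

lemma inverse_star:
  fixes w W :: "'a::cstar_algebra_1"
  assumes "star w = w" "w * W = 1"
  shows "star W = W" "W * w = 1"
proof -
  have 1: "star W * w = 1" using arg_cong[OF assms(2), of star] by (simp add: star_mult assms(1))
  have "star W = star W * (w * W)" by (simp add: assms(2))
  also have "\<dots> = W" by (simp only: mult.assoc[symmetric] 1) simp
  finally show "star W = W" .
  then show "W * w = 1" using 1 by simp
qed

lemma inverse_commute: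
  fixes w W d :: "'a::monoid_mult"
  assumes "w * W = 1" "W * w = 1" "d * w = w * d"
  shows "d * W = W * d"
proof -
  have "d * W = W * (w * d) * W" by (simp add: mult.assoc[symmetric] assms(2))
  also have "\<dots> = W * d * (w * W)" by (simp only: assms(3)[symmetric] mult.assoc)
  finally show ?thesis by (simp add: assms(1))
qed

section \<open>Fukamiya's theorem\<close>

text \<open>The norm of the square of a self-adjoint element belongs to its spectrum.\<close>

lemma one_minus_square_not_invertible:
  fixes m :: "'a::cstar_algebra_1"
  assumes m: "star m = m" "norm m = 1" and G: "(1 - m * m) * G = 1"
  shows False
proof -
  have mm: "star (m * m) = m * m" "norm (m * m) \<le> 1"
    using m by (auto simp: star_mult norm_sq_self_adjoint)
  obtain r where r: "star r = r" "\<And>d. d * (m * m) = (m * m) * d \<Longrightarrow> d * r = r * d"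
    "(1 - r) * (1 - r) = 1 - m * m"
    using exists_sqrt_one_minus[OF mm] by metis
  define w where "w = 1 - r"
  have sw: "star w = w" and ww: "w * w = 1 - m * m" using r by (auto simp: w_def star_diff)
  have "m * r = r * m" by (rule r(2)) (simp add: mult.assoc)
  then have mw: "m * w = w * m" by (simp add: w_def algebra_simps)
  define W where "W = w * G"
  have W: "w * W = 1" using G by (simp add: W_def ww mult.assoc[symmetric])
  then have sW: "star W = W" and W': "W * w = 1" using inverse_star[OF sw] by auto
  have mW: "m * W = W * m" by (rule inverse_commute[OF W W' mw])
  have W0: "W \<noteq> 0" using W by auto
  \<comment> \<open>The bound on \<delta> gives 1 - \<delta> W^2 a square root v. Since W inverts w,
    (w v)^2 = w^2 - \<delta> = 1 - m^2 - \<delta>, so m^2 + (w v)^2 = 1 - \<delta>, whose norm is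
    below 1 = \<open>norm m\<close>.\<close>
  define \<delta> where "\<delta> = 1 / max 1 ((norm W)\<^sup>2)"
  have \<delta>: "0 < \<delta>" "\<delta> \<le> 1" "\<delta> * (norm W)\<^sup>2 \<le> 1"
    by (auto simp: \<delta>_def max_def divide_simps)
  define b where "b = sqrt \<delta> *\<^sub>R W"
  have sb: "star b = b" by (simp add: b_def star_scaleR sW)
  have bb: "b * b = \<delta> *\<^sub>R (W * W)" using \<delta> by (simp add: b_def)
  have "norm (b * b) \<le> 1" using \<delta> by (simp add: bb norm_sq_self_adjoint[OF sW])
  then obtain s where s: "star s = s" "\<And>d. d * (b * b) = (b * b) * d \<Longrightarrow> d * s = s * d"
    "(1 - s) * (1 - s) = 1 - b * b"
    using exists_sqrt_one_minus[of "b * b"] sb by (metis star_mult)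
  define v where "v = 1 - s"
  have sv: "star v = v" and vv: "v * v = 1 - b * b" using s by (auto simp: v_def star_diff)
  have comm: "d * v = v * d" if "d * W = W * d" for d
  proof -
    have "d * (W * W) = W * W * d" using that by (metis mult.assoc)
    then have "d * s = s * d" by (intro s(2)) (simp add: bb)
    then show ?thesis by (simp add: v_def algebra_simps)
  qed
  have wv: "w * v = v * w" using W W' by (intro comm) simp
  have mv: "m * v = v * m" by (rule comm[OF mW])
  have "(w * v) * (w * v) = w * w * (v * v)" using wv by (metis mult.assoc)
  also have "\<dots> = w * w - \<delta> *\<^sub>R (w * (w * W) * W)"
    by (simp add: vv bb right_diff_distrib mult.assoc)
  also have "\<dots> = 1 - m * m - of_real \<delta>" by (simp add: W ww of_real_def)
  finally have "m * m + (w * v) * (w * v) = of_real (1 - \<delta>)" by simp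
  moreover have "(norm m)\<^sup>2 \<le> norm (m * m + (w * v) * (w * v))"
  proof (rule norm_sq_le_norm_sum_squares[OF m(1)])
    show "star (w * v) = w * v" by (simp add: star_mult sw sv wv)
    show "m * (w * v) = w * v * m" using mw mv by (metis mult.assoc)
  qed
  ultimately have "(norm m)\<^sup>2 \<le> norm (of_real (1 - \<delta>) :: 'a)" by simp
  then show False using \<delta> m(2) unfolding norm_of_real by simp
qed

text \<open>With h and k the real and imaginary parts of z, the sum of the two products becomes
  visibly non-negative, before anything is known about \<open>star z * z\<close> alone.\<close>

lemma real_imaginary_parts:
  fixes z :: "'a::cstar_algebra"
  obtains h k where "star h = h" "star k = k" "star z * z + z * star z = 2 *\<^sub>R (h * h + k * k)"
proof
  let ?h = "scaleC (1 / 2) (z + star z)" and ?k = "scaleC (- \<i> / 2) (z - star z)"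
  show "star ?h = ?h" by (simp add: star_scaleC star_add star_star add.commute)
  show "star ?k = ?k"
    by (simp add: star_scaleC star_diff star_star star_minus scaleC_minus_left scaleC_diff_right)
  have "?h * ?h + ?k * ?k = scaleC (1 / 4) ((z + star z) * (z + star z)) + scaleC (- 1 / 4) ((z - star z) * (z - star z))"
    by (simp add: mult_scaleC_left mult_scaleC_right scaleC_scaleC)
  also have "\<dots> = scaleC (1 / 4) ((z + star z) * (z + star z) - (z - star z) * (z - star z))"
    using scaleC_minus_left[of "1 / 4" "(z - star z) * (z - star z)"] by (simp add: scaleC_diff_right)
  also have "(z + star z) * (z + star z) - (z - star z) * (z - star z) = scaleC 2 (star z * z + z * star z)"
    by (simp add: algebra_simps scaleR_scaleC[of 2, simplified, symmetric] scaleR_2)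
  finally show "star z * z + z * star z = 2 *\<^sub>R (?h * ?h + ?k * ?k)"
    by (simp add: scaleR_scaleC scaleC_scaleC)
qed

text \<open>
  Both \<open>1 + t (z z\<^sup>*)\<close> and \<open>1 + t (z\<^sup>* z)\<close> are invertible as soon as one of them is, and
  \<open>z\<^sup>* z + z z\<^sup>*\<close> is non-negative.
\<close>

lemma star_mult_self_eq_minus_square:
  fixes z q :: "'a::cstar_algebra_1"
  assumes q: "star q = q" and zq: "star z * z = - (q * q)"
  shows "z = 0"
proof -
  have "q = 0"
  proof (rule ccontr)
    assume q0: "q \<noteq> 0"
    obtain h k where hk: "star h = h" "star k = k" "star z * z + z * star z = 2 *\<^sub>R (h * h + k * k)"
      using real_imaginary_parts by metis
    have "z * star z = 2 *\<^sub>R (h * h + k * k) + q * q"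
      using hk(3) zq by (simp add: algebra_simps)
    then have e: "nonneg (z * star z)"
      using hk q by (auto intro!: nonneg_add nonneg_scaleR nonneg_square simp del: scaleR_add_right)
    \<comment> \<open>Chosen so that m = q / \<open>norm q\<close> satisfies 1 - m^2 = 1 + \<tau>
      \<open>star z * z\<close>.\<close>
    define \<tau> where "\<tau> = 1 / (norm q)\<^sup>2"
    have \<tau>: "\<tau> > 0" using q0 by (simp add: \<tau>_def)
    obtain g where g: "(1 + \<tau> *\<^sub>R (z * star z)) * g = 1"
      using nonneg_inverse[OF nonneg_scaleR[OF _ e]] \<tau> by (metis less_imp_le)
    define m where "m = (1 / norm q) *\<^sub>R q"
    have m: "star m = m" "norm m = 1" using q q0 by (auto simp: m_def star_scaleR)
    have mm: "1 - m * m = 1 + \<tau> *\<^sub>R (star z * z)"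
      by (simp add: m_def zq \<tau>_def power2_eq_square)
    \<comment> \<open>The identity behind this: 1 - a g b inverts 1 + a b when g inverts 1 + b
      a.\<close>
    have "(1 - m * m) * (1 - \<tau> *\<^sub>R (star z * g * z)) =
        1 + \<tau> *\<^sub>R (star z * (1 - (1 + \<tau> *\<^sub>R (z * star z)) * g) * z)"
      unfolding mm by (simp add: algebra_simps)
    also have "\<dots> = 1" by (simp add: g)
    finally show False by (rule one_minus_square_not_invertible[OF m])
  qed
  then show ?thesis using zq cstar_identity[of z] by simp
qed

text \<open>
  Fukamiya's theorem.  With \<open>b = y\<^sup>* y\<close>, \<open>m = \<bar>b\<bar>\<close> and \<open>n = m - b\<close>, the element \<open>z = y n\<close>
  satisfies \<open>z\<^sup>* z = n b n = - m n\<^sup>2\<close>.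
\<close>

lemma nonneg_star_mult_self:
  fixes y :: "'a::cstar_algebra_1"
  shows "nonneg (star y * y)"
proof -
  define b where "b = star y * y"
  have sb: "star b = b" by (simp add: b_def star_mult star_star)
  obtain m where m: "nonneg m" "m * m = b * b" "\<And>d. d * (b * b) = b * b * d \<Longrightarrow> d * m = m * d"
    using nonneg_sqrt[OF nonneg_square[OF sb]] by metis
  have bm: "b * m = m * b" by (rule m(3)) (simp add: mult.assoc)
  \<comment> \<open>The root s of m turns m n^2 into the square of the self-adjoint element s n, as
    \<open>star_mult_self_eq_minus_square\<close> requires.\<close>
  obtain s where s: "nonneg s" "s * s = m" "\<And>d. d * m = m * d \<Longrightarrow> d * s = s * d"
    using nonneg_sqrt[OF m(1)] by metis
  have bs: "b * s = s * b" by (rule s(3)[OF bm])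
  have ms: "m * s = s * m" by (rule s(3)) simp
  define n where "n = m - b"
  have sn: "star n = n" using nonneg_star[OF m(1)] sb by (simp add: n_def star_diff)
  have ns: "n * s = s * n" using bs ms by (simp add: n_def algebra_simps)
  have nb: "n * b = - (m * n)" by (simp add: n_def algebra_simps m(2) bm)
  have "star (y * n) * (y * n) = n * b * n" by (simp add: star_mult sn b_def mult.assoc)
  also have "\<dots> = - (s * s * n * n)" by (simp add: nb s(2))
  also have "s * s * n * n = (s * n) * (s * n)" using ns by (metis mult.assoc)
  finally have "star (y * n) * (y * n) = - ((s * n) * (s * n))" .
  moreover have "star (s * n) = s * n" using nonneg_star[OF s(1)] sn ns by (simp add: star_mult)
  ultimately have "y * n = 0" by (intro star_mult_self_eq_minus_square)
  \<comment> \<open>From here b n = 0; adjoints give n b = 0, then m n = 0, so n^2 = (m - b) n =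
    0.\<close>
  then have bn: "b * n = 0" by (simp add: b_def mult.assoc)
  then have "star (b * n) = 0" by simp
  then have "n * b = 0" by (simp add: star_mult sb sn)
  then have "m * n = 0" using nb by simp
  then have "n * n = 0" using bn by (simp add: n_def left_diff_distrib)
  then have "n = 0" using norm_sq_self_adjoint[OF sn] by simp
  then have "b = m" by (simp add: n_def)
  then show ?thesis using m(1) by (simp add: b_def)
qed

lemma positive_iff_nonneg: "positive a \<longleftrightarrow> nonneg (a :: 'a::cstar_algebra_1)"
proof
  assume "nonneg a"
  then obtain w where "nonneg w" "w * w = a" using nonneg_sqrt by metis
  then show "positive a" unfolding positive_def using nonneg_star by metis
qed (auto simp: positive_def nonneg_star_mult_self)

text \<open>Invariance under conjugation is evident for \<open>positive\<close>, so the equivalence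
  of the two notions carries the argument.\<close>

lemma nonneg_conjugate:
  fixes a r :: "'a::cstar_algebra_1"
  assumes "nonneg a"
  shows "nonneg (star r * a * r)"
proof -
  obtain x where "a = star x * x" using assms by (auto simp: positive_iff_nonneg[symmetric] positive_def)
  then have "star r * a * r = star (x * r) * (x * r)" by (simp add: star_mult mult.assoc)
  then show ?thesis by (simp add: nonneg_star_mult_self)
qed

lemma nonneg_norm_minus:
  fixes h :: "'a::cstar_algebra_1"
  assumes "star h = h"
  shows "nonneg (of_real (norm h) - h)"
  using assms by (auto simp: nonneg_def star_diff intro!: exI[of _ "norm h"])

section \<open>Closed ideals are closed under approximate domination\<close>

text \<open>For a multiple k of j put r = (1 + k^2)^(-1). Then 1 - r = r k^2 lies in J, so x is
  approximated by x (1 - r) in J; the error x r is small because conjugating the domination by r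
  bounds \<open>star (x * r) * (x * r)\<close> by 4 \<epsilon>.\<close>

lemma mem_closed_ideal_if_dominated:
  fixes J :: "'a::cstar_algebra_1 set"
  assumes J: "closed_ideal J"
    and dom: "\<And>\<epsilon>. 0 < \<epsilon> \<Longrightarrow> \<exists>j\<in>J. nonneg (of_real \<epsilon> + j - star x * x)"
  shows "x \<in> J"
proof -
  have cl: "closed J" and id: "\<And>a y. y \<in> J \<Longrightarrow> a * y \<in> J \<and> y * a \<in> J"
    and sc: "\<And>c y. y \<in> J \<Longrightarrow> scaleC c y \<in> J"
    using J by (auto simp: closed_ideal_def complex_subspace_def)
  have "\<exists>y\<in>J. dist y x < e" if e: "e > 0" for e
  proof -
    \<comment> \<open>Chosen so that the final bound 4 \<epsilon> equals (e / 2)^2.\<close>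
    define \<epsilon> where "\<epsilon> = (e / 4)\<^sup>2"
    have \<epsilon>: "\<epsilon> > 0" using e by (simp add: \<epsilon>_def)
    obtain j where j: "j \<in> J" and nn: "nonneg (of_real \<epsilon> + j - star x * x)" using dom[OF \<epsilon>] by blast
    have sj: "star j = j" using nonneg_star[OF nn]
      by (simp add: star_diff star_add star_mult star_star)
    define k where "k = (1 / (4 * \<epsilon>)) *\<^sub>R j"
    have sk: "star k = k" by (simp add: k_def star_scaleR sj)
    have kJ: "k \<in> J" using sc[OF j] by (simp add: k_def scaleR_scaleC)
    have jk: "j = (4 * \<epsilon>) *\<^sub>R k" using \<epsilon> by (simp add: k_def)
    obtain r where r: "(1 + k * k) * r = 1" using nonneg_inverse[OF nonneg_square[OF sk]] by metis
    have sr: "star r = r" and r': "r * (1 + k * k) = 1"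
      using inverse_star[OF _ r] sk by (auto simp: star_add star_mult)
    \<comment> \<open>A sum-of-squares certificate: j = 4 \<epsilon> k, and \<epsilon> + 4
      \<epsilon> k + d = 4 \<epsilon> (1 + k^2)^2.\<close>
    define d where "d = \<epsilon> *\<^sub>R ((1 - 2 *\<^sub>R k) * (1 - 2 *\<^sub>R k)) + (2 * \<epsilon>) *\<^sub>R 1
      + (4 * \<epsilon>) *\<^sub>R (k * k) + (4 * \<epsilon>) *\<^sub>R ((k * k) * (k * k))"
    have "nonneg d"
      unfolding d_def using \<epsilon> sk nonneg_of_real[of 1, where 'a = 'a]
      by (intro nonneg_add nonneg_scaleR nonneg_square)
         (auto simp: star_diff star_scaleR star_mult)
    then have "nonneg ((of_real \<epsilon> + j - star x * x) + d)" by (rule nonneg_add[OF nn])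
    also have "(of_real \<epsilon> + j - star x * x) + d = (4 * \<epsilon>) *\<^sub>R ((1 + k * k) * (1 + k * k)) - star x * x"
      by (simp add: d_def jk of_real_def algebra_simps flip: scaleR_add_left)
    finally have "nonneg (star r * ((4 * \<epsilon>) *\<^sub>R ((1 + k * k) * (1 + k * k)) - star x * x) * r)"
      by (rule nonneg_conjugate)
    also have "star r * ((4 * \<epsilon>) *\<^sub>R ((1 + k * k) * (1 + k * k)) - star x * x) * r
        = (4 * \<epsilon>) *\<^sub>R ((r * (1 + k * k)) * ((1 + k * k) * r)) - star (x * r) * (x * r)"
      by (simp only: sr star_mult right_diff_distrib left_diff_distrib mult_scaleR_left mult_scaleR_right mult.assoc)
    also have "\<dots> = of_real (4 * \<epsilon>) - star (x * r) * (x * r)" by (simp add: r r' of_real_def)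
    \<comment> \<open>The two summands commute because their sum is a scalar, so
      \<open>nonneg_le_norm\<close> applies.\<close>
    finally have "norm (star (x * r) * (x * r)) \<le> norm (star (x * r) * (x * r) + (of_real (4 * \<epsilon>) - star (x * r) * (x * r)))"
      by (intro nonneg_le_norm nonneg_star_mult_self) (simp_all add: right_diff_distrib left_diff_distrib of_real_def)
    then have "(norm (x * r))\<^sup>2 \<le> (e / 2)\<^sup>2"
      using \<epsilon> by (simp add: cstar_identity \<epsilon>_def power_divide)
    then have le: "norm (x * r) \<le> e / 2" by (rule power2_le_imp_le) (use e in simp)
    have "x * (r * k * k) \<in> J" using id[OF kJ] by (simp add: mult.assoc[symmetric])
    moreover have "r * k * k = 1 - r" using r' by (simp add: algebra_simps)
    then have "x - x * (r * k * k) = x * r" by (simp add: right_diff_distrib)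
    then have "dist (x * (r * k * k)) x < e" using le e by (simp add: dist_norm norm_minus_commute)
    ultimately show ?thesis by blast
  qed
  then show ?thesis using closed_approachable[OF cl] by blast
qed

section \<open>States\<close>

locale state =
  fixes f :: "'a::cstar_algebra_1 \<Rightarrow> complex"
  assumes f_add: "f (a + b) = f a + f b"
    and f_scaleC: "f (scaleC c a) = c * f a"
    and f_one: "f 1 = 1"
    and f_pos: "0 \<le> Re (f (star a * a))"
    and f_real: "Im (f (star a * a)) = 0"
begin

lemma f_zero [simp]: "f 0 = 0"
  using f_scaleC[of 0 0] by simp

lemma f_minus: "f (- a) = - f a"
  using f_scaleC[of "-1" a] by (simp add: scaleC_minus_left)

lemma f_diff: "f (a - b) = f a - f b"
  using f_add[of a "- b"] by (simp add: f_minus)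

lemma f_scaleR: "f (r *\<^sub>R a) = r * f a"
  by (simp add: scaleR_scaleC f_scaleC)

lemma f_of_real: "f (of_real r) = r"
  by (simp add: of_real_def f_scaleR f_one)

text \<open>Reality at 1 + b and at b makes the imaginary parts at b and \<open>star b\<close>
  opposite; taking b = a and b = i a settles both parts of f.\<close>

lemma f_star: "f (star a) = cnj (f a)"
proof -
  have im: "Im (f b) + Im (f (star b)) = 0" for b
  proof -
    have "star (1 + b) * (1 + b) = 1 + b + star b + star b * b"
      by (simp add: star_add algebra_simps)
    then show ?thesis using f_real[of "1 + b"] f_real[of b] by (simp add: f_add f_one)
  qed
  show ?thesis
    using im[of a] im[of "scaleC \<i> a"]
    by (auto simp: star_scaleC f_scaleC complex_eq_iff)
qed

lemma f_nonneg: "nonneg a \<Longrightarrow> 0 \<le> Re (f a)"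
  by (auto simp: positive_iff_nonneg[symmetric] positive_def f_pos)

end

text \<open>Lets \<open>upper_bound\<close> be sublinear on the whole algebra as a real vector space
  while measuring self-adjoint parts only.\<close>

definition re_part :: "'a::cstar_algebra \<Rightarrow> 'a" where
  "re_part a = (1 / 2) *\<^sub>R (a + star a)"

lemma re_part_add: "re_part (a + b) = re_part a + re_part b"
  and re_part_scaleR: "re_part (t *\<^sub>R a) = t *\<^sub>R re_part a"
  and re_part_minus: "re_part (- a) = - re_part a"
  and re_part_self_adjoint: "star a = a \<Longrightarrow> re_part a = a"
  and re_part_skew: "star a = - a \<Longrightarrow> re_part a = 0"
  and star_re_part: "star (re_part a) = re_part a"
  by (simp_all add: re_part_def star_add star_scaleR star_minus star_star scaleR_add_right scaleR_diff_right
      scaleR_2[symmetric] add.commute)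

text \<open>For x = \<open>star j\<close>, the element \<open>star x * x = j * star j\<close> is
  itself in J and dominates.\<close>

lemma closed_ideal_star:
  fixes J :: "'a::cstar_algebra_1 set"
  assumes J: "closed_ideal J" and j: "j \<in> J"
  shows "star j \<in> J"
proof (rule mem_closed_ideal_if_dominated[OF J])
  fix \<epsilon> :: real assume "\<epsilon> > 0"
  then have "nonneg (of_real \<epsilon> + j * star j - star (star j) * star j)"
    using nonneg_of_real[of \<epsilon>] by (simp add: star_star)
  then show "\<exists>j'\<in>J. nonneg (of_real \<epsilon> + j' - star (star j) * star j)"
    using J j by (auto simp: closed_ideal_def)
qed

section \<open>The sublinear functional attached to a proper closed ideal\<close>

text \<open>
  \<open>upper_bound J a\<close> is the largest value at \<open>a\<close> of the real part of a state vanishing on \<open>J\<close>.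
\<close>

definition upper_bounds :: "'a::cstar_algebra_1 set \<Rightarrow> 'a \<Rightarrow> real set" where
  "upper_bounds J a = {\<nu>. \<exists>j\<in>J. nonneg (of_real \<nu> + j - re_part a)}"

definition upper_bound :: "'a::cstar_algebra_1 set \<Rightarrow> 'a \<Rightarrow> real" where
  "upper_bound J a = Inf (upper_bounds J a)"

context
  fixes J :: "'a::cstar_algebra_1 set" and x :: 'a
  assumes J: "closed_ideal J" and x: "x \<notin> J"
begin

lemma J_closed:
  "0 \<in> J" "a \<in> J \<Longrightarrow> b \<in> J \<Longrightarrow> a + b \<in> J" "a \<in> J \<Longrightarrow> r *\<^sub>R a \<in> J"
  "a \<in> J \<Longrightarrow> b * a \<in> J" "a \<in> J \<Longrightarrow> a * b \<in> J" "a \<in> J \<Longrightarrow> - a \<in> J"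
proof -
  show sc: "r *\<^sub>R a \<in> J" if "a \<in> J" for a r
    using J that by (simp add: closed_ideal_def complex_subspace_def scaleR_scaleC)
  show "- a \<in> J" if "a \<in> J" using sc[OF that, of "-1"] by simp
qed (use J in \<open>auto simp: closed_ideal_def complex_subspace_def\<close>)

text \<open>If \<mu> < 0, rescaling gives 1 \<le> j / (-\<mu>); then 1 lies in J by domination,
  contradicting that x is outside J.\<close>

lemma nonneg_mod_ideal:
  assumes "j \<in> J" "nonneg (of_real \<mu> + j)"
  shows "0 \<le> \<mu>"
proof (rule ccontr)
  assume "\<not> ?thesis"
  then have \<mu>: "\<mu> < 0" by simp
  have "1 \<in> J"
  proof (rule mem_closed_ideal_if_dominated[OF J])
    fix \<epsilon> :: real assume "\<epsilon> > 0"
    have "nonneg (of_real \<epsilon> + (1 / - \<mu>) *\<^sub>R (of_real \<mu> + j))"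
      using \<mu> \<open>\<epsilon> > 0\<close> by (intro nonneg_add[OF nonneg_of_real nonneg_scaleR[OF _ assms(2)]]) auto
    also have "of_real \<epsilon> + (1 / - \<mu>) *\<^sub>R (of_real \<mu> + j) = of_real \<epsilon> + (1 / - \<mu>) *\<^sub>R j - star 1 * 1"
      using \<mu> by (simp add: of_real_def scaleR_add_right)
    finally show "\<exists>j\<in>J. nonneg (of_real \<epsilon> + j - star 1 * 1)" using J_closed(3)[OF assms(1)] by blast
  qed
  then show False using J_closed(4)[of 1 x] x by simp
qed

lemma upper_bounds_ge: "\<nu> \<in> upper_bounds J a \<Longrightarrow> - norm (re_part a) \<le> \<nu>"
proof -
  assume "\<nu> \<in> upper_bounds J a"
  then obtain j where j: "j \<in> J" "nonneg (of_real \<nu> + j - re_part a)" by (auto simp: upper_bounds_def)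
  have "nonneg (of_real (norm (- re_part a)) - (- re_part a))"
    by (rule nonneg_norm_minus) (simp add: star_minus star_re_part)
  from nonneg_add[OF j(2) this] have "nonneg (of_real (\<nu> + norm (re_part a)) + j)"
    by (simp add: algebra_simps)
  then show ?thesis using nonneg_mod_ideal[OF j(1)] by fastforce
qed

lemma bdd_below_upper_bounds: "bdd_below (upper_bounds J a)"
  using upper_bounds_ge by (intro bdd_belowI)

lemma upper_bounds_nonempty: "upper_bounds J a \<noteq> {}"
  using nonneg_norm_minus[OF star_re_part, of a] J_closed(1)
  by (auto simp: upper_bounds_def intro!: exI[of _ "norm (re_part a)"] bexI[of _ 0])

lemma upper_bound_le: "j \<in> J \<Longrightarrow> nonneg (of_real \<nu> + j - re_part a) \<Longrightarrow> upper_bound J a \<le> \<nu>"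
  unfolding upper_bound_def by (rule cInf_lower[OF _ bdd_below_upper_bounds]) (auto simp: upper_bounds_def)

lemma upper_bound_less:
  assumes "upper_bound J a < \<nu>"
  shows "\<exists>j\<in>J. nonneg (of_real \<nu> + j - re_part a)"
proof -
  obtain \<mu> where "\<mu> \<in> upper_bounds J a" "\<mu> < \<nu>"
    using cInf_lessD[OF upper_bounds_nonempty assms[unfolded upper_bound_def]] by blast
  then obtain j where \<mu>: "\<mu> < \<nu>" "j \<in> J" "nonneg (of_real \<mu> + j - re_part a)"
    by (auto simp: upper_bounds_def)
  have "nonneg (of_real (\<nu> - \<mu>) + (of_real \<mu> + j - re_part a))"
    using \<mu> by (intro nonneg_add nonneg_of_real) auto
  then show ?thesis using \<mu>(2) by (auto simp: algebra_simps)
qed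

lemma sublinear_upper_bound: "sublinear (upper_bound J)"
proof (rule sublinearI)
  fix a b :: 'a
  show "upper_bound J (a + b) \<le> upper_bound J a + upper_bound J b"
  proof (rule field_le_epsilon)
    fix e :: real assume "e > 0"
    obtain i where i: "i \<in> J" "nonneg (of_real (upper_bound J a + e / 2) + i - re_part a)"
      using upper_bound_less[of a "upper_bound J a + e / 2"] \<open>e > 0\<close> by auto
    obtain j where j: "j \<in> J" "nonneg (of_real (upper_bound J b + e / 2) + j - re_part b)"
      using upper_bound_less[of b "upper_bound J b + e / 2"] \<open>e > 0\<close> by auto
    show "upper_bound J (a + b) \<le> upper_bound J a + upper_bound J b + e"
    proof (rule upper_bound_le[OF J_closed(2)[OF i(1) j(1)]])
      have "of_real (upper_bound J a + upper_bound J b + e) + (i + j) - re_part (a + b) =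
        (of_real (upper_bound J a + e / 2) + i - re_part a) + (of_real (upper_bound J b + e / 2) + j - re_part b)"
        by (simp add: re_part_add of_real_def algebra_simps flip: scaleR_add_left)
      then show "nonneg (of_real (upper_bound J a + upper_bound J b + e) + (i + j) - re_part (a + b))"
        using nonneg_add[OF i(2) j(2)] by (simp only:)
    qed
  qed
next
  fix t :: real and a :: 'a
  assume t: "t > 0"
  show "upper_bound J (t *\<^sub>R a) \<le> t * upper_bound J a"
  proof (rule field_le_epsilon)
    fix e :: real assume "e > 0"
    obtain i where i: "i \<in> J" "nonneg (of_real (upper_bound J a + e / t) + i - re_part a)"
      using upper_bound_less[of a "upper_bound J a + e / t"] \<open>e > 0\<close> t by auto
    have "t *\<^sub>R (of_real (upper_bound J a + e / t) + i - re_part a) =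
        of_real (t * upper_bound J a + e) + t *\<^sub>R i - re_part (t *\<^sub>R a)"
      using t by (simp add: re_part_scaleR of_real_def scaleR_add_right scaleR_diff_right distrib_left)
    then show "upper_bound J (t *\<^sub>R a) \<le> t * upper_bound J a + e"
      using nonneg_scaleR[OF _ i(2), of t] t by (intro upper_bound_le[OF J_closed(3)[OF i(1), of t]]) simp
  qed
next
  have "upper_bound J 0 \<le> 0"
    using upper_bound_le[of 0 0 0] J_closed(1) nonneg_of_real[of 0, where 'a = 'a]
    by (simp add: re_part_def)
  moreover have "0 \<le> upper_bound J 0"
    unfolding upper_bound_def
    using upper_bounds_nonempty upper_bounds_ge[of _ 0] by (intro cInf_greatest) (auto simp: re_part_def)
  ultimately show "upper_bound J 0 = 0" by simp
qed

text \<open>Makes the real parts of states vanishing on J admissible competitors in the extremality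
  property.\<close>

lemma state_le_upper_bound:
  assumes g: "state g" and gJ: "\<And>j. j \<in> J \<Longrightarrow> g j = 0"
  shows "Re (g a) \<le> upper_bound J a"
proof (rule field_le_epsilon)
  interpret g: state g by (rule g)
  fix e :: real assume "e > 0"
  then obtain j where j: "j \<in> J" "nonneg (of_real (upper_bound J a + e) + j - re_part a)"
    using upper_bound_less[of a "upper_bound J a + e"] by auto
  have "Re (g (re_part a)) = Re (g a)"
    by (simp add: re_part_def g.f_scaleR g.f_add g.f_star)
  then show "Re (g a) \<le> upper_bound J a + e"
    using g.f_nonneg[OF j(2)] gJ[OF j(1)] by (simp add: g.f_diff g.f_add g.f_of_real del: of_real_add)
qed

text \<open>A real linear functional below \<open>upper_bound J\<close> is the real part of a state
  vanishing on J. Hence extremality among real functionals becomes purity among these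
  states.\<close>

lemma exists_pure_state:
  obtains f where "state f" "\<And>j. j \<in> J \<Longrightarrow> f j = 0" "f (star x * x) \<noteq> 0"
    "\<And>g h t. state g \<Longrightarrow> state h \<Longrightarrow> (\<And>j. j \<in> J \<Longrightarrow> g j = 0) \<Longrightarrow> (\<And>j. j \<in> J \<Longrightarrow> h j = 0) \<Longrightarrow>
      0 < t \<Longrightarrow> t < 1 \<Longrightarrow> (\<And>a. f a = of_real t * g a + of_real (1 - t) * h a) \<Longrightarrow> g = f"
proof -
  obtain f where lin: "linear f" and le: "\<And>a. f a \<le> upper_bound J a"
    and max: "f (star x * x) = upper_bound J (star x * x)"
    and ext: "\<And>g h t a. linear g \<Longrightarrow> linear h \<Longrightarrow> (\<And>a. g a \<le> upper_bound J a) \<Longrightarrow>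
      (\<And>a. h a \<le> upper_bound J a) \<Longrightarrow> 0 < t \<Longrightarrow> t < 1 \<Longrightarrow>
      (\<And>a. f a = t * g a + (1 - t) * h a) \<Longrightarrow> g a = f a"
    using exists_extreme_linear_below[OF sublinear_upper_bound, of "star x * x"] by blast
  note f_simps = linear_add[OF lin] linear_diff[OF lin] linear_neg[OF lin] linear_scale[OF lin]
  have f_le: "f a \<le> \<nu>" if "j \<in> J" "nonneg (of_real \<nu> + j - re_part a)" for a j \<nu>
    using le[of a] upper_bound_le[OF that] by linarith
  have f_nn: "0 \<le> f a" if "nonneg a" for a
    using f_le[OF J_closed(1), of 0 "- a"] that
    by (simp add: re_part_minus re_part_self_adjoint[OF nonneg_star] f_simps)
  have nn0: "nonneg (0::'a)" using nonneg_of_real[of 0] by simp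
  have f_skew: "f a = 0" if "star a = - a" for a
    using f_le[OF J_closed(1), of 0 a] f_le[OF J_closed(1), of 0 "- a"] that nn0
    by (simp add: re_part_minus re_part_skew f_simps)
  have f_J: "f j = 0" if "j \<in> J" for j
  proof -
    have "re_part i \<in> J" if "i \<in> J" for i
      unfolding re_part_def using that closed_ideal_star[OF J] by (intro J_closed) auto
    then have "f i \<le> 0" if "i \<in> J" for i
      using f_le[of "re_part i" 0 i] that nn0 by simp
    from this[of j] this[of "- j"] that show ?thesis by (simp add: J_closed(6) f_simps)
  qed
  \<comment> \<open>The bounds at 1 and at -1 give the two inequalities.\<close>
  have f_1: "f 1 = 1"
    using f_le[OF J_closed(1), of 1 1] f_le[OF J_closed(1), of "-1" "-1"] nn0
    by (simp add: re_part_minus re_part_self_adjoint f_simps)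
  \<comment> \<open>The only complex linear functional with real part f.\<close>
  define F where "F a = Complex (f a) (- f (scaleC \<i> a))" for a
  have F_scaleC: "F (scaleC c a) = c * F a" for c a
  proof -
    have "scaleC c b = Re c *\<^sub>R b + Im c *\<^sub>R scaleC \<i> b" for b :: 'a
      using complex_eq[of c]
      by (simp add: scaleR_scaleC scaleC_scaleC scaleC_add_left[symmetric] mult.commute)
    then have *: "f (scaleC c b) = Re c * f b + Im c * f (scaleC \<i> b)" for b by (simp add: f_simps)
    have "scaleC \<i> (scaleC c a) = scaleC c (scaleC \<i> a)" by (simp add: scaleC_scaleC mult.commute)
    then show ?thesis
      using *[of a] *[of "scaleC \<i> a"]
      by (simp add: F_def complex_eq_iff scaleC_scaleC scaleC_minus_left f_simps algebra_simps)
  qed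
  have "state F"
  proof
    show "F (a + b) = F a + F b" for a b
      by (simp add: F_def scaleC_add_right f_simps complex_eq_iff)
    show "F (scaleC c a) = c * F a" for c a by (rule F_scaleC)
    show "F 1 = 1" using f_skew[of "scaleC \<i> 1"]
      by (simp add: F_def f_1 star_scaleC scaleC_minus_left complex_eq_iff)
    show "0 \<le> Re (F (star a * a))" for a
      using f_nn[OF nonneg_star_mult_self] by (simp add: F_def)
    show "Im (F (star a * a)) = 0" for a
      using f_skew[of "scaleC \<i> (star a * a)"]
      by (simp add: F_def star_scaleC scaleC_minus_left star_mult star_star)
  qed
  moreover have "F j = 0" if "j \<in> J" for j
  proof -
    have "scaleC \<i> j \<in> J" using J that by (simp add: closed_ideal_def complex_subspace_def)
    then show ?thesis using f_J that by (simp add: F_def complex_eq_iff)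
  qed
  moreover have "F (star x * x) \<noteq> 0"
  proof -
    \<comment> \<open>A value at most 0 would dominate \<open>star x * x\<close> by every \<epsilon>
      > 0 modulo J and put x into J.\<close>
    have "upper_bound J (star x * x) > 0"
    proof (rule ccontr)
      assume "\<not> ?thesis"
      then have "\<exists>j\<in>J. nonneg (of_real \<epsilon> + j - re_part (star x * x))" if "\<epsilon> > 0" for \<epsilon>
        using that by (intro upper_bound_less) auto
      moreover have "re_part (star x * x) = star x * x"
        by (rule re_part_self_adjoint) (simp add: star_mult star_star)
      ultimately have "x \<in> J" by (intro mem_closed_ideal_if_dominated[OF J]) auto
      then show False using x by simp
    qed
    then show ?thesis using max by (auto simp: F_def complex_eq_iff)
  qed
  moreover have "g = F"
    if g: "state g" "\<And>j. j \<in> J \<Longrightarrow> g j = 0" and h: "state h" "\<And>j. j \<in> J \<Longrightarrow> h j = 0"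
      and t: "0 < t" "t < 1" and eq: "\<And>a. F a = of_real t * g a + of_real (1 - t) * h a" for g h t
  proof -
    have lin': "linear (\<lambda>a. Re (k a))" if "state k" for k :: "'a \<Rightarrow> complex"
      using state.f_add[OF that] state.f_scaleR[OF that] by (intro linearI) auto
    have "f a = t * Re (g a) + (1 - t) * Re (h a)" for a
      using arg_cong[OF eq[of a], of Re] by (simp add: F_def)
    then have Re: "Re (g a) = f a" for a
      using ext[of "\<lambda>a. Re (g a)" "\<lambda>a. Re (h a)" t] lin'[OF g(1)] lin'[OF h(1)]
        state_le_upper_bound[OF g] state_le_upper_bound[OF h] t by blast
    have "g a = F a" for a
      using Re[of a] Re[of "scaleC \<i> a"] by (simp add: F_def complex_eq_iff state.f_scaleC[OF g(1)])
    then show ?thesis by blast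
  qed
  ultimately show ?thesis using that by metis
qed

end

section \<open>Orthogonal projections\<close>

context complex_hilbert_space
begin

lemma hnorm_sq_add:
  assumes "x \<in> H" "y \<in> H"
  shows "(hnorm (x + y))\<^sup>2 = (hnorm x)\<^sup>2 + 2 * Re (ip x y) + (hnorm y)\<^sup>2"
proof -
  have 1: "ip (x + y) x = cnj (ip x (x + y))" "ip (x + y) y = cnj (ip y (x + y))"
    by (rule ip_cnj; simp add: assms)+
  have 2: "ip y x = cnj (ip x y)" by (rule ip_cnj; simp add: assms)
  have "ip (x + y) (x + y) = ip (x + y) x + ip (x + y) y" using assms by (simp add: ip_add)
  then have "Re (ip (x + y) (x + y)) = Re (ip x x) + 2 * Re (ip x y) + Re (ip y y)"
    using assms by (simp add: 1 ip_add 2)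
  then show ?thesis using assms by (simp add: hnorm_sq)
qed

lemma hnorm_scale: "x \<in> H \<Longrightarrow> hnorm (scale c x) = cmod c * hnorm x"
proof -
  assume x: "x \<in> H"
  have "ip (scale c x) (scale c x) = (c * cnj c) * ip x x"
    using x by (simp add: ip_scale ip_scale_left)
  also have "\<dots> = complex_of_real ((cmod c)\<^sup>2 * Re (ip x x))"
    using ip_self[OF x] by (metis complex_norm_square of_real_mult)
  finally show ?thesis by (simp add: hnorm_def real_sqrt_mult)
qed

lemma hnorm_triangle: "x \<in> H \<Longrightarrow> y \<in> H \<Longrightarrow> hnorm (x + y) \<le> hnorm x + hnorm y"
proof -
  assume xy: "x \<in> H" "y \<in> H"
  have "(hnorm (x + y))\<^sup>2 \<le> (hnorm x + hnorm y)\<^sup>2"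
    using Cauchy_Schwarz[OF xy] complex_Re_le_cmod[of "ip x y"]
    by (simp add: hnorm_sq_add xy power2_sum)
  then show ?thesis by (rule power2_le_imp_le) (simp add: xy)
qed

lemma hnorm_minus: "x \<in> H \<Longrightarrow> hnorm (- x) = hnorm x"
  using hnorm_scale[of x "-1"] by simp

lemma hnorm_sq_diff:
  assumes "x \<in> H" "y \<in> H"
  shows "(hnorm (x - y))\<^sup>2 = (hnorm x)\<^sup>2 - 2 * Re (ip x y) + (hnorm y)\<^sup>2"
proof -
  have "- y \<in> H" using assms(2) H_simps(4)[of y "-1"] by simp
  moreover have "ip x (- y) = - ip x y" using assms ip_diff[of x 0 y] by simp
  ultimately show ?thesis using hnorm_sq_add[of x "- y"] assms by (simp add: hnorm_minus)
qed

lemma orthogonal_if_closest: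
  assumes v: "v \<in> H" and y: "y \<in> H" and min: "\<And>c. hnorm v \<le> hnorm (v - scale c y)"
  shows "ip y v = 0"
proof (rule ccontr)
  assume "ip y v \<noteq> 0"
  define \<gamma> where "\<gamma> = ip y v"
  \<comment> \<open>Moving v by t \<gamma> y changes its squared norm by t |\<gamma>|^2 (t |y|^2 -
    2), which is negative because t |y|^2 < 1.\<close>
  define t where "t = 1 / (1 + (hnorm y)\<^sup>2)"
  have t: "t > 0" "t * (hnorm y)\<^sup>2 < 1"
    by (simp_all add: t_def add_pos_nonneg divide_simps)
  have vy: "ip v y = cnj \<gamma>" using v y ip_cnj[of y v] by (simp add: \<gamma>_def)
  have ys: "scale (t * \<gamma>) y \<in> H" using y by simp
  have "(hnorm v)\<^sup>2 \<le> (hnorm (v - scale (t * \<gamma>) y))\<^sup>2"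
    using min v by (intro power_mono) auto
  also have "\<dots> = (hnorm v)\<^sup>2 - 2 * Re (t * \<gamma> * cnj \<gamma>) + (cmod (t * \<gamma>) * hnorm y)\<^sup>2"
    using v y ys by (simp add: hnorm_sq_diff hnorm_scale ip_scale vy)
  also have "Re (t * \<gamma> * cnj \<gamma>) = t * (cmod \<gamma>)\<^sup>2"
    by (metis Re_complex_of_real complex_norm_square mult.assoc of_real_mult)
  also have "(cmod (t * \<gamma>) * hnorm y)\<^sup>2 = t * (cmod \<gamma>)\<^sup>2 * (t * (hnorm y)\<^sup>2)"
    by (simp add: norm_mult power_mult_distrib power2_eq_square)
  finally have "t * (cmod \<gamma>)\<^sup>2 * 2 \<le> t * (cmod \<gamma>)\<^sup>2 * (t * (hnorm y)\<^sup>2)" by simp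
  moreover have "t * (cmod \<gamma>)\<^sup>2 > 0" using t \<open>ip y v \<noteq> 0\<close> by (simp add: \<gamma>_def)
  ultimately show False using t(2) by (simp only: mult_le_cancel_left_pos)
qed

lemma exists_projection:
  assumes K: "closed_subspace K" and x: "x \<in> H"
  obtains k where "k \<in> K" "\<And>y. y \<in> K \<Longrightarrow> ip y (x - k) = 0"
proof -
  have sub: "subspace K" and KH: "K \<subseteq> H"
    and lim: "\<And>X l. (\<And>n. X n \<in> K) \<Longrightarrow> l \<in> H \<Longrightarrow> (\<lambda>n. hnorm (X n - l)) \<longlonglongrightarrow> 0 \<Longrightarrow> l \<in> K"
    using K unfolding closed_subspace_def by blast+
  have KH': "y \<in> H" if "y \<in> K" for y using that KH by blast
  define D where "D = (\<lambda>y. (hnorm (x - y))\<^sup>2) ` K"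
  define d where "d = Inf D"
  have bdd: "bdd_below D" unfolding D_def by (intro bdd_belowI2[of _ 0]) simp
  have ne: "D \<noteq> {}" using subspace_0[OF sub] by (auto simp: D_def)
  have dle: "d \<le> (hnorm (x - y))\<^sup>2" if "y \<in> K" for y
    unfolding d_def using that bdd by (intro cInf_lower) (auto simp: D_def)
  have "\<exists>y\<in>K. (hnorm (x - y))\<^sup>2 < d + 1 / real (Suc n)" for n
    using cInf_lessD[OF ne, of "d + 1 / real (Suc n)"] by (auto simp: d_def D_def)
  then obtain Y where Y: "Y n \<in> K" "(hnorm (x - Y n))\<^sup>2 < d + 1 / real (Suc n)" for n by metis
  have YH: "Y n \<in> H" for n using Y(1) KH by blast
  \<comment> \<open>Parallelogram law: the midpoint of Y m and Y n lies in K, so its distance to x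
    is at least sqrt d, which forces Y m and Y n together.\<close>
  have par: "(hnorm (Y m - Y n))\<^sup>2 \<le> 2 / real (Suc m) + 2 / real (Suc n)" for m n
  proof -
    define u v where "u = x - Y m" and "v = x - Y n"
    have uv: "u \<in> H" "v \<in> H" using x YH by (auto simp: u_def v_def)
    have mid: "scale (1 / 2) (Y m + Y n) \<in> K"
      using Y(1) sub by (intro subspace_scale subspace_add) auto
    have "x - scale (1 / 2) (Y m + Y n) = scale (1 / 2) (u + v)"
    proof -
      have half: "scale (1 / 2) (x + x) = x"
        using scale_left_distrib[of "1 / 2" "1 / 2" x] by (simp add: scale_right_distrib)
      have "u + v = (x + x) - (Y m + Y n)" by (simp add: u_def v_def)
      then show ?thesis by (simp only: scale_right_diff_distrib half)
    qed
    then have "d \<le> (hnorm (scale (1 / 2) (u + v)))\<^sup>2" using dle[OF mid] by simp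
    also have "\<dots> = (hnorm (u + v))\<^sup>2 / 4" using uv by (simp add: hnorm_scale power_divide)
    finally have "4 * d \<le> (hnorm (u + v))\<^sup>2" by simp
    moreover have "(hnorm (v - u))\<^sup>2 + (hnorm (u + v))\<^sup>2 = 2 * (hnorm u)\<^sup>2 + 2 * (hnorm v)\<^sup>2"
      using hnorm_sq_add[OF uv(2,1)] hnorm_sq_diff[OF uv(2,1)] by (simp add: add.commute)
    moreover have "v - u = Y m - Y n" by (simp add: u_def v_def)
    ultimately show ?thesis using Y(2)[of m] Y(2)[of n] by (simp add: u_def v_def)
  qed
  have "\<exists>l\<in>H. (\<lambda>n. sqrt (Re (ip (Y n - l) (Y n - l)))) \<longlonglongrightarrow> 0"
  proof (rule complete_H)
    show "\<forall>e>0. \<exists>N. \<forall>m\<ge>N. \<forall>n\<ge>N. sqrt (Re (ip (Y m - Y n) (Y m - Y n))) < e"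
    proof (intro allI impI)
      fix e :: real assume e: "e > 0"
      obtain N where N: "inverse (real (Suc N)) < e\<^sup>2 / 4" using reals_Archimedean[of "e\<^sup>2 / 4"] e by auto
      have "hnorm (Y m - Y n) < e" if "m \<ge> N" "n \<ge> N" for m n
      proof -
        have "1 / real (Suc m) \<le> 1 / real (Suc N)" "1 / real (Suc n) \<le> 1 / real (Suc N)"
          using that by (auto simp: divide_simps)
        then have "(hnorm (Y m - Y n))\<^sup>2 < e\<^sup>2" using par[of m n] N by (simp add: inverse_eq_divide)
        then show ?thesis by (rule power2_less_imp_less) (use e in simp)
      qed
      then show "\<exists>N. \<forall>m\<ge>N. \<forall>n\<ge>N. sqrt (Re (ip (Y m - Y n) (Y m - Y n))) < e"
        unfolding hnorm_def by blast
    qed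
  qed (simp add: YH)
  then obtain l where l: "l \<in> H" and lY: "(\<lambda>n. hnorm (Y n - l)) \<longlonglongrightarrow> 0" by (auto simp: hnorm_def)
  have lK: "l \<in> K" using Y(1) l lY by (rule lim)
  have le: "hnorm (x - l) \<le> sqrt d"
  proof (rule LIMSEQ_le_const)
    have "(\<lambda>n. d + 1 / real (Suc n)) \<longlonglongrightarrow> d + 0"
      by (intro tendsto_intros LIMSEQ_Suc[OF lim_1_over_n])
    then show "(\<lambda>n. sqrt (d + 1 / real (Suc n)) + hnorm (Y n - l)) \<longlonglongrightarrow> sqrt d"
      using tendsto_add[OF tendsto_real_sqrt lY, of _ d] by simp
    have "hnorm (x - l) \<le> sqrt (d + 1 / real (Suc n)) + hnorm (Y n - l)" for n
    proof -
      have "hnorm (x - l) \<le> hnorm (x - Y n) + hnorm (Y n - l)"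
        using hnorm_triangle[of "x - Y n" "Y n - l"] x l YH by simp
      moreover have "hnorm (x - Y n) \<le> sqrt (d + 1 / real (Suc n))"
        using Y(2)[of n] by (intro real_le_rsqrt) simp
      ultimately show ?thesis by simp
    qed
    then show "\<exists>N. \<forall>n\<ge>N. hnorm (x - l) \<le> sqrt (d + 1 / real (Suc n)) + hnorm (Y n - l)" by blast
  qed
  have min: "hnorm (x - l) \<le> hnorm (x - y)" if "y \<in> K" for y
    using le real_sqrt_le_mono[OF dle[OF that]] x KH'[OF that] by simp
  show ?thesis
  proof (rule that[OF lK])
    fix y assume y: "y \<in> K"
    show "ip y (x - l) = 0"
    proof (rule orthogonal_if_closest)
      fix c
      have "l + scale c y \<in> K" using lK y sub by (intro subspace_add subspace_scale)
      then show "hnorm (x - l) \<le> hnorm (x - l - scale c y)" using min[of "l + scale c y"] by (simp add: algebra_simps)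
    qed (use x l KH'[OF y] in auto)
  qed
qed

end

section \<open>The GNS construction\<close>

text \<open>
  A vector of the Hilbert space is represented by the functional \<open>a \<mapsto> \<langle>a, v\<rangle>\<close> on the algebra,
  where \<open>v\<close> is the limit of a sequence that is Cauchy for the seminorm of the state.
\<close>

context state
begin

definition form :: "'a \<Rightarrow> 'a \<Rightarrow> complex" where
  "form a b = f (star a * b)"

definition seminorm :: "'a \<Rightarrow> real" where
  "seminorm a = sqrt (Re (form a a))"

lemma form_simps:
  "form a (b + c) = form a b + form a c" "form (a + b) c = form a c + form b c"
  "form a (b - c) = form a b - form a c" "form (a - b) c = form a c - form b c"
  "form a (scaleC z b) = z * form a b" "form (scaleC z a) b = cnj z * form a b"
  "form a 0 = 0" "form 0 a = 0" "form a (b * c) = form (star b * a) c"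
  by (simp_all add: form_def star_add star_diff star_scaleC star_mult star_star f_add f_diff
      f_scaleC algebra_simps mult_scaleC_left mult_scaleC_right)

lemma form_cnj: "form b a = cnj (form a b)"
  using f_star[of "star a * b"] by (simp add: form_def star_mult star_star)

lemma form_self_nonneg: "0 \<le> Re (form a a)" and form_self_real: "Im (form a a) = 0"
  by (simp_all add: form_def f_pos f_real)

lemma form_self: "form a a = (seminorm a)\<^sup>2"
  using form_self_nonneg[of a] form_self_real[of a] by (simp add: seminorm_def complex_eq_iff)

lemma seminorm_nonneg [simp]: "0 \<le> seminorm a"
  by (simp add: seminorm_def form_self_nonneg)

lemma form_Cauchy_Schwarz: "cmod (form a b) \<le> seminorm a * seminorm b"
proof -
  define \<gamma> where "\<gamma> = form a b"
  define A B where "A = (seminorm a)\<^sup>2" and "B = (seminorm b)\<^sup>2"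
  have A0: "A \<ge> 0" by (simp add: A_def)
  have *: "0 \<le> B - 2 * t * (cmod \<gamma>)\<^sup>2 + t\<^sup>2 * (cmod \<gamma>)\<^sup>2 * A" for t :: real
  proof -
    let ?v = "b - scaleC (t * \<gamma>) a"
    have "form ?v ?v = B - t * \<gamma> * cnj \<gamma> - t * cnj \<gamma> * \<gamma> + t * \<gamma> * (t * cnj \<gamma>) * A"
      by (simp add: form_simps form_self[of a] form_self[of b] A_def B_def form_cnj[of b a] \<gamma>_def[symmetric] algebra_simps)
    also have "\<dots> = B - 2 * t * (\<gamma> * cnj \<gamma>) + t\<^sup>2 * (\<gamma> * cnj \<gamma>) * A"
      by (simp add: algebra_simps power2_eq_square)
    also have "\<gamma> * cnj \<gamma> = complex_of_real ((cmod \<gamma>)\<^sup>2)" using complex_norm_square[of \<gamma>] by simp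
    finally have "form ?v ?v = complex_of_real (B - 2 * t * (cmod \<gamma>)\<^sup>2 + t\<^sup>2 * (cmod \<gamma>)\<^sup>2 * A)" by simp
    then show ?thesis using form_self_nonneg[of ?v] by simp
  qed
  have "(cmod \<gamma>)\<^sup>2 \<le> A * B"
  proof (cases "A = 0")
    case True
    have "(cmod \<gamma>)\<^sup>2 = 0"
    proof (rule ccontr)
      assume "(cmod \<gamma>)\<^sup>2 \<noteq> 0"
      \<comment> \<open>The form may be degenerate. For A = 0 the quadratic is B - 2 t |\<gamma>|^2,
        which equals -1 at this t.\<close>
      then show False using *[of "(B + 1) / (2 * (cmod \<gamma>)\<^sup>2)"] True by simp
    qed
    then show ?thesis using True by simp
  next
    case False
    then have "A > 0" using A0 by simp
    then show ?thesis using *[of "1 / A"] by (simp add: power2_eq_square field_simps)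
  qed
  then have "(cmod \<gamma>)\<^sup>2 \<le> (seminorm a * seminorm b)\<^sup>2" by (simp add: A_def B_def power_mult_distrib)
  then show ?thesis unfolding \<gamma>_def by (rule power2_le_imp_le) simp
qed

lemma seminorm_triangle: "seminorm (a + b) \<le> seminorm a + seminorm b"
proof -
  have "form (a + b) (a + b) = form a a + form b b + (form a b + cnj (form a b))"
    by (simp add: form_simps form_cnj[of b a])
  from arg_cong[OF this, of Re]
  have "(seminorm (a + b))\<^sup>2 = (seminorm a)\<^sup>2 + (seminorm b)\<^sup>2 + 2 * Re (form a b)"
    by (simp add: form_self flip: of_real_power)
  also have "\<dots> \<le> (seminorm a + seminorm b)\<^sup>2"
    using form_Cauchy_Schwarz[of a b] complex_Re_le_cmod[of "form a b"] by (simp add: power2_sum)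
  finally show ?thesis by (rule power2_le_imp_le) simp
qed

lemma seminorm_scaleC: "seminorm (scaleC c a) = cmod c * seminorm a"
proof -
  have "form (scaleC c a) (scaleC c a) = complex_of_real ((cmod c)\<^sup>2) * form a a"
    using complex_norm_square[of c] by (simp add: form_simps mult.commute)
  then show ?thesis by (simp add: seminorm_def real_sqrt_mult)
qed

lemma seminorm_minus: "seminorm (- a) = seminorm a"
  using seminorm_scaleC[of "-1" a] by (simp add: scaleC_minus_left)

lemma seminorm_diff_commute: "seminorm (a - b) = seminorm (b - a)"
  using seminorm_minus[of "a - b"] by simp

lemma seminorm_diff_le: "\<bar>seminorm a - seminorm b\<bar> \<le> seminorm (a - b)"
  using seminorm_triangle[of "a - b" b] seminorm_triangle[of "b - a" a] seminorm_diff_commute[of a b]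
  by simp

text \<open>Conjugate \<open>star a * a \<le> (norm a)^2\<close> by b and apply the state; this
  makes left multiplication bounded on the completion.\<close>

lemma seminorm_mult: "seminorm (a * b) \<le> norm a * seminorm b"
proof -
  have "star (star a * a) = star a * a" by (simp add: star_mult star_star)
  then have "nonneg (of_real (norm (star a * a)) - star a * a)" by (rule nonneg_norm_minus)
  then have "nonneg (star b * (of_real ((norm a)\<^sup>2) - star a * a) * b)"
    unfolding cstar_identity by (rule nonneg_conjugate)
  also have "star b * (of_real ((norm a)\<^sup>2) - star a * a) * b
      = ((norm a)\<^sup>2) *\<^sub>R (star b * b) - star (a * b) * (a * b)"
    by (simp add: right_diff_distrib left_diff_distrib star_mult of_real_def mult.assoc)
  finally have "0 \<le> Re (f (((norm a)\<^sup>2) *\<^sub>R (star b * b) - star (a * b) * (a * b)))"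
    by (rule f_nonneg)
  then have "0 \<le> Re (complex_of_real ((norm a)\<^sup>2) * form b b - form (a * b) (a * b))"
    by (simp only: f_diff f_scaleR form_def)
  then have "(seminorm (a * b))\<^sup>2 \<le> (norm a)\<^sup>2 * (seminorm b)\<^sup>2"
    by (simp add: form_self flip: of_real_power of_real_mult)
  then have "(seminorm (a * b))\<^sup>2 \<le> (norm a * seminorm b)\<^sup>2" by (simp add: power_mult_distrib)
  then show ?thesis by (rule power2_le_imp_le) simp
qed

section \<open>Sequences that are Cauchy for the seminorm\<close>

definition cauchy :: "(nat \<Rightarrow> 'a) \<Rightarrow> bool" where
  "cauchy X \<longleftrightarrow> (\<forall>e>0. \<exists>N. \<forall>m\<ge>N. \<forall>n\<ge>N. seminorm (X m - X n) < e)"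

lemma cauchyD:
  assumes "cauchy X" "0 < e"
  obtains N where "\<And>m n. N \<le> m \<Longrightarrow> N \<le> n \<Longrightarrow> seminorm (X m - X n) < e"
  using assms unfolding cauchy_def by blast

lemma cauchy_if_dominated:
  assumes X: "cauchy X" and Y: "cauchy Y"
    and le: "\<And>m n. seminorm (Z m - Z n) \<le> C * (seminorm (X m - X n) + seminorm (Y m - Y n))"
  shows "cauchy Z"
  unfolding cauchy_def
proof (intro allI impI)
  fix e :: real assume e: "e > 0"
  \<comment> \<open>The maximum keeps the divisor positive, as no sign is assumed for C.\<close>
  define d where "d = e / (2 * max C 1)"
  have d: "d > 0" using e by (simp add: d_def)
  obtain M N where M: "\<And>m n. M \<le> m \<Longrightarrow> M \<le> n \<Longrightarrow> seminorm (X m - X n) < d"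
    and N: "\<And>m n. N \<le> m \<Longrightarrow> N \<le> n \<Longrightarrow> seminorm (Y m - Y n) < d"
    using cauchyD[OF X d] cauchyD[OF Y d] by metis
  have "seminorm (Z m - Z n) < e" if "m \<ge> max M N" "n \<ge> max M N" for m n
  proof -
    have "seminorm (Z m - Z n) \<le> max C 1 * (seminorm (X m - X n) + seminorm (Y m - Y n))"
      using le[of m n] mult_right_mono[of C "max C 1" "seminorm (X m - X n) + seminorm (Y m - Y n)"] by simp
    also have "\<dots> < max C 1 * (d + d)"
      using M[of m n] N[of m n] that by (intro mult_strict_left_mono add_strict_mono) auto
    also have "\<dots> = e" by (simp add: d_def field_simps)
    finally show ?thesis .
  qed
  then show "\<exists>N. \<forall>m\<ge>N. \<forall>n\<ge>N. seminorm (Z m - Z n) < e" by blast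
qed

lemma cauchy_const: "cauchy (\<lambda>n. a)"
  by (simp add: cauchy_def seminorm_def form_simps)

lemma cauchy_add: "cauchy X \<Longrightarrow> cauchy Y \<Longrightarrow> cauchy (\<lambda>n. X n + Y n)"
  by (erule (1) cauchy_if_dominated[where C = 1])
     (simp add: add_diff_add seminorm_triangle)

lemma seminorm_zero [simp]: "seminorm 0 = 0"
  by (simp add: seminorm_def form_simps)

lemma cauchy_mult: "cauchy X \<Longrightarrow> cauchy (\<lambda>n. a * X n)"
  by (rule cauchy_if_dominated[where Y = "\<lambda>n. 0" and C = "norm a"], assumption, rule cauchy_const)
     (simp add: right_diff_distrib[symmetric] seminorm_mult)

lemma cauchy_scaleC: "cauchy X \<Longrightarrow> cauchy (\<lambda>n. scaleC c (X n))"
  using cauchy_mult[of X "scaleC c 1"] by (simp add: mult_scaleC_left)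

lemma cauchy_convergent:
  fixes u :: "nat \<Rightarrow> 'b::banach"
  assumes X: "cauchy X" and Y: "cauchy Y" and C: "0 \<le> C"
    and le: "\<And>m n. norm (u m - u n) \<le> C * (seminorm (X m - X n) + seminorm (Y m - Y n))"
  shows "convergent u"
proof -
  have "Cauchy u"
  proof (rule CauchyI)
    fix e :: real assume e: "e > 0"
    define d where "d = e / (2 * (C + 1))"
    have d: "d > 0" using e C by (simp add: d_def)
    obtain M N where M: "\<And>m n. M \<le> m \<Longrightarrow> M \<le> n \<Longrightarrow> seminorm (X m - X n) < d"
      and N: "\<And>m n. N \<le> m \<Longrightarrow> N \<le> n \<Longrightarrow> seminorm (Y m - Y n) < d"
      using cauchyD[OF X d] cauchyD[OF Y d] by metis
    have "norm (u m - u n) < e" if "m \<ge> max M N" "n \<ge> max M N" for m n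
    proof -
      have "norm (u m - u n) \<le> (C + 1) * (seminorm (X m - X n) + seminorm (Y m - Y n))"
        using le[of m n] by (simp add: distrib_right) (smt (verit) seminorm_nonneg)
      also have "\<dots> < (C + 1) * (d + d)"
        using M[of m n] N[of m n] that C by (intro mult_strict_left_mono add_strict_mono) auto
      also have "\<dots> = 2 * (C + 1) * d" by (simp add: algebra_simps)
      also have "\<dots> = e" using C by (simp add: d_def)
      finally show ?thesis .
    qed
    then show "\<exists>M. \<forall>m\<ge>M. \<forall>n\<ge>M. norm (u m - u n) < e" by blast
  qed
  then show ?thesis by (simp add: Cauchy_convergent_iff)
qed

lemma cauchy_bounded:
  assumes X: "cauchy X"
  obtains C where "0 < C" "\<And>n. seminorm (X n) \<le> C"
proof -
  have "convergent (\<lambda>n. seminorm (X n))"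
    by (rule cauchy_convergent[OF X cauchy_const[of 0], where C = 1])
       (use seminorm_diff_le in \<open>auto intro: add_increasing2\<close>)
  then obtain K where "K > 0" "\<And>n. norm (seminorm (X n)) \<le> K"
    by (meson BseqE convergent_imp_Bseq)
  then show ?thesis using that by simp
qed

lemma form_diff_le:
  "cmod (form a b - form a' b') \<le> seminorm (a - a') * seminorm b + seminorm a' * seminorm (b - b')"
proof -
  have "form a b - form a' b' = form (a - a') b + form a' (b - b')" by (simp add: form_simps)
  then show ?thesis
    using norm_triangle_ineq[of "form (a - a') b" "form a' (b - b')"]
      form_Cauchy_Schwarz[of "a - a'" b] form_Cauchy_Schwarz[of a' "b - b'"] by simp
qed

lemma convergent_form:
  assumes X: "cauchy X"
  shows "convergent (\<lambda>n. form a (X n))"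
proof (rule cauchy_convergent[OF X cauchy_const[of 0], where C = "seminorm a"])
  show "norm (form a (X m) - form a (X n)) \<le> seminorm a * (seminorm (X m - X n) + seminorm (0 - 0))" for m n
    using form_diff_le[of a "X m" a "X n"] by (simp add: seminorm_def[of 0] form_simps)
qed simp

lemma convergent_form2:
  assumes X: "cauchy X" and Y: "cauchy Y"
  shows "convergent (\<lambda>n. form (X n) (Y n))"
proof -
  obtain A B where A: "\<And>n. seminorm (X n) \<le> A" "0 < A" and B: "\<And>n. seminorm (Y n) \<le> B" "0 < B"
    using cauchy_bounded[OF X] cauchy_bounded[OF Y] by metis
  show ?thesis
  proof (rule cauchy_convergent[OF X Y, where C = "A + B"])
    show "norm (form (X m) (Y m) - form (X n) (Y n)) \<le> (A + B) * (seminorm (X m - X n) + seminorm (Y m - Y n))" for m n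
    proof -
      have "norm (form (X m) (Y m) - form (X n) (Y n)) \<le>
          seminorm (X m - X n) * seminorm (Y m) + seminorm (X n) * seminorm (Y m - Y n)"
        by (rule form_diff_le)
      also have "\<dots> \<le> seminorm (X m - X n) * (A + B) + (A + B) * seminorm (Y m - Y n)"
        using A(1)[of n] B(1)[of m] A(2) B(2)
        by (intro add_mono mult_left_mono mult_right_mono) auto
      finally show ?thesis by (simp add: algebra_simps)
    qed
  qed (use A B in simp)
qed

section \<open>The completion as a space of functionals\<close>

definition represents :: "(nat \<Rightarrow> 'a) \<Rightarrow> ('a \<Rightarrow> complex) \<Rightarrow> bool" where
  "represents X \<phi> \<longleftrightarrow> cauchy X \<and> (\<forall>a. (\<lambda>n. form a (X n)) \<longlonglongrightarrow> \<phi> a)"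

definition gns_space :: "('a \<Rightarrow> complex) set" where
  "gns_space = {\<phi>. \<exists>X. represents X \<phi>}"

definition representative :: "('a \<Rightarrow> complex) \<Rightarrow> nat \<Rightarrow> 'a" where
  "representative \<phi> = (SOME X. represents X \<phi>)"

text \<open>Uses chosen representatives; \<open>gns_ip_limit\<close> shows that all representatives
  give the same limit.\<close>

definition gns_ip :: "('a \<Rightarrow> complex) \<Rightarrow> ('a \<Rightarrow> complex) \<Rightarrow> complex" where
  "gns_ip \<phi> \<psi> = lim (\<lambda>n. form (representative \<phi> n) (representative \<psi> n))"

definition gns_vector :: "'a \<Rightarrow> 'a \<Rightarrow> complex" where
  "gns_vector a b = form b a"

text \<open>Moving a to the other side of the form: the coefficient of a v against b is that of v
  against \<open>star a * b\<close>.\<close>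

definition gns_rep :: "'a \<Rightarrow> ('a \<Rightarrow> complex) \<Rightarrow> ('a \<Rightarrow> complex)" where
  "gns_rep a \<phi> b = \<phi> (star a * b)"

definition gns_norm :: "('a \<Rightarrow> complex) \<Rightarrow> real" where
  "gns_norm \<phi> = sqrt (Re (gns_ip \<phi> \<phi>))"

lemma represents_add: "represents X \<phi> \<Longrightarrow> represents Y \<psi> \<Longrightarrow> represents (\<lambda>n. X n + Y n) (\<phi> + \<psi>)"
  by (auto simp: represents_def form_simps intro: cauchy_add tendsto_add)

lemma represents_scale: "represents X \<phi> \<Longrightarrow> represents (\<lambda>n. scaleC c (X n)) (\<lambda>a. c * \<phi> a)"
  by (auto simp: represents_def form_simps intro: cauchy_scaleC tendsto_mult_left)

lemma represents_diff: "represents X \<phi> \<Longrightarrow> represents Y \<psi> \<Longrightarrow> represents (\<lambda>n. X n - Y n) (\<phi> - \<psi>)"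
  using represents_add[of X \<phi> "\<lambda>n. scaleC (- 1) (Y n)" "\<lambda>a. - 1 * \<psi> a"] represents_scale[of Y \<psi> "- 1"]
  by (simp add: scaleC_minus_left plus_fun_def fun_diff_def)

lemma represents_gns_vector: "represents (\<lambda>n. a) (gns_vector a)"
  by (simp add: represents_def cauchy_const gns_vector_def)

lemma represents_gns_rep: "represents X \<phi> \<Longrightarrow> represents (\<lambda>n. a * X n) (gns_rep a \<phi>)"
  by (auto simp: represents_def gns_rep_def form_simps intro: cauchy_mult)

lemma represents_zero: "represents (\<lambda>n. 0) 0"
  by (simp add: represents_def cauchy_const form_simps)

lemma gns_spaceI: "represents X \<phi> \<Longrightarrow> \<phi> \<in> gns_space"
  by (auto simp: gns_space_def)

lemma gns_spaceE:
  assumes "\<phi> \<in> gns_space"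
  obtains X where "represents X \<phi>"
  using assms by (auto simp: gns_space_def)

lemma gns_space_closed:
  "0 \<in> gns_space" "\<phi> \<in> gns_space \<Longrightarrow> \<psi> \<in> gns_space \<Longrightarrow> \<phi> + \<psi> \<in> gns_space"
  "\<phi> \<in> gns_space \<Longrightarrow> \<psi> \<in> gns_space \<Longrightarrow> \<phi> - \<psi> \<in> gns_space"
  "\<phi> \<in> gns_space \<Longrightarrow> (\<lambda>a. c * \<phi> a) \<in> gns_space" "gns_vector a \<in> gns_space"
  "\<phi> \<in> gns_space \<Longrightarrow> gns_rep a \<phi> \<in> gns_space"
  using represents_zero represents_add represents_diff represents_scale represents_gns_vector
    represents_gns_rep
  unfolding gns_space_def mem_Collect_eq by metis+

text \<open>A weakly null Cauchy sequence is null: the square of the seminorm of Z n is the limit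
  over m of \<open>form (Z n) (Z n - Z m)\<close>, at most (e / 2) times that seminorm. So a
  functional determines its vector.\<close>

lemma represents_zero_seminorm:
  assumes Z: "represents Z 0"
  shows "(\<lambda>n. seminorm (Z n)) \<longlonglongrightarrow> 0"
proof (rule LIMSEQ_I)
  fix e :: real assume "e > 0"
  have cau: "cauchy Z" and lim: "\<And>a. (\<lambda>n. form a (Z n)) \<longlonglongrightarrow> 0"
    using Z by (auto simp: represents_def)
  have "e / 2 > 0" using \<open>e > 0\<close> by simp
  then obtain N where N: "\<And>m n. N \<le> m \<Longrightarrow> N \<le> n \<Longrightarrow> seminorm (Z m - Z n) < e / 2"
    using cauchyD[OF cau] by metis
  have "seminorm (Z n) < e" if n: "n \<ge> N" for n
  proof -
    have "cmod (form (Z n) (Z n) - 0) \<le> seminorm (Z n) * (e / 2)"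
    proof (rule LIMSEQ_le_const2)
      show "(\<lambda>m. cmod (form (Z n) (Z n) - form (Z n) (Z m))) \<longlonglongrightarrow> cmod (form (Z n) (Z n) - 0)"
        by (intro tendsto_intros lim)
      have "cmod (form (Z n) (Z n) - form (Z n) (Z m)) \<le> seminorm (Z n) * (e / 2)" if "m \<ge> N" for m
      proof -
        have "cmod (form (Z n) (Z n) - form (Z n) (Z m)) \<le> seminorm (Z n) * seminorm (Z n - Z m)"
          using form_Cauchy_Schwarz[of "Z n" "Z n - Z m"] by (simp add: form_simps)
        also have "\<dots> \<le> seminorm (Z n) * (e / 2)"
          using N[OF n that] by (intro mult_left_mono) auto
        finally show ?thesis .
      qed
      then show "\<exists>M. \<forall>m\<ge>M. cmod (form (Z n) (Z n) - form (Z n) (Z m)) \<le> seminorm (Z n) * (e / 2)"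
        by blast
    qed
    then have "seminorm (Z n) * seminorm (Z n) \<le> seminorm (Z n) * (e / 2)"
      by (simp add: form_self norm_power power2_eq_square norm_mult)
    then have "seminorm (Z n) \<le> e / 2"
      using \<open>e > 0\<close> seminorm_nonneg[of "Z n"] by (cases "seminorm (Z n) = 0") auto
    then show ?thesis using \<open>e > 0\<close> by simp
  qed
  then show "\<exists>N. \<forall>n\<ge>N. norm (seminorm (Z n) - 0) < e" by auto
qed

text \<open>Two representatives of one functional differ by a representative of 0, whose seminorm
  tends to 0.\<close>

lemma gns_ip_limit:
  assumes X: "represents X \<phi>" and Y: "represents Y \<psi>"
  shows "(\<lambda>n. form (X n) (Y n)) \<longlonglongrightarrow> gns_ip \<phi> \<psi>"
proof -
  let ?X = "representative \<phi>" and ?Y = "representative \<psi>"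
  have X': "represents ?X \<phi>" unfolding representative_def using X by (rule someI[of "\<lambda>X. represents X \<phi>" X])
  have Y': "represents ?Y \<psi>" unfolding representative_def using Y by (rule someI[of "\<lambda>Y. represents Y \<psi>" Y])
  have cX: "cauchy X" "cauchy ?X" and cY: "cauchy Y" "cauchy ?Y"
    using X Y X' Y' by (auto simp: represents_def)
  obtain A B where A: "\<And>n. seminorm (?X n) \<le> A" and B: "\<And>n. seminorm (Y n) \<le> B"
    using cauchy_bounded[OF cX(2)] cauchy_bounded[OF cY(1)] by metis
  have 0: "(\<lambda>n. seminorm (X n - ?X n) * B + A * seminorm (Y n - ?Y n)) \<longlonglongrightarrow> 0"
    using represents_diff[OF X X'] represents_diff[OF Y Y']
    by (intro tendsto_add_zero tendsto_mult_left_zero tendsto_mult_right_zero represents_zero_seminorm) auto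
  have "\<forall>\<^sub>F n in sequentially. norm (form (X n) (Y n) - form (?X n) (?Y n))
      \<le> seminorm (X n - ?X n) * B + A * seminorm (Y n - ?Y n)"
  proof (intro always_eventually allI)
    fix n
    show "norm (form (X n) (Y n) - form (?X n) (?Y n))
      \<le> seminorm (X n - ?X n) * B + A * seminorm (Y n - ?Y n)"
      using A B by (intro order_trans[OF form_diff_le] add_mono mult_left_mono mult_right_mono) auto
  qed
  from Lim_null_comparison[OF this 0]
  have "(\<lambda>n. form (X n) (Y n) - form (?X n) (?Y n)) \<longlonglongrightarrow> 0" .
  moreover have "(\<lambda>n. form (?X n) (?Y n)) \<longlonglongrightarrow> gns_ip \<phi> \<psi>"
    unfolding gns_ip_def using convergent_form2[OF cX(2) cY(2)] by (simp add: convergent_LIMSEQ_iff)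
  ultimately show ?thesis by (rule Lim_transform[rotated])
qed

lemma gns_norm_limit:
  assumes "represents X \<phi>"
  shows "(\<lambda>n. seminorm (X n)) \<longlonglongrightarrow> gns_norm \<phi>"
  unfolding seminorm_def gns_norm_def
  by (intro tendsto_real_sqrt tendsto_Re gns_ip_limit assms)

lemma gns_norm_triangle: "\<phi> \<in> gns_space \<Longrightarrow> \<psi> \<in> gns_space \<Longrightarrow> gns_norm (\<phi> + \<psi>) \<le> gns_norm \<phi> + gns_norm \<psi>"
proof (elim gns_spaceE)
  fix X Y assume XY: "represents X \<phi>" "represents Y \<psi>"
  show ?thesis
    by (rule LIMSEQ_le[OF gns_norm_limit[OF represents_add[OF XY]]
          tendsto_add[OF gns_norm_limit[OF XY(1)] gns_norm_limit[OF XY(2)]]])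
       (simp add: seminorm_triangle)
qed

lemma gns_norm_vector: "gns_norm (gns_vector a) = seminorm a"
proof (rule LIMSEQ_unique)
  show "(\<lambda>n. seminorm a) \<longlonglongrightarrow> gns_norm (gns_vector a)"
    by (rule gns_norm_limit[OF represents_gns_vector])
qed (rule tendsto_const)

lemma gns_norm_diff_commute: "\<phi> \<in> gns_space \<Longrightarrow> \<psi> \<in> gns_space \<Longrightarrow> gns_norm (\<phi> - \<psi>) = gns_norm (\<psi> - \<phi>)"
proof (elim gns_spaceE)
  fix X Y assume r: "represents X \<phi>" "represents Y \<psi>"
  show ?thesis
  proof (rule LIMSEQ_unique)
    show "(\<lambda>n. seminorm (X n - Y n)) \<longlonglongrightarrow> gns_norm (\<phi> - \<psi>)"
      by (intro gns_norm_limit represents_diff r)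
    show "(\<lambda>n. seminorm (X n - Y n)) \<longlonglongrightarrow> gns_norm (\<psi> - \<phi>)"
      by (subst seminorm_diff_commute) (intro gns_norm_limit represents_diff r)
  qed
qed

lemma represents_tendsto:
  assumes X: "represents X \<phi>" and "0 < e"
  obtains N where "\<And>n. N \<le> n \<Longrightarrow> gns_norm (gns_vector (X n) - \<phi>) < e"
proof -
  have "e / 2 > 0" using \<open>0 < e\<close> by simp
  then obtain N where N: "\<And>m n. N \<le> m \<Longrightarrow> N \<le> n \<Longrightarrow> seminorm (X m - X n) < e / 2"
    using cauchyD X by (metis represents_def)
  have "gns_norm (gns_vector (X n) - \<phi>) < e" if n: "n \<ge> N" for n
  proof -
    have "(\<lambda>m. seminorm (X n - X m)) \<longlonglongrightarrow> gns_norm (gns_vector (X n) - \<phi>)"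
      by (intro gns_norm_limit represents_diff X represents_gns_vector)
    then have "gns_norm (gns_vector (X n) - \<phi>) \<le> e / 2"
      using N[OF n] by (intro LIMSEQ_le_const2[of "\<lambda>m. seminorm (X n - X m)"]) (auto intro: less_imp_le)
    then show ?thesis using \<open>0 < e\<close> by simp
  qed
  then show ?thesis using that by blast
qed

text \<open>A diagonal argument: algebra elements z n within 1 / (n + 1) of \<Phi> n form a Cauchy
  sequence, and the functional it represents is the limit.\<close>

lemma gns_complete:
  assumes \<Phi>: "\<And>n. \<Phi> n \<in> gns_space"
    and cau: "\<And>e. e > 0 \<Longrightarrow> \<exists>N. \<forall>m\<ge>N. \<forall>n\<ge>N. gns_norm (\<Phi> m - \<Phi> n) < e"
  shows "\<exists>l\<in>gns_space. (\<lambda>n. gns_norm (\<Phi> n - l)) \<longlonglongrightarrow> 0"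
proof -
  have "\<exists>a. gns_norm (gns_vector a - \<Phi> n) < 1 / real (Suc n)" for n
  proof -
    obtain X where X: "represents X (\<Phi> n)" using \<Phi> gns_spaceE by blast
    show ?thesis using represents_tendsto[OF X, of "1 / real (Suc n)"] by (metis order_refl zero_less_divide_1_iff of_nat_0_less_iff zero_less_Suc)
  qed
  then obtain z where z: "\<And>n. gns_norm (gns_vector (z n) - \<Phi> n) < 1 / real (Suc n)" by metis
  have vec_diff: "gns_vector a - gns_vector b = gns_vector (a - b)" for a b
    by (auto simp: gns_vector_def form_simps)
  have cz: "cauchy z"
    unfolding cauchy_def
  proof (intro allI impI)
    fix e :: real assume e: "e > 0"
    obtain N where N: "\<forall>m\<ge>N. \<forall>n\<ge>N. gns_norm (\<Phi> m - \<Phi> n) < e / 3" using cau[of "e / 3"] e by auto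
    obtain M where M: "inverse (real (Suc M)) < e / 3" using reals_Archimedean[of "e / 3"] e by auto
    have "seminorm (z m - z n) < e" if mn: "m \<ge> max M N" "n \<ge> max M N" for m n
    proof -
      have "gns_vector (z m - z n) = (gns_vector (z m) - \<Phi> m) + ((\<Phi> m - \<Phi> n) + (\<Phi> n - gns_vector (z n)))"
        by (simp add: vec_diff[symmetric])
      then have "seminorm (z m - z n) \<le> gns_norm (gns_vector (z m) - \<Phi> m) +
          (gns_norm (\<Phi> m - \<Phi> n) + gns_norm (\<Phi> n - gns_vector (z n)))"
        unfolding gns_norm_vector[symmetric]
        by (simp only:) (intro order_trans[OF gns_norm_triangle] add_mono order_refl gns_space_closed \<Phi> gns_norm_triangle)
      moreover have "1 / real (Suc m) \<le> 1 / real (Suc M)" "1 / real (Suc n) \<le> 1 / real (Suc M)"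
        using mn by (auto simp: divide_simps)
      ultimately show ?thesis
        using z[of m] z[of n] N mn M gns_norm_diff_commute[OF \<Phi>[of n] gns_space_closed(5)[of "z n"]]
        by (fastforce simp: inverse_eq_divide)
    qed
    then show "\<exists>N. \<forall>m\<ge>N. \<forall>n\<ge>N. seminorm (z m - z n) < e" by blast
  qed
  define l where "l a = lim (\<lambda>n. form a (z n))" for a
  have rl: "represents z l"
    using cz convergent_form[OF cz] by (simp add: represents_def l_def convergent_LIMSEQ_iff)
  then have l: "l \<in> gns_space" by (rule gns_spaceI)
  have "(\<lambda>n. gns_norm (\<Phi> n - l)) \<longlonglongrightarrow> 0"
  proof (rule LIMSEQ_I)
    fix e :: real assume e: "e > 0"
    then have "e / 2 > 0" by simp
    then obtain N where N: "\<And>n. N \<le> n \<Longrightarrow> gns_norm (gns_vector (z n) - l) < e / 2"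
      using represents_tendsto[OF rl] by metis
    obtain M where M: "inverse (real (Suc M)) < e / 2" using reals_Archimedean[of "e / 2"] e by auto
    have "norm (gns_norm (\<Phi> n - l) - 0) < e" if n: "n \<ge> max M N" for n
    proof -
      have "\<Phi> n - l = (\<Phi> n - gns_vector (z n)) + (gns_vector (z n) - l)" by simp
      then have "gns_norm (\<Phi> n - l) \<le> gns_norm (\<Phi> n - gns_vector (z n)) + gns_norm (gns_vector (z n) - l)"
        using gns_norm_triangle[of "\<Phi> n - gns_vector (z n)" "gns_vector (z n) - l"] \<Phi> l
        by (simp add: gns_space_closed)
      moreover have "1 / real (Suc n) \<le> 1 / real (Suc M)" using n by (auto simp: divide_simps)
      moreover have "0 \<le> gns_norm (\<Phi> n - l)"
      proof -
        obtain X where "represents X (\<Phi> n - l)" using gns_space_closed(3)[OF \<Phi> l] gns_spaceE by blast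
        from LIMSEQ_le_const[OF gns_norm_limit[OF this], of 0] show ?thesis by auto
      qed
      ultimately show ?thesis
        using z[of n] N[of n] n M gns_norm_diff_commute[OF \<Phi>[of n] gns_space_closed(5)[of "z n"]]
        by (simp add: inverse_eq_divide)
    qed
    then show "\<exists>N. \<forall>n\<ge>N. norm (gns_norm (\<Phi> n - l) - 0) < e" by blast
  qed
  then show ?thesis using l by blast
qed

abbreviation fun_scale :: "complex \<Rightarrow> ('a \<Rightarrow> complex) \<Rightarrow> 'a \<Rightarrow> complex" where
  "fun_scale \<equiv> \<lambda>c \<phi> a. c * \<phi> a"

lemma complex_hilbert_space_gns: "complex_hilbert_space fun_scale gns_space gns_ip"
proof -
  have vs: "vector_space fun_scale"
    by unfold_locales (auto simp: fun_eq_iff algebra_simps)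
  interpret F: vector_space fun_scale by (rule vs)
  show ?thesis
  proof (rule complex_hilbert_space.intro[OF vs], unfold_locales)
    show "F.subspace gns_space" by (intro F.subspaceI gns_space_closed)
  next
    fix \<phi> \<psi> \<omega> assume "\<phi> \<in> gns_space" "\<psi> \<in> gns_space" "\<omega> \<in> gns_space"
    then obtain X Y Z where r: "represents X \<phi>" "represents Y \<psi>" "represents Z \<omega>"
      by (metis gns_spaceE)
    have "(\<lambda>n. form (X n) (Y n) + form (X n) (Z n)) \<longlonglongrightarrow> gns_ip \<phi> \<psi> + gns_ip \<phi> \<omega>"
      by (intro tendsto_add gns_ip_limit r)
    then show "gns_ip \<phi> (\<psi> + \<omega>) = gns_ip \<phi> \<psi> + gns_ip \<phi> \<omega>"
      using LIMSEQ_unique[OF gns_ip_limit[OF r(1) represents_add[OF r(2,3)]]] by (simp add: form_simps)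
  next
    fix \<phi> \<psi> and c :: complex assume "\<phi> \<in> gns_space" "\<psi> \<in> gns_space"
    then obtain X Y where r: "represents X \<phi>" "represents Y \<psi>" by (metis gns_spaceE)
    have "(\<lambda>n. c * form (X n) (Y n)) \<longlonglongrightarrow> c * gns_ip \<phi> \<psi>"
      by (intro tendsto_mult_left gns_ip_limit r)
    then show "gns_ip \<phi> (\<lambda>a. c * \<psi> a) = c * gns_ip \<phi> \<psi>"
      using LIMSEQ_unique[OF gns_ip_limit[OF r(1) represents_scale[OF r(2), of c]]] by (simp add: form_simps)
  next
    fix \<phi> \<psi> assume "\<phi> \<in> gns_space" "\<psi> \<in> gns_space"
    then obtain X Y where r: "represents X \<phi>" "represents Y \<psi>" by (metis gns_spaceE)
    have "(\<lambda>n. form (Y n) (X n)) \<longlonglongrightarrow> cnj (gns_ip \<phi> \<psi>)"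
      by (subst form_cnj) (intro tendsto_cnj gns_ip_limit r)
    then show "gns_ip \<psi> \<phi> = cnj (gns_ip \<phi> \<psi>)"
      using LIMSEQ_unique[OF gns_ip_limit[OF r(2,1)]] by simp
  next
    fix \<phi> assume "\<phi> \<in> gns_space"
    then obtain X where r: "represents X \<phi>" by (metis gns_spaceE)
    show "0 \<le> Re (gns_ip \<phi> \<phi>)"
      by (rule LIMSEQ_le_const[OF tendsto_Re[OF gns_ip_limit[OF r r]]]) (simp add: form_self_nonneg)
  next
    fix \<phi> assume "\<phi> \<in> gns_space" and 0: "gns_ip \<phi> \<phi> = 0"
    then obtain X where r: "represents X \<phi>" by (metis gns_spaceE)
    have lim: "(\<lambda>n. seminorm (X n)) \<longlonglongrightarrow> 0" using gns_norm_limit[OF r] 0 by (simp add: gns_norm_def)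
    have "\<phi> a = 0" for a
    proof -
      have "(\<lambda>n. form a (X n)) \<longlonglongrightarrow> 0"
        by (rule Lim_null_comparison[OF always_eventually tendsto_mult_right_zero[OF lim, of "seminorm a"]])
           (simp add: form_Cauchy_Schwarz)
      then show ?thesis using r LIMSEQ_unique by (auto simp: represents_def)
    qed
    then show "\<phi> = 0" by auto
  next
    fix \<Phi> :: "nat \<Rightarrow> 'a \<Rightarrow> complex"
    assume "\<forall>n. \<Phi> n \<in> gns_space"
      and "\<forall>e>0. \<exists>N. \<forall>m\<ge>N. \<forall>n\<ge>N. sqrt (Re (gns_ip (\<Phi> m - \<Phi> n) (\<Phi> m - \<Phi> n))) < e"
    then show "\<exists>l\<in>gns_space. (\<lambda>n. sqrt (Re (gns_ip (\<Phi> n - l) (\<Phi> n - l)))) \<longlonglongrightarrow> 0"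
      using gns_complete[of \<Phi>] unfolding gns_norm_def by blast
  qed
qed

sublocale gns: complex_hilbert_space fun_scale gns_space gns_ip
  by (rule complex_hilbert_space_gns)

section \<open>The GNS representation\<close>

lemma star_representation_gns: "gns.star_representation gns_rep"
  unfolding gns.star_representation_def gns.bounded_operator_def
proof (intro conjI allI ballI)
  fix a show "\<phi> \<in> gns_space \<Longrightarrow> gns_rep a \<phi> \<in> gns_space" for \<phi> by (rule gns_space_closed(6))
  show "\<exists>C. \<forall>\<phi>\<in>gns_space. gns.hnorm (gns_rep a \<phi>) \<le> C * gns.hnorm \<phi>"
  proof (intro exI ballI)
    fix \<phi> assume "\<phi> \<in> gns_space"
    then obtain X where r: "represents X \<phi>" by (metis gns_spaceE)
    have "gns_norm (gns_rep a \<phi>) \<le> norm a * gns_norm \<phi>"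
      by (rule LIMSEQ_le[OF gns_norm_limit[OF represents_gns_rep[OF r]] tendsto_mult_left[OF gns_norm_limit[OF r]]])
         (simp add: seminorm_mult)
    then show "gns.hnorm (gns_rep a \<phi>) \<le> norm a * gns.hnorm \<phi>"
      by (simp add: gns.hnorm_def gns_norm_def)
  qed
  show "gns_rep a (\<phi> + \<psi>) = gns_rep a \<phi> + gns_rep a \<psi>" for \<phi> \<psi>
    by (auto simp: gns_rep_def)
  show "gns_rep a (fun_scale c \<phi>) = fun_scale c (gns_rep a \<phi>)" for c \<phi>
    by (auto simp: gns_rep_def)
  fix \<phi> assume "\<phi> \<in> gns_space"
  then obtain X where r: "represents X \<phi>" by (metis gns_spaceE)
  \<comment> \<open>A sequence represents at most one functional, so linearity in a is read off from
    representatives.\<close>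
  have eq: "\<psi> = \<psi>'" if "represents Y \<psi>" "represents Y \<psi>'" for Y \<psi> \<psi>'
    using that LIMSEQ_unique by (fastforce simp: represents_def)
  show "gns_rep (a + b) \<phi> = gns_rep a \<phi> + gns_rep b \<phi>" for b
    using represents_gns_rep[OF r, of "a + b"]
      represents_add[OF represents_gns_rep[OF r, of a] represents_gns_rep[OF r, of b]]
    by (intro eq) (auto simp: distrib_right)
  show "gns_rep (scaleC c a) \<phi> = fun_scale c (gns_rep a \<phi>)" for c
    using represents_gns_rep[OF r, of "scaleC c a"] represents_scale[OF represents_gns_rep[OF r, of a], of c]
    by (intro eq) (auto simp: mult_scaleC_left)
  show "gns_rep (a * b) \<phi> = gns_rep a (gns_rep b \<phi>)" for b
    by (auto simp: gns_rep_def star_mult mult.assoc)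
  fix \<psi> assume "\<psi> \<in> gns_space"
  then obtain Y where s: "represents Y \<psi>" by (metis gns_spaceE)
  show "gns_ip (gns_rep (star a) \<phi>) \<psi> = gns_ip \<phi> (gns_rep a \<psi>)"
    using LIMSEQ_unique[OF gns_ip_limit[OF represents_gns_rep[OF r, of "star a"] s]]
      gns_ip_limit[OF r represents_gns_rep[OF s, of a]]
    by (simp add: form_simps(9))
qed

text \<open>Reproducing property: in particular, a vector orthogonal to every
  \<open>gns_vector a\<close> is zero.\<close>

lemma gns_ip_vector: "\<phi> \<in> gns_space \<Longrightarrow> gns_ip (gns_vector a) \<phi> = \<phi> a"
proof (elim gns_spaceE)
  fix X assume r: "represents X \<phi>"
  show ?thesis
  proof (rule LIMSEQ_unique)
    show "(\<lambda>n. form a (X n)) \<longlonglongrightarrow> gns_ip (gns_vector a) \<phi>"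
      by (rule gns_ip_limit[OF represents_gns_vector r])
    show "(\<lambda>n. form a (X n)) \<longlonglongrightarrow> \<phi> a" using r by (simp add: represents_def)
  qed
qed

lemma gns_rep_vector: "gns_rep a (gns_vector b) = gns_vector (a * b)"
  by (auto simp: gns_rep_def gns_vector_def form_simps)

end

section \<open>Primitive ideals separate closed ideals\<close>

context complex_hilbert_space
begin

lemma
  assumes "star_representation \<pi>"
  shows rep_add: "x \<in> H \<Longrightarrow> \<pi> (a + b) x = \<pi> a x + \<pi> b x"
    and rep_scaleC: "x \<in> H \<Longrightarrow> \<pi> (scaleC c a) x = scale c (\<pi> a x)"
    and rep_add_right: "x \<in> H \<Longrightarrow> y \<in> H \<Longrightarrow> \<pi> a (x + y) = \<pi> a x + \<pi> a y"
  using assms unfolding star_representation_def bounded_operator_def by blast+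

lemma state_vector:
  fixes \<pi> :: "'a::cstar_algebra_1 \<Rightarrow> _"
  assumes rep: "star_representation \<pi>" and one: "\<pi> 1 k = k" and k: "k \<in> H" "k \<noteq> 0"
  shows "state (\<lambda>a. ip k (\<pi> a k) / Re (ip k k))"
proof
  have r0: "Re (ip k k) \<noteq> 0" using ip_definite[OF k(1)] k(2) ip_self[OF k(1)] by auto
  have pos: "ip k (\<pi> (star a * a) k) = complex_of_real (Re (ip (\<pi> a k) (\<pi> a k)))" for a
    using rep k(1) ip_self[of "\<pi> a k"] by (simp add: rep_mult rep_adj[symmetric] star_star)
  show "ip k (\<pi> (a + b) k) / Re (ip k k) = ip k (\<pi> a k) / Re (ip k k) + ip k (\<pi> b k) / Re (ip k k)" for a b
    using rep k(1) by (simp add: rep_add ip_add add_divide_distrib)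
  show "ip k (\<pi> (scaleC c a) k) / Re (ip k k) = c * (ip k (\<pi> a k) / Re (ip k k))" for c a
    using rep k(1) by (simp add: rep_scaleC ip_scale)
  show "ip k (\<pi> 1 k) / Re (ip k k) = 1"
    using r0 ip_self[OF k(1)] by (metis divide_self of_real_eq_0_iff one)
  show "0 \<le> Re (ip k (\<pi> (star a * a) k) / Re (ip k k))" for a
    unfolding pos using k(1) rep ip_nonneg by (simp flip: of_real_divide)
  show "Im (ip k (\<pi> (star a * a) k) / Re (ip k k)) = 0" for a
    unfolding pos by (simp flip: of_real_divide)
qed

end

context state
begin

lemma gns_rep_one: "gns_rep 1 \<phi> = \<phi>"
  by (auto simp: gns_rep_def)

text \<open>The coefficients of j v are limits of values of f at \<open>star b * j * X n\<close>,
  which lie in the two-sided ideal J.\<close>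

lemma gns_rep_ideal:
  assumes J: "closed_ideal J" and fJ: "\<And>j. j \<in> J \<Longrightarrow> f j = 0" and j: "j \<in> J" and \<phi>: "\<phi> \<in> gns_space"
  shows "gns_rep j \<phi> = 0"
proof -
  obtain X where X: "represents X \<phi>" using \<phi> gns_spaceE by blast
  have "\<phi> (star j * b) = 0" for b
  proof -
    have "star b * j * X n \<in> J" for n using J j by (simp add: closed_ideal_def)
    then have "form (star j * b) (X n) = 0" for n using fJ by (simp add: form_def star_mult star_star)
    moreover have "(\<lambda>n. form (star j * b) (X n)) \<longlonglongrightarrow> \<phi> (star j * b)" using X by (simp add: represents_def)
    ultimately show ?thesis by (simp add: LIMSEQ_const_iff)
  qed
  then show ?thesis by (auto simp: gns_rep_def)
qed

text \<open>
  The components of the cyclic vector in an invariant subspace and its complement write \<open>f\<close> as a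
  convex combination of two vector states.
\<close>

lemma gns_irreducible:
  assumes J: "closed_ideal J" and fJ: "\<And>j. j \<in> J \<Longrightarrow> f j = 0"
    and pure: "\<And>g h t. state g \<Longrightarrow> state h \<Longrightarrow> (\<And>j. j \<in> J \<Longrightarrow> g j = 0) \<Longrightarrow> (\<And>j. j \<in> J \<Longrightarrow> h j = 0) \<Longrightarrow>
      0 < t \<Longrightarrow> t < 1 \<Longrightarrow> (\<And>a. f a = of_real t * g a + of_real (1 - t) * h a) \<Longrightarrow> g = f"
    and K: "gns.closed_subspace K" and inv: "\<And>a \<phi>. \<phi> \<in> K \<Longrightarrow> gns_rep a \<phi> \<in> K"
  shows "K = {0} \<or> K = gns_space"
proof -
  note rep = star_representation_gns
  define \<xi> where "\<xi> = gns_vector 1"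
  have \<xi>: "\<xi> \<in> gns_space" by (simp add: \<xi>_def gns_space_closed)
  have a\<xi>: "gns_rep a \<xi> = gns_vector a" for a by (simp add: \<xi>_def gns_rep_vector)
  have KH: "\<And>\<phi>. \<phi> \<in> K \<Longrightarrow> \<phi> \<in> gns_space" and sub: "gns.subspace K"
    using K by (auto simp: gns.closed_subspace_def)
  obtain k where k: "k \<in> K" and orth: "\<And>y. y \<in> K \<Longrightarrow> gns_ip y (\<xi> - k) = 0"
    using gns.exists_projection[OF K \<xi>] by blast
  define l where "l = \<xi> - k"
  have kH: "k \<in> gns_space" and lH: "l \<in> gns_space" using k KH \<xi> by (auto simp: l_def)
  have \<xi>kl: "\<xi> = k + l" by (simp add: l_def)
  have Kl: "gns_ip y l = 0" and lK: "gns_ip l y = 0" if "y \<in> K" for y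
    using orth[OF that] gns.ip_cnj[OF KH[OF that] lH] by (auto simp: l_def)
  \<comment> \<open>Invariance of K moves a onto k, so the cross terms vanish and the vector state
    splits.\<close>
  have kl: "gns_ip k (gns_rep a l) = 0" for a
    using Kl[OF inv[OF k, of "star a"]] gns.rep_adj[OF rep kH lH, of a] by simp
  have k\<xi>: "gns_ip k (gns_rep a k) = gns_ip k (gns_vector a)" for a
    unfolding a\<xi>[symmetric] \<xi>kl gns.rep_add_right[OF rep kH lH]
    using kH lH by (simp add: gns.ip_add gns_space_closed kl)
  have decomp: "f a = gns_ip k (gns_rep a k) + gns_ip l (gns_rep a l)" for a
  proof -
    have "f a = gns_ip \<xi> (gns_rep a \<xi>)"
      unfolding a\<xi> by (simp add: \<xi>_def gns_ip_vector gns_space_closed) (simp add: gns_vector_def form_def)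
    also have "\<dots> = gns_ip k (gns_rep a \<xi>) + gns_ip l (gns_rep a \<xi>)"
      using gns.ip_cnj[of "gns_rep a \<xi>"] kH lH \<xi>
      by (simp add: \<xi>kl gns.ip_add gns_space_closed)
    also have "gns_ip l (gns_rep a \<xi>) = gns_ip l (gns_rep a l)"
      unfolding \<xi>kl gns.rep_add_right[OF rep kH lH]
      using kH lH lK[OF inv[OF k]] by (simp add: gns.ip_add gns_space_closed)
    finally show ?thesis by (simp add: k\<xi> a\<xi>)
  qed
  consider "k = 0" | "l = 0" | "k \<noteq> 0" "l \<noteq> 0" by blast
  then show ?thesis
  proof cases
    case 1
    have "y = 0" if y: "y \<in> K" for y
    proof -
      have "y a = 0" for a
      proof -
        \<comment> \<open>Here the cyclic vector is orthogonal to K, hence so are all algebra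
          vectors, by invariance.\<close>
        have "y a = gns_ip (gns_rep a \<xi>) y" using KH[OF y] by (simp add: a\<xi> gns_ip_vector)
        also have "\<dots> = gns_ip \<xi> (gns_rep (star a) y)" by (rule gns.rep_adj'[OF rep \<xi> KH[OF y]])
        also have "\<dots> = 0" using lK[OF inv[OF y]] by (simp add: \<xi>kl 1)
        finally show ?thesis .
      qed
      then show ?thesis by auto
    qed
    then show ?thesis using gns.subspace_0[OF sub] by blast
  next
    case 2
    \<comment> \<open>Here the cyclic vector lies in K, so K contains all algebra vectors; a vector
      orthogonal to K then vanishes.\<close>
    have vK: "gns_vector a \<in> K" for a using inv[OF k, of a] \<xi>kl 2 a\<xi>[of a] by simp
    have "\<phi> \<in> K" if \<phi>: "\<phi> \<in> gns_space" for \<phi>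
    proof -
      obtain p where p: "p \<in> K" "\<And>y. y \<in> K \<Longrightarrow> gns_ip y (\<phi> - p) = 0"
        using gns.exists_projection[OF K \<phi>] by blast
      have "(\<phi> - p) a = 0" for a
        using p(2)[OF vK[of a]] gns_ip_vector[OF gns_space_closed(3)[OF \<phi> KH[OF p(1)]], of a] by simp
      then have "\<phi> = p" by (auto simp: fun_eq_iff)
      then show ?thesis using p(1) by simp
    qed
    then show ?thesis using KH by blast
  next
    case 3
    define t where "t = Re (gns_ip k k)"
    have t0: "t > 0"
      using gns.ip_nonneg[OF kH] gns.ip_self[OF kH] gns.ip_definite[OF kH] 3(1) unfolding t_def
      by (metis less_eq_real_def of_real_0)
    have l0: "Re (gns_ip l l) > 0"
      using gns.ip_nonneg[OF lH] gns.ip_self[OF lH] gns.ip_definite[OF lH] 3(2)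
      by (metis less_eq_real_def of_real_0)
    have "1 = gns_ip k k + gns_ip l l" using decomp[of 1] by (simp add: gns_rep_one f_one)
    from arg_cong[OF this, of Re] have tl: "Re (gns_ip l l) = 1 - t" by (simp add: t_def)
    define g where "g a = gns_ip k (gns_rep a k) / complex_of_real t" for a
    define h where "h a = gns_ip l (gns_rep a l) / complex_of_real (1 - t)" for a
    have "state g" "state h"
      using gns.state_vector[OF rep gns_rep_one kH 3(1)] gns.state_vector[OF rep gns_rep_one lH 3(2)]
      unfolding g_def[abs_def] h_def[abs_def] t_def[symmetric] tl by blast+
    moreover have "g j = 0" "h j = 0" if "j \<in> J" for j
      using gns_rep_ideal[OF J fJ that kH] gns_rep_ideal[OF J fJ that lH] kH lH by (simp_all add: g_def h_def)
    moreover have "f a = of_real t * g a + of_real (1 - t) * h a" for a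
      using decomp[of a] t0 l0 tl by (simp add: g_def h_def)
    ultimately have "g = f" using t0 l0 tl by (intro pure[of g h t]) auto
    \<comment> \<open>Purity forces k = t \<xi>; then \<xi> and l lie in K, although l is orthogonal
      to K and non-zero.\<close>
    then have kt: "gns_ip k (gns_vector a) = t * f a" for a
      using t0 k\<xi>[of a] by (auto simp: g_def fun_eq_iff field_simps)
    have "k a = t * \<xi> a" for a
    proof -
      have "k a = cnj (gns_ip k (gns_vector a))"
        using gns_ip_vector[OF kH, of a] gns.ip_cnj[OF kH gns_space_closed(5)[of a]] by simp
      also have "\<dots> = t * f (star a)" by (simp add: kt f_star)
      also have "f (star a) = \<xi> a" by (simp add: \<xi>_def gns_vector_def form_def)
      finally show ?thesis .
    qed
    then have "\<xi> = (\<lambda>a. (1 / t) * k a)" using t0 by (auto simp: fun_eq_iff)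
    then have "\<xi> \<in> K" using gns.subspace_scale[OF sub k, of "1 / t"] by simp
    then have "l \<in> K" unfolding l_def using k by (rule gns.subspace_diff[OF sub])
    then have "gns_ip l l = 0" by (rule Kl)
    then show ?thesis using l0 by simp
  qed
qed

end

text \<open>The GNS representation of the unitization stays irreducible on the algebra, since
  scalars preserve every subspace. The image of x moves the cyclic vector to one of squared norm f
  at \<open>star x * x\<close>, which is non-zero.\<close>

lemma exists_Prim_separating:
  fixes J :: "'a::cstar_algebra set"
  assumes J: "closed_ideal J" and x: "x \<notin> J"
  obtains P where "P \<in> Prim" "J \<subseteq> P" "x \<notin> P"
proof -
  let ?\<iota> = "embed_unitization :: 'a \<Rightarrow> 'a unitization"
  have J': "closed_ideal (?\<iota> ` J)" by (rule closed_ideal_embed_unitization[OF J])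
  have x': "?\<iota> x \<notin> ?\<iota> ` J" using x by (auto simp: embed_unitization_def)
  obtain f where f: "state f" and fJ: "\<And>j. j \<in> ?\<iota> ` J \<Longrightarrow> f j = 0"
    and fx: "f (star (?\<iota> x) * ?\<iota> x) \<noteq> 0"
    and pure: "\<And>g h t. state g \<Longrightarrow> state h \<Longrightarrow> (\<And>j. j \<in> ?\<iota> ` J \<Longrightarrow> g j = 0) \<Longrightarrow>
      (\<And>j. j \<in> ?\<iota> ` J \<Longrightarrow> h j = 0) \<Longrightarrow> 0 < t \<Longrightarrow> t < 1 \<Longrightarrow>
      (\<And>a. f a = of_real t * g a + of_real (1 - t) * h a) \<Longrightarrow> g = f"
    using exists_pure_state[OF J' x'] by blast
  interpret state f by (rule f)
  note rep = star_representation_gns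
  define \<rho> where "\<rho> a = gns_rep (?\<iota> a)" for a
  have rep': "gns.star_representation \<rho>"
    using rep unfolding gns.star_representation_def \<rho>_def embed_unitization_hom by blast
  have nx: "\<rho> x (gns_vector 1) \<noteq> 0"
  proof
    assume "\<rho> x (gns_vector 1) = 0"
    then have "gns_vector (?\<iota> x) = 0" by (simp add: \<rho>_def gns_rep_vector)
    then have "gns_vector (?\<iota> x) (?\<iota> x) = 0" by simp
    then show False using fx by (simp add: gns_vector_def form_def)
  qed
  have xk: "x \<notin> gns.rep_kernel \<rho>"
    using nx by (auto simp: gns.rep_kernel_def gns_space_closed)
  have "K = {0} \<or> K = gns_space"
    if K: "gns.closed_subspace K" "\<forall>a. \<forall>\<phi>\<in>K. \<rho> a \<phi> \<in> K" for K
  proof (rule gns_irreducible[OF J' fJ pure K(1)])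
    have sub: "gns.subspace K" and KH: "\<And>\<phi>. \<phi> \<in> K \<Longrightarrow> \<phi> \<in> gns_space"
      using K(1) by (auto simp: gns.closed_subspace_def)
    fix u \<phi> assume \<phi>: "\<phi> \<in> K"
    have "gns_rep u \<phi> = \<rho> (alg_part u) \<phi> + (\<lambda>a. scalar_part u * \<phi> a)"
      using KH[OF \<phi>] rep
      by (subst unitization_decompose[of u]) (simp add: gns.rep_add gns.rep_scaleC gns_rep_one \<rho>_def plus_fun_def)
    then show "gns_rep u \<phi> \<in> K"
      using K(2) \<phi> gns.subspace_add[OF sub _ gns.subspace_scale[OF sub \<phi>]] by simp
  qed auto
  then have "gns.irreducible_rep \<rho>"
    using rep' xk unfolding gns.irreducible_rep_def by blast
  then have "primitive_by fun_scale gns_space gns_ip (gns.rep_kernel \<rho>)"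
    unfolding primitive_by_def using complex_hilbert_space_gns by blast
  then have "gns.rep_kernel \<rho> \<in> Prim" by (rule primitive_by_imp_Prim)
  moreover have "J \<subseteq> gns.rep_kernel \<rho>"
    using gns_rep_ideal[OF J' fJ] by (auto simp: gns.rep_kernel_def \<rho>_def)
  ultimately show ?thesis using that xk by blast
qed

section \<open>Regular open sets and regular ideals\<close>

lemma closed_ideal_zero: "closed_ideal {0}"
  by (auto simp: closed_ideal_def complex_subspace_def)

lemma zero_in_Prim: "P \<in> Prim \<Longrightarrow> 0 \<in> P"
proof -
  assume "P \<in> Prim"
  then obtain H :: "('a \<Rightarrow> complex) set" and ip \<pi>
    where hs: "complex_hilbert_space (\<lambda>c f x. c * f x) H ip"
      and irr: "complex_hilbert_space.irreducible_rep (\<lambda>c f x. c * f x) H ip \<pi>"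
      and P: "P = complex_hilbert_space.rep_kernel H \<pi>"
    unfolding Prim_def primitive_by_def by auto
  interpret complex_hilbert_space "\<lambda>c f x. c * f x" H ip by (rule hs)
  have rep: "star_representation \<pi>" using irr by (simp add: irreducible_rep_def)
  have "\<pi> 0 v = 0" if "v \<in> H" for v
    using rep_scaleC[OF rep that, of 0 0] by auto
  then show ?thesis by (simp add: P rep_kernel_def)
qed

lemma eq_zero_if_in_all_Prim:
  assumes "\<And>P. P \<in> Prim \<Longrightarrow> a \<in> P"
  shows "a = 0"
  using exists_Prim_separating[OF closed_ideal_zero, of a] assms by blast

lemma closed_ideal_perp:
  fixes X :: "'a::cstar_algebra set"
  assumes "\<And>a x. x \<in> X \<Longrightarrow> a * x \<in> X \<and> x * a \<in> X"
  shows "closed_ideal (perp X)"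
  unfolding closed_ideal_def
proof (intro conjI allI ballI)
  show "complex_subspace (perp X)"
    by (auto simp: complex_subspace_def perp_def distrib_left distrib_right mult_scaleC_left mult_scaleC_right)
  have "perp X = (\<Inter>x\<in>X. {a. a * x = 0} \<inter> {a. x * a = 0})" by (auto simp: perp_def)
  also have "closed \<dots>"
    by (intro closed_INT ballI closed_Int closed_Collect_eq continuous_intros)
  finally show "closed (perp X)" .
  fix a y assume y: "y \<in> perp X"
  have "a * y * x = 0" "x * (a * y) = 0" "y * a * x = 0" "x * (y * a) = 0" if "x \<in> X" for x
  proof -
    have 1: "y * z = 0" "z * y = 0" if "z \<in> X" for z using y that by (auto simp: perp_def)
    show "a * y * x = 0" "y * a * x = 0" using 1 assms that by (auto simp: mult.assoc)
    show "x * (a * y) = 0" "x * (y * a) = 0" using 1 assms that by (auto simp: mult.assoc[symmetric])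
  qed
  then show "a * y \<in> perp X" "y * a \<in> perp X" by (auto simp: perp_def)
qed

text \<open>If a lies outside some P in V, choose i in the ideal but not in P; primeness gives b
  with a b i outside P, while a annihilates b i. Conversely, products of the two intersections lie
  in every primitive ideal, hence vanish.\<close>

lemma perp_Inter_complement:
  fixes V :: "'a::cstar_algebra set set"
  assumes V: "openin hull_kernel_topology V"
  shows "perp (\<Inter>(Prim - V)) = \<Inter>V"
proof (intro equalityI subsetI)
  let ?I = "\<Inter>(Prim - V)"
  obtain S where S: "V = Prim - hull_of S" using V by (auto simp: openin_hull_kernel)
  fix a assume a: "a \<in> perp ?I"
  show "a \<in> \<Inter>V"
  proof
    fix P assume P: "P \<in> V"
    then obtain i where i: "i \<in> S" "i \<notin> P" and PP: "P \<in> Prim" by (auto simp: S hull_of_def)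
    have iI: "i \<in> ?I" using i(1) by (auto simp: S hull_of_def)
    show "a \<in> P"
    proof (rule ccontr)
      assume "a \<notin> P"
      then obtain b where b: "a * b * i \<notin> P" using Prim_prime[OF PP _ i(2)] by blast
      have "b * i \<in> ?I" using iI Prim_ideal by blast
      then have "a * (b * i) = 0" using a by (simp add: perp_def)
      then show False using b zero_in_Prim[OF PP] by (simp add: mult.assoc)
    qed
  qed
next
  fix a assume a: "a \<in> \<Inter>V"
  have "a * i = 0 \<and> i * a = 0" if i: "i \<in> \<Inter>(Prim - V)" for i
  proof -
    have "a * i \<in> P \<and> i * a \<in> P" if "P \<in> Prim" for P
      using a i that Prim_ideal[OF that] by (cases "P \<in> V") auto
    then show ?thesis using eq_zero_if_in_all_Prim by blast
  qed
  then show "a \<in> perp (\<Inter>(Prim - V))" by (auto simp: perp_def)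
qed

text \<open>The closure is the hull of the intersection, so it adds only ideals that contain this
  intersection.\<close>

lemma Inter_closure_of_hull_kernel:
  assumes "R \<subseteq> Prim"
  shows "\<Inter>(hull_kernel_topology closure_of R) = \<Inter>R"
  unfolding closure_of_hull_kernel[OF assms] using assms by (auto simp: hull_of_def)

text \<open>Regularity of V says that its complement is the closure of the complement of cl V.
  Applying the annihilator formula to that open complement shows that the ideal is the annihilator
  of the intersection of V, which is itself the annihilator of the ideal.\<close>

lemma regular_ideal_of_regular_open:
  fixes V :: "'a::cstar_algebra set set"
  assumes V: "regular_open hull_kernel_topology V"
  shows "regular_ideal (\<Inter>(Prim - V))"
proof -
  let ?X = "hull_kernel_topology :: 'a set topology"
  let ?C = "?X closure_of V"
  have op: "openin ?X V" and reg: "V = ?X interior_of ?C" using V by (auto simp: regular_open_def)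
  have VP: "V \<subseteq> Prim" using openin_subset[OF op] by simp
  have CP: "?C \<subseteq> Prim" using closure_of_subset_topspace[of ?X V] by simp
  have "Prim - V = ?X closure_of (Prim - ?C)"
    using closure_of_complement[of ?X ?C] reg by simp
  then have "\<Inter>(Prim - V) = \<Inter>(Prim - ?C)"
    using Inter_closure_of_hull_kernel[of "Prim - ?C"] by simp
  moreover have "openin ?X (Prim - ?C)"
    using openin_diff[OF openin_topspace closedin_closure_of, of ?X V] by simp
  then have "perp (\<Inter>(Prim - (Prim - ?C))) = \<Inter>(Prim - ?C)" by (rule perp_Inter_complement)
  moreover have "\<Inter>(Prim - (Prim - ?C)) = \<Inter>V"
    using Inter_closure_of_hull_kernel[OF VP] CP by (simp add: double_diff)
  ultimately have perp: "perp (\<Inter>V) = \<Inter>(Prim - V)" by simp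
  have "closed_ideal (perp (\<Inter>V))"
    using VP Prim_ideal by (intro closed_ideal_perp) blast
  then show ?thesis
    unfolding regular_ideal_def perp_Inter_complement[OF op] by (simp add: perp)
qed

lemma exists_regular_ideal_below:
  fixes J :: "'a::cstar_algebra set"
  assumes semi: "semiregular_space (hull_kernel_topology :: 'a set topology)"
    and J: "closed_ideal J" "J \<noteq> {0}"
  obtains I where "regular_ideal I" "I \<noteq> {0}" "I \<subseteq> J"
proof -
  have "0 \<in> J" using J(1) by (simp add: closed_ideal_def complex_subspace_def)
  then obtain x where x: "x \<in> J" "x \<noteq> 0" using J(2) by blast
  obtain P where P: "P \<in> Prim" "x \<notin> P" using eq_zero_if_in_all_Prim x(2) by blast
  let ?U = "Prim - hull_of J"
  have "openin hull_kernel_topology ?U" by (auto simp: openin_hull_kernel)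
  moreover have PU: "P \<in> ?U" using P x by (auto simp: hull_of_def)
  ultimately obtain V where V: "regular_open hull_kernel_topology V" "P \<in> V" "V \<subseteq> ?U"
    using semi unfolding semiregular_space_def union_of_def by (auto; metis Union_iff Union_upper subset_eq)
  let ?I = "\<Inter>(Prim - V)"
  \<comment> \<open>S lies in every primitive ideal outside V but not in P, so it supplies a
    non-zero element of the ideal.\<close>
  obtain S where S: "V = Prim - hull_of S" using V(1) by (auto simp: regular_open_def openin_hull_kernel)
  obtain i where i: "i \<in> S" "i \<notin> P" using V(2) by (auto simp: S hull_of_def)
  have iI: "i \<in> ?I" using i(1) by (auto simp: S hull_of_def)
  have "?I \<noteq> {0}"
  proof
    assume "?I = {0}"
    with iI have "i \<in> {0}" by (simp only:)
    then show False using i(2) zero_in_Prim[OF P(1)] by simp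
  qed
  moreover have "?I \<subseteq> J"
  proof
    fix y assume y: "y \<in> ?I"
    show "y \<in> J"
    proof (rule ccontr)
      assume "y \<notin> J"
      then obtain Q where Q: "Q \<in> Prim" "J \<subseteq> Q" "y \<notin> Q" using exists_Prim_separating[OF J(1)] by blast
      then have "Q \<in> Prim - V" using V(3) by (auto simp: hull_of_def)
      then show False using y Q(3) by blast
    qed
  qed
  ultimately show ?thesis using that regular_ideal_of_regular_open[OF V(1)] by blast
qed

theorem proposition7p2:
  fixes B :: "'a::cstar_algebra set"
  assumes "cstar_inclusion B"
    and "semiregular_space (hull_kernel_topology :: 'a set topology)"
  shows "ideal_intersection_property B \<longleftrightarrow> regular_ideal_intersection_property B"
proof
  assume "ideal_intersection_property B"
  then show "regular_ideal_intersection_property B"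
    by (auto simp: ideal_intersection_property_def regular_ideal_intersection_property_def regular_ideal_def)
next
  assume reg: "regular_ideal_intersection_property B"
  show "ideal_intersection_property B"
    unfolding ideal_intersection_property_def
  proof (intro allI impI)
    fix J :: "'a set"
    assume "closed_ideal J \<and> J \<noteq> {0}"
    then obtain I where I: "regular_ideal I" "I \<noteq> {0}" "I \<subseteq> J"
      using exists_regular_ideal_below[OF assms(2)] by blast
    then have "I \<inter> B \<noteq> {0}" using reg by (simp add: regular_ideal_intersection_property_def)
    moreover have "0 \<in> I" using I(1) by (simp add: regular_ideal_def closed_ideal_def complex_subspace_def)
    ultimately show "J \<inter> B \<noteq> {0}" using I(3) by blast
  qed
qed

end
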